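(* Let $n\ge 2$ and let $G\subset S^1=\{z\in\mathbb{C}:|z|=1\}$ be any increasing countable union of finite subgroups of $S^1$, equipped with the topology induced from $S^1$. Then there exists a germ $(M,p)$ of a smooth strongly pseudoconvex hypersurface in $\mathbb{C}^n$ such that $\mathrm{Aut}(M,p)$ is topologically isomorphic (isomorphic as a topological group) to $G$. In particular, for any $n\ge2$ there exists a germ $(M,p)$ of a smooth strongly pseudoconvex hypersurface in $\mathbb{C}^n$ such that $\mathrm{Aut}(M,p)$ is topologically isomorphic to a countable dense subgroup of $S^1$ (for instance $\{e^{2\pi i l/2^m} : l,m\in\mathbb{N}\}$), and hence is not a Lie group.
   Context: "Smooth" means $C^\infty$. For a germ $(M,p)$ of a real submanifold of $\mathbb{C}^n$, the local stability group $\mathrm{Aut}(M,p)$ is the group of all germs at $p$ of local biholomorphic maps of $\mathbb{C}^n$ fixing $p$ and preserving the germ $(M,p)$. It is equipped with its natural inductive limit topology, i.e. the topology induced from the space of germs at $p$ of holomorphic maps into $\mathbb{C}^n$, regarded as the inductive limit, over open neighborhoods $U$ of $p$, of the spaces of holomorphic maps $U\to\mathbb{C}^n$ with the topology of uniform convergence on compact sets. *)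

theory Defs
  imports "HOL-Analysis.Analysis" "HOL-Algebra.Group"
begin

section \<open>Holomorphic maps in several variables\<close>

definition holo_on :: "(complex^'n) set \<Rightarrow> (complex^'n \<Rightarrow> complex^'m) \<Rightarrow> bool" where
  "holo_on U f \<longleftrightarrow> open U \<and>
     (\<forall>z\<in>U. \<exists>D. (f has_derivative D) (at z) \<and> (\<forall>c v. D (c *s v) = c *s D v))"

definition biholo :: "(complex^'n) set \<Rightarrow> (complex^'n) set \<Rightarrow> (complex^'n \<Rightarrow> complex^'n) \<Rightarrow> bool" where
  "biholo U V f \<longleftrightarrow> (\<exists>g. homeomorphism U V f g \<and> holo_on U f \<and> holo_on V g)"

section \<open>Smooth strongly pseudoconvex hypersurfaces\<close>

primrec Ck_on :: "nat \<Rightarrow> 'a::real_normed_vector set \<Rightarrow> ('a \<Rightarrow> 'b::real_normed_vector) \<Rightarrow> bool" where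
  "Ck_on 0 U f \<longleftrightarrow> continuous_on U f"
| "Ck_on (Suc k) U f \<longleftrightarrow> (\<forall>x\<in>U. f differentiable (at x)) \<and>
     (\<forall>v. Ck_on k U (\<lambda>x. frechet_derivative f (at x) v))"

definition smooth_on :: "'a::real_normed_vector set \<Rightarrow> ('a \<Rightarrow> 'b::real_normed_vector) \<Rightarrow> bool" where
  "smooth_on U f \<longleftrightarrow> open U \<and> (\<forall>k. Ck_on k U f)"

text \<open>The Wirtinger operators \<open>\<partial>/\<partial>z\<^sub>j\<close> and \<open>\<partial>/\<partial>zbar\<^sub>j\<close>, where \<open>z\<^sub>j = x\<^sub>j + \<i> y\<^sub>j\<close>; the real
  directions \<open>x\<^sub>j\<close>, \<open>y\<^sub>j\<close> are \<open>axis j 1\<close> and \<open>axis j \<i>\<close>.\<close>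

definition d_z :: "'n \<Rightarrow> (complex^'n \<Rightarrow> complex) \<Rightarrow> complex^'n \<Rightarrow> complex" where
  "d_z j f z = (frechet_derivative f (at z) (axis j 1)
                - \<i> * frechet_derivative f (at z) (axis j \<i>)) / 2"

definition d_zbar :: "'n \<Rightarrow> (complex^'n \<Rightarrow> complex) \<Rightarrow> complex^'n \<Rightarrow> complex" where
  "d_zbar j f z = (frechet_derivative f (at z) (axis j 1)
                + \<i> * frechet_derivative f (at z) (axis j \<i>)) / 2"

definition complex_tangent :: "(complex^'n \<Rightarrow> real) \<Rightarrow> complex^'n \<Rightarrow> (complex^'n) set" where
  "complex_tangent \<rho> z = {v. (\<Sum>j\<in>UNIV. d_z j (\<lambda>w. of_real (\<rho> w)) z * v $ j) = 0}"

definition levi_form :: "(complex^'n \<Rightarrow> real) \<Rightarrow> complex^'n \<Rightarrow> complex^'n \<Rightarrow> real" where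
  "levi_form \<rho> z v =
     Re (\<Sum>j\<in>UNIV. \<Sum>k\<in>UNIV. d_z j (d_zbar k (\<lambda>w. of_real (\<rho> w))) z * v $ j * cnj (v $ k))"

definition local_defining_function ::
  "(complex^'n) set \<Rightarrow> (complex^'n) set \<Rightarrow> (complex^'n \<Rightarrow> real) \<Rightarrow> bool" where
  "local_defining_function M U \<rho> \<longleftrightarrow> smooth_on U \<rho> \<and> M \<inter> U = {z\<in>U. \<rho> z = 0} \<and>
     (\<forall>z\<in>U. \<exists>v. frechet_derivative \<rho> (at z) v \<noteq> 0)"

text \<open>Only positivity is required, since \<open>-\<rho>\<close> is a defining function whenever \<open>\<rho>\<close> is.\<close>

definition spsc_hypersurface :: "(complex^'n) set \<Rightarrow> bool" where
  "spsc_hypersurface M \<longleftrightarrow> (\<forall>q\<in>M. \<exists>U \<rho>. q \<in> U \<and> local_defining_function M U \<rho> \<and>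
     (\<forall>v\<in>complex_tangent \<rho> q. v \<noteq> 0 \<longrightarrow> levi_form \<rho> q v > 0))"

section \<open>Germs of maps and the inductive limit topology\<close>

definition germ :: "'a::topological_space \<Rightarrow> ('a \<Rightarrow> 'b) \<Rightarrow> ('a \<Rightarrow> 'b) set" where
  "germ p f = {g. \<forall>\<^sub>F z in nhds p. g z = f z}"

text \<open>The space of holomorphic maps on \<open>U\<close>; values outside \<open>U\<close> are normalised.\<close>

definition holo_maps :: "(complex^'n) set \<Rightarrow> (complex^'n \<Rightarrow> complex^'m) set" where
  "holo_maps U = {f \<in> extensional U. holo_on U f}"

text \<open>Uniform convergence on compact subsets of \<open>U\<close>.\<close>

definition compact_convergence ::
  "(complex^'n) set \<Rightarrow> (complex^'n \<Rightarrow> complex^'m) topology" where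
  "compact_convergence U = topology (\<lambda>W. W \<subseteq> holo_maps U \<and>
     (\<forall>f\<in>W. \<exists>K e. compact K \<and> K \<subseteq> U \<and> e > 0 \<and>
        {g\<in>holo_maps U. \<forall>z\<in>K. dist (g z) (f z) < e} \<subseteq> W))"

definition holo_germs :: "complex^'n \<Rightarrow> (complex^'n \<Rightarrow> complex^'m) set set" where
  "holo_germs p = (\<Union>U\<in>{U. open U \<and> p \<in> U}. germ p ` holo_maps U)"

text \<open>The inductive limit: the finest topology for which every \<open>germ p\<close>, restricted to the
  holomorphic maps on a neighbourhood of \<open>p\<close>, is continuous.\<close>

definition germ_topology :: "complex^'n \<Rightarrow> (complex^'n \<Rightarrow> complex^'m) set topology" where
  "germ_topology p = topology (\<lambda>W. W \<subseteq> holo_germs p \<and>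
     (\<forall>U. open U \<and> p \<in> U \<longrightarrow> openin (compact_convergence U) {f\<in>holo_maps U. germ p f \<in> W}))"

section \<open>The local stability group\<close>

definition aut_germs :: "(complex^'n) set \<Rightarrow> complex^'n \<Rightarrow> (complex^'n \<Rightarrow> complex^'n) set set" where
  "aut_germs M p = {germ p f | f. \<exists>U V. p \<in> U \<and> biholo U V f \<and> f p = p \<and> f ` (M \<inter> U) = M \<inter> V}"

definition germ_comp ::
  "'a::topological_space \<Rightarrow> ('a \<Rightarrow> 'a) set \<Rightarrow> ('a \<Rightarrow> 'a) set \<Rightarrow> ('a \<Rightarrow> 'a) set" where
  "germ_comp p A B = {h. \<exists>f\<in>A. \<exists>g\<in>B. \<forall>\<^sub>F z in nhds p. h z = f (g z)}"

definition Aut :: "(complex^'n) set \<Rightarrow> complex^'n \<Rightarrow> (complex^'n \<Rightarrow> complex^'n) set monoid" where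
  "Aut M p = \<lparr>carrier = aut_germs M p, mult = germ_comp p, one = germ p id\<rparr>"

definition Aut_topology ::
  "(complex^'n) set \<Rightarrow> complex^'n \<Rightarrow> (complex^'n \<Rightarrow> complex^'n) set topology" where
  "Aut_topology M p = subtopology (germ_topology p) (carrier (Aut M p))"

section \<open>Topological groups and Lie groups\<close>

definition circle_group :: "complex monoid" where
  "circle_group = \<lparr>carrier = sphere 0 1, mult = (*), one = 1\<rparr>"

definition topologically_isomorphic ::
  "'a monoid \<Rightarrow> 'a topology \<Rightarrow> 'b monoid \<Rightarrow> 'b topology \<Rightarrow> bool" where
  "topologically_isomorphic A S B T \<longleftrightarrow> (\<exists>h. h \<in> iso A B \<and> homeomorphic_map S T h)"

definition topological_group :: "'a monoid \<Rightarrow> 'a topology \<Rightarrow> bool" where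
  "topological_group A T \<longleftrightarrow> group A \<and> topspace T = carrier A \<and>
     continuous_map (prod_topology T T) T (\<lambda>(x, y). x \<otimes>\<^bsub>A\<^esub> y) \<and>
     continuous_map T T (\<lambda>x. inv\<^bsub>A\<^esub> x)"

text \<open>Smoothness on open subsets of \<open>Euclidean_space d\<close>, via iterated partial derivatives. The
  dimension has to be a number here (rather than a type), because it is existentially quantified
  in the definition of a Lie group and may be 0.\<close>

primrec Ck_coord :: "nat \<Rightarrow> nat \<Rightarrow> (nat \<Rightarrow> real) set \<Rightarrow> ((nat \<Rightarrow> real) \<Rightarrow> real) \<Rightarrow> bool" where
  "Ck_coord d 0 S f \<longleftrightarrow> continuous_map (subtopology (Euclidean_space d) S) euclideanreal f"
| "Ck_coord d (Suc k) S f \<longleftrightarrow>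
     continuous_map (subtopology (Euclidean_space d) S) euclideanreal f \<and>
     (\<forall>i<d. (\<forall>x\<in>S. (\<lambda>t. f (x(i := t))) field_differentiable (at (x i))) \<and>
            Ck_coord d k S (\<lambda>x. deriv (\<lambda>t. f (x(i := t))) (x i)))"

definition smooth_coord_map ::
  "nat \<Rightarrow> nat \<Rightarrow> (nat \<Rightarrow> real) set \<Rightarrow> ((nat \<Rightarrow> real) \<Rightarrow> nat \<Rightarrow> real) \<Rightarrow> bool" where
  "smooth_coord_map d e S F \<longleftrightarrow> openin (Euclidean_space d) S \<and> (\<forall>i<e. \<forall>k. Ck_coord d k S (\<lambda>x. F x i))"

definition smooth_atlas :: "'a topology \<Rightarrow> nat \<Rightarrow> ('a set \<times> ('a \<Rightarrow> nat \<Rightarrow> real)) set \<Rightarrow> bool" where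
  "smooth_atlas T d C \<longleftrightarrow> topspace T = (\<Union>(U, \<phi>)\<in>C. U) \<and>
     (\<forall>(U, \<phi>)\<in>C. openin T U \<and> openin (Euclidean_space d) (\<phi> ` U) \<and>
        homeomorphic_map (subtopology T U) (subtopology (Euclidean_space d) (\<phi> ` U)) \<phi>) \<and>
     (\<forall>(U, \<phi>)\<in>C. \<forall>(V, \<psi>)\<in>C. smooth_coord_map d d (\<phi> ` (U \<inter> V)) (\<lambda>x. \<psi> (inv_into U \<phi> x)))"

text \<open>\<open>Euclidean_space (d + d)\<close> as the product of two copies of \<open>Euclidean_space d\<close>.\<close>

definition fst_coords :: "nat \<Rightarrow> (nat \<Rightarrow> real) \<Rightarrow> nat \<Rightarrow> real" where
  "fst_coords d z = (\<lambda>i. if i < d then z i else 0)"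

definition snd_coords :: "nat \<Rightarrow> (nat \<Rightarrow> real) \<Rightarrow> nat \<Rightarrow> real" where
  "snd_coords d z = (\<lambda>i. if i < d then z (d + i) else 0)"

text \<open>Second countability is deliberately not demanded, so every discrete group is a
  (0-dimensional) Lie group; demanding it would only make the notion narrower.\<close>

definition lie_group :: "'a monoid \<Rightarrow> 'a topology \<Rightarrow> bool" where
  "lie_group A T \<longleftrightarrow> topological_group A T \<and> Hausdorff_space T \<and>
     (\<exists>d C. smooth_atlas T d C \<and>
        (\<forall>(U, \<phi>)\<in>C. \<forall>(V, \<psi>)\<in>C. \<forall>(W, \<theta>)\<in>C.
           smooth_coord_map (d + d) d
             {z \<in> topspace (Euclidean_space (d + d)).
                fst_coords d z \<in> \<phi> ` U \<and> snd_coords d z \<in> \<psi> ` V \<and>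
                inv_into U \<phi> (fst_coords d z) \<otimes>\<^bsub>A\<^esub> inv_into V \<psi> (snd_coords d z) \<in> W}
             (\<lambda>z. \<theta> (inv_into U \<phi> (fst_coords d z) \<otimes>\<^bsub>A\<^esub> inv_into V \<psi> (snd_coords d z)))) \<and>
        (\<forall>(U, \<phi>)\<in>C. \<forall>(V, \<psi>)\<in>C.
           smooth_coord_map d d {x \<in> \<phi> ` U. inv\<^bsub>A\<^esub> (inv_into U \<phi> x) \<in> V}
             (\<lambda>x. \<psi> (inv\<^bsub>A\<^esub> (inv_into U \<phi> x)))))"

section \<open>Well-definedness\<close>

lemma openin_compact_convergence:
  fixes W :: "(complex^'n \<Rightarrow> complex^'m) set"
  shows "openin (compact_convergence U) W \<longleftrightarrow> W \<subseteq> holo_maps U \<and>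
     (\<forall>f\<in>W. \<exists>K e. compact K \<and> K \<subseteq> U \<and> e > 0 \<and>
        {g\<in>holo_maps U. \<forall>z\<in>K. dist (g z) (f z) < e} \<subseteq> W)"
proof -
  let ?N = "\<lambda>(f :: complex^'n \<Rightarrow> complex^'m) K (e::real). {g\<in>holo_maps U. \<forall>z\<in>K. dist (g z) (f z) < e}"
  let ?P = "\<lambda>W :: (complex^'n \<Rightarrow> complex^'m) set. W \<subseteq> holo_maps U \<and>
     (\<forall>f\<in>W. \<exists>K e. compact K \<and> K \<subseteq> U \<and> e > 0 \<and> ?N f K e \<subseteq> W)"
  have "istopology ?P"
    unfolding istopology_def
  proof (intro conjI allI impI)
    fix S T assume S: "?P S" and T: "?P T"
    show "S \<inter> T \<subseteq> holo_maps U" using S by blast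
    show "\<forall>f\<in>S \<inter> T. \<exists>K e. compact K \<and> K \<subseteq> U \<and> e > 0 \<and> ?N f K e \<subseteq> S \<inter> T"
    proof
      fix f assume "f \<in> S \<inter> T"
      obtain K e where 1: "compact K" "K \<subseteq> U" "e > 0" "?N f K e \<subseteq> S"
        using S \<open>f \<in> S \<inter> T\<close> by blast
      obtain L d where 2: "compact L" "L \<subseteq> U" "d > 0" "?N f L d \<subseteq> T"
        using T \<open>f \<in> S \<inter> T\<close> by blast
      have "?N f (K \<union> L) (min e d) \<subseteq> S \<inter> T"
        using 1(4) 2(4) by auto
      moreover have "compact (K \<union> L)" "K \<union> L \<subseteq> U" "min e d > 0"
        using 1 2 by auto
      ultimately show "\<exists>K e. compact K \<and> K \<subseteq> U \<and> e > 0 \<and> ?N f K e \<subseteq> S \<inter> T"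
        by blast
    qed
  next
    fix \<K> assume K: "\<forall>W\<in>\<K>. ?P W"
    show "\<Union>\<K> \<subseteq> holo_maps U" using K by blast
    show "\<forall>f\<in>\<Union>\<K>. \<exists>K e. compact K \<and> K \<subseteq> U \<and> e > 0 \<and> ?N f K e \<subseteq> \<Union>\<K>"
    proof
      fix f assume "f \<in> \<Union>\<K>"
      then obtain W where W: "W \<in> \<K>" "f \<in> W" by blast
      from K W(1) have "?P W" by (rule bspec)
      then have "\<exists>K e. compact K \<and> K \<subseteq> U \<and> e > 0 \<and> ?N f K e \<subseteq> W"
        using W(2) by (rule bspec[OF conjunct2])
      then obtain K e where *: "compact K" "K \<subseteq> U" "e > 0" "?N f K e \<subseteq> W"
        by (elim exE conjE)
      have "?N f K e \<subseteq> \<Union>\<K>" using *(4) Union_upper[OF W(1)] by (rule subset_trans)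
      with *(1-3) show "\<exists>K e. compact K \<and> K \<subseteq> U \<and> e > 0 \<and> ?N f K e \<subseteq> \<Union>\<K>"
        by (intro exI conjI)
    qed
  qed
  then show ?thesis
    by (simp add: compact_convergence_def)
qed

lemma topspace_compact_convergence: "topspace (compact_convergence U) = holo_maps U"
proof -
  have "openin (compact_convergence U) (holo_maps U)"
    unfolding openin_compact_convergence
    by (auto intro!: exI[of _ "{}"] exI[of _ "1::real"])
  then have "holo_maps U \<subseteq> topspace (compact_convergence U)"
    by (rule openin_subset)
  moreover have "topspace (compact_convergence U) \<subseteq> holo_maps U"
    using openin_topspace[of "compact_convergence U"] unfolding openin_compact_convergence by (rule conjunct1)
  ultimately show ?thesis by (rule subset_antisym[rotated])
qed

lemma openin_germ_topology:
  fixes W :: "(complex^'n \<Rightarrow> complex^'m) set set"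
  shows "openin (germ_topology p) W \<longleftrightarrow> W \<subseteq> holo_germs p \<and>
     (\<forall>U. open U \<and> p \<in> U \<longrightarrow> openin (compact_convergence U) {f\<in>holo_maps U. germ p f \<in> W})"
proof -
  let ?L = "\<lambda>U (W :: (complex^'n \<Rightarrow> complex^'m) set set). {f\<in>holo_maps U. germ p f \<in> W}"
  have i: "?L U (S \<inter> T) = ?L U S \<inter> ?L U T" for U S T by blast
  have u: "?L U (\<Union>\<K>) = \<Union>(?L U ` \<K>)" for U \<K> by blast
  have "istopology (\<lambda>W. W \<subseteq> holo_germs p \<and>
     (\<forall>U. open U \<and> p \<in> U \<longrightarrow> openin (compact_convergence U) (?L U W)))"
    unfolding istopology_def i u by (auto intro!: openin_Int openin_Union)
  then show ?thesis
    by (simp add: germ_topology_def)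
qed

lemma topspace_germ_topology:
  "topspace (germ_topology p) = (holo_germs p :: (complex^'n \<Rightarrow> complex^'m) set set)"
proof -
  let ?H = "holo_maps :: _ \<Rightarrow> (complex^'n \<Rightarrow> complex^'m) set"
  let ?G = "holo_germs p :: (complex^'n \<Rightarrow> complex^'m) set set"
  have "{f \<in> ?H U. germ p f \<in> ?G} = ?H U" if "open U" "p \<in> U" for U
    using that unfolding holo_germs_def by blast
  moreover have "openin (compact_convergence U) (?H U)" for U
    using openin_topspace[of "compact_convergence U :: (complex^'n \<Rightarrow> complex^'m) topology"]
    unfolding topspace_compact_convergence .
  ultimately have "openin (germ_topology p) ?G"
    unfolding openin_germ_topology by simp
  then have "?G \<subseteq> topspace (germ_topology p)"
    by (rule openin_subset)
  moreover have "topspace (germ_topology p) \<subseteq> ?G"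
    using openin_topspace[of "germ_topology p :: (complex^'n \<Rightarrow> complex^'m) set topology"]
    unfolding openin_germ_topology by (rule conjunct1)
  ultimately show ?thesis by (rule subset_antisym[rotated])
qed

lemma holo_on_subset: "holo_on U f \<Longrightarrow> open O' \<Longrightarrow> O' \<subseteq> U \<Longrightarrow> holo_on O' f"
  unfolding holo_on_def by blast

lemma holo_on_id: "open U \<Longrightarrow> holo_on U id"
  unfolding holo_on_def using has_derivative_id by (metis id_apply)

lemma holo_on_comp:
  assumes "holo_on U f" "holo_on V g" "f ` U \<subseteq> V"
  shows "holo_on U (g \<circ> f)"
  unfolding holo_on_def
proof (intro conjI ballI)
  show "open U" using assms unfolding holo_on_def by blast
  fix z assume z: "z \<in> U"
  obtain D where D: "(f has_derivative D) (at z)" "\<And>c v. D (c *s v) = c *s D v"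
    using assms(1) z unfolding holo_on_def by blast
  obtain E where E: "(g has_derivative E) (at (f z))" "\<And>c v. E (c *s v) = c *s E v"
    using assms(2,3) z unfolding holo_on_def by blast
  have "((g \<circ> f) has_derivative (E \<circ> D)) (at z)"
    by (rule diff_chain_at[OF D(1) E(1)])
  then show "\<exists>D. ((g \<circ> f) has_derivative D) (at z) \<and> (\<forall>c v. D (c *s v) = c *s D v)"
    using D(2) E(2) by (auto intro!: exI[of _ "E \<circ> D"])
qed

lemma holo_on_open: "holo_on U f \<Longrightarrow> open U"
  unfolding holo_on_def by blast

lemma biholo_open: "biholo U V f \<Longrightarrow> open U" "biholo U V f \<Longrightarrow> open V"
  unfolding biholo_def using holo_on_open by blast+

lemma biholo_id: "open U \<Longrightarrow> biholo U U id"
  unfolding biholo_def using holo_on_id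
  by (auto intro!: exI[of _ id] simp: homeomorphism_def)

lemma biholo_comp:
  assumes "biholo U V f" "biholo V W g"
  shows "biholo U W (g \<circ> f)"
proof -
  obtain f' where f: "homeomorphism U V f f'" "holo_on U f" "holo_on V f'"
    using assms(1) unfolding biholo_def by blast
  obtain g' where g: "homeomorphism V W g g'" "holo_on V g" "holo_on W g'"
    using assms(2) unfolding biholo_def by blast
  have "homeomorphism U W (g \<circ> f) (f' \<circ> g')"
    using f(1) g(1) by (rule homeomorphism_compose)
  moreover have "holo_on U (g \<circ> f)" "holo_on W (f' \<circ> g')"
    using f g by (auto intro!: holo_on_comp simp: homeomorphism_def)
  ultimately show ?thesis unfolding biholo_def by blast
qed

lemma biholo_restrict:
  assumes "biholo U V f" "open O'" "O' \<subseteq> U"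
  shows "biholo O' (f ` O') f"
proof -
  obtain g where f: "homeomorphism U V f g" "holo_on U f" "holo_on V g"
    using assms(1) unfolding biholo_def by blast
  have sub: "f ` O' \<subseteq> V" using f(1) assms(3) by (auto simp: homeomorphism_def)
  have h: "homeomorphism O' (f ` O') f g"
    using homeomorphism_of_subsets[OF f(1) assms(3) sub refl] .
  have "f ` O' = V \<inter> g -` O'"
    using f(1) assms(3) by (force simp: homeomorphism_def image_iff)
  moreover have "open (V \<inter> g -` O')"
    using f assms(2) holo_on_open[OF f(3)]
    by (intro continuous_open_preimage) (auto simp: homeomorphism_def)
  ultimately have "open (f ` O')" by simp
  then show ?thesis
    unfolding biholo_def using h holo_on_subset[OF f(2) assms(2,3)] holo_on_subset[OF f(3) _ sub]
    by blast
qed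

lemma germ_eqI: "\<forall>\<^sub>F z in nhds p. f z = g z \<Longrightarrow> germ p f = germ p g"
  unfolding germ_def by (auto elim: eventually_elim2)

lemma germ_comp_germ:
  fixes f g :: "'a::topological_space \<Rightarrow> 'a"
  assumes "(g \<longlongrightarrow> p) (nhds p)"
  shows "germ_comp p (germ p f) (germ p g) = germ p (f \<circ> g)"
proof (rule equalityI; rule subsetI)
  fix h assume "h \<in> germ_comp p (germ p f) (germ p g)"
  then obtain f' g' where *: "\<forall>\<^sub>F z in nhds p. f' z = f z" "\<forall>\<^sub>F z in nhds p. g' z = g z"
    "\<forall>\<^sub>F z in nhds p. h z = f' (g' z)"
    unfolding germ_comp_def germ_def by blast
  have "\<forall>\<^sub>F z in nhds p. f' (g z) = f (g z)"
    using *(1) assms by (rule eventually_compose_filterlim)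
  with *(2,3) have "\<forall>\<^sub>F z in nhds p. h z = (f \<circ> g) z"
    by eventually_elim simp
  then show "h \<in> germ p (f \<circ> g)" by (simp add: germ_def)
next
  fix h assume "h \<in> germ p (f \<circ> g)"
  then show "h \<in> germ_comp p (germ p f) (germ p g)"
    unfolding germ_comp_def germ_def by (force intro!: bexI[of _ f] bexI[of _ g])
qed

lemma biholo_tendsto:
  assumes "biholo U V f" "p \<in> U" "f p = p"
  shows "(f \<longlongrightarrow> p) (nhds p)"
proof -
  have "continuous_on U f" "open U"
    using assms(1) biholo_open by (auto simp: biholo_def homeomorphism_def)
  then have "isCont f p" using assms(2) continuous_on_eq_continuous_at by blast
  then show ?thesis
    using assms(3) by (metis isCont_def tendsto_at_iff_tendsto_nhds)
qed

definition aut_rep :: "(complex^'n) set \<Rightarrow> complex^'n \<Rightarrow> (complex^'n \<Rightarrow> complex^'n) \<Rightarrow> bool" where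
  "aut_rep M p f \<longleftrightarrow> (\<exists>U V. p \<in> U \<and> biholo U V f \<and> f p = p \<and> f ` (M \<inter> U) = M \<inter> V)"

lemma aut_germs_alt: "aut_germs M p = germ p ` {f. aut_rep M p f}"
  unfolding aut_germs_def aut_rep_def by blast

lemma aut_rep_tendsto: "aut_rep M p f \<Longrightarrow> (f \<longlongrightarrow> p) (nhds p)"
  unfolding aut_rep_def using biholo_tendsto by blast

lemma aut_rep_id: "aut_rep M p id"
  unfolding aut_rep_def by (intro exI[of _ UNIV]) (auto simp: biholo_id)

lemma aut_rep_comp:
  assumes "aut_rep M p f" "aut_rep M p g"
  shows "aut_rep M p (f \<circ> g)"
proof -
  obtain U V where f: "p \<in> U" "biholo U V f" "f p = p" "f ` (M \<inter> U) = M \<inter> V"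
    using assms(1) unfolding aut_rep_def by blast
  obtain U' V' where g: "p \<in> U'" "biholo U' V' g" "g p = p" "g ` (M \<inter> U') = M \<inter> V'"
    using assms(2) unfolding aut_rep_def by blast
  define W where "W = U' \<inter> g -` U"
  have "open W"
    unfolding W_def using g(2) biholo_open[OF g(2)] biholo_open[OF f(2)]
    by (intro continuous_open_preimage) (auto simp: biholo_def homeomorphism_def)
  have b1: "biholo W (g ` W) g"
    using biholo_restrict[OF g(2) \<open>open W\<close>] by (simp add: W_def)
  have sub: "g ` W \<subseteq> U" by (auto simp: W_def)
  have b2: "biholo (g ` W) (f ` g ` W) f"
    using biholo_restrict[OF f(2) biholo_open(2)[OF b1] sub] .
  have injg: "inj_on g U'" and imgg: "g ` U' = V'"
    using g(2) unfolding biholo_def by (metis homeomorphism_def inj_on_inverseI)+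
  have injf: "inj_on f U" and imgf: "f ` U = V"
    using f(2) unfolding biholo_def by (metis homeomorphism_def inj_on_inverseI)+
  have 1: "g ` (M \<inter> W) = M \<inter> g ` W"
  proof -
    have mem: "g x \<in> M \<longleftrightarrow> x \<in> M" if "x \<in> U'" for x
    proof -
      have "g x \<in> V'" using that imgg by blast
      then have "g x \<in> M \<longleftrightarrow> g x \<in> g ` (M \<inter> U')" using g(4) by blast
      also have "\<dots> \<longleftrightarrow> x \<in> M" using that injg by (auto simp: inj_on_def)
      finally show ?thesis .
    qed
    then show ?thesis by (auto simp: W_def)
  qed
  have 2: "f ` (M \<inter> g ` W) = M \<inter> f ` g ` W"
  proof -
    have mem: "f x \<in> M \<longleftrightarrow> x \<in> M" if "x \<in> U" for x
    proof -
      have "f x \<in> V" using that imgf by blast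
      then have "f x \<in> M \<longleftrightarrow> f x \<in> f ` (M \<inter> U)" using f(4) by blast
      also have "\<dots> \<longleftrightarrow> x \<in> M" using that injf by (auto simp: inj_on_def)
      finally show ?thesis .
    qed
    then show ?thesis using sub by auto
  qed
  have "(f \<circ> g) ` (M \<inter> W) = M \<inter> f ` g ` W"
    using 1 2 by (metis image_comp)
  then show ?thesis
    unfolding aut_rep_def using biholo_comp[OF b1 b2] f g
    by (intro exI[of _ W] exI[of _ "f ` g ` W"]) (auto simp: W_def)
qed

lemma aut_rep_inverse:
  assumes "aut_rep M p f"
  shows "\<exists>g. aut_rep M p g \<and> germ p (g \<circ> f) = germ p id"
proof -
  obtain U V where f: "p \<in> U" "biholo U V f" "f p = p" "f ` (M \<inter> U) = M \<inter> V"
    using assms(1) unfolding aut_rep_def by blast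
  obtain g where g: "homeomorphism U V f g" "holo_on U f" "holo_on V g"
    using f(2) unfolding biholo_def by blast
  have inv: "\<And>x. x \<in> U \<Longrightarrow> g (f x) = x" using g(1) by (auto simp: homeomorphism_def)
  have "biholo V U g"
    unfolding biholo_def using g homeomorphism_sym by blast
  moreover have "p \<in> V" using f(1,3) g(1) by (metis homeomorphism_image1 imageI)
  moreover have "g p = p" using inv[OF f(1)] f(3) by simp
  moreover have "g ` (M \<inter> V) = M \<inter> U"
    unfolding f(4)[symmetric] image_image using inv by force
  ultimately have "aut_rep M p g" unfolding aut_rep_def by blast
  moreover have "germ p (g \<circ> f) = germ p id"
    using inv f(1) biholo_open(1)[OF f(2)]
    by (intro germ_eqI) (auto simp: eventually_nhds)
  ultimately show ?thesis by blast
qed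

lemma group_Aut: "group (Aut M p)"
proof (rule groupI)
  show "\<one>\<^bsub>Aut M p\<^esub> \<in> carrier (Aut M p)"
    using aut_rep_id by (auto simp: Aut_def aut_germs_alt)
next
  fix x y assume "x \<in> carrier (Aut M p)" "y \<in> carrier (Aut M p)"
  then show "x \<otimes>\<^bsub>Aut M p\<^esub> y \<in> carrier (Aut M p)"
    by (auto simp: Aut_def aut_germs_alt germ_comp_germ aut_rep_tendsto aut_rep_comp)
next
  fix x y z
  assume "x \<in> carrier (Aut M p)" "y \<in> carrier (Aut M p)" "z \<in> carrier (Aut M p)"
  then obtain f g h where *: "x = germ p f" "y = germ p g" "z = germ p h"
    "aut_rep M p f" "aut_rep M p g" "aut_rep M p h"
    by (auto simp: Aut_def aut_germs_alt)
  note t = aut_rep_tendsto[OF *(5)] aut_rep_tendsto[OF *(6)]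
    aut_rep_tendsto[OF aut_rep_comp[OF *(5,6)]]
  show "x \<otimes>\<^bsub>Aut M p\<^esub> y \<otimes>\<^bsub>Aut M p\<^esub> z = x \<otimes>\<^bsub>Aut M p\<^esub> (y \<otimes>\<^bsub>Aut M p\<^esub> z)"
    unfolding Aut_def *(1-3) by (simp add: germ_comp_germ t Fun.comp_assoc)
next
  fix x assume "x \<in> carrier (Aut M p)"
  then show "\<one>\<^bsub>Aut M p\<^esub> \<otimes>\<^bsub>Aut M p\<^esub> x = x"
    by (auto simp: Aut_def aut_germs_alt germ_comp_germ aut_rep_tendsto)
next
  fix x assume "x \<in> carrier (Aut M p)"
  then obtain f where f: "aut_rep M p f" "x = germ p f"
    by (auto simp: Aut_def aut_germs_alt)
  then obtain g where "aut_rep M p g" "germ p (g \<circ> f) = germ p id"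
    using aut_rep_inverse by blast
  then show "\<exists>y\<in>carrier (Aut M p). y \<otimes>\<^bsub>Aut M p\<^esub> x = \<one>\<^bsub>Aut M p\<^esub>"
    using f by (auto simp: Aut_def aut_germs_alt germ_comp_germ aut_rep_tendsto intro!: bexI[of _ g])
qed

lemma aut_germs_subset: "aut_germs M p \<subseteq> holo_germs p"
proof
  fix x assume "x \<in> aut_germs M p"
  then obtain f U V where f: "x = germ p f" "p \<in> U" "biholo U V f"
    unfolding aut_germs_def by blast
  have o: "open U" using f biholo_open by blast
  let ?f = "restrict f U"
  have "holo_on U ?f"
    unfolding holo_on_def
  proof (intro conjI ballI)
    fix z assume z: "z \<in> U"
    then obtain D where D: "(f has_derivative D) (at z)" "\<forall>c v. D (c *s v) = c *s D v"
      using f(3) unfolding biholo_def holo_on_def by blast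
    have "(?f has_derivative D) (at z)"
      by (rule has_derivative_transform_within_open[OF D(1) o z]) simp
    then show "\<exists>D. (?f has_derivative D) (at z) \<and> (\<forall>c v. D (c *s v) = c *s D v)"
      using D(2) by blast
  qed (rule o)
  moreover have "germ p ?f = germ p f"
    using o f(2) by (intro germ_eqI) (auto simp: eventually_nhds)
  ultimately show "x \<in> holo_germs p"
    unfolding holo_germs_def holo_maps_def using o f
    by (auto intro!: bexI[of _ U] image_eqI[of _ _ ?f])
qed

lemma topspace_Aut_topology: "topspace (Aut_topology M p) = carrier (Aut M p)"
  using aut_germs_subset by (auto simp: Aut_topology_def topspace_germ_topology Aut_def)

end

theory Submission
  imports Defs "HOL-Complex_Analysis.Complex_Analysis"
begin

text \<open>
  Let \<open>Q\<close> be the sphere \<open>|Z|\<^sup>2 = Re Z\<^sub>0\<close>, which passes through the origin; here \<open>Z\<^sub>0\<close> is one chosen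
  coordinate (the coordinate \<open>i0\<close> below). The map \<open>rot i0 \<zeta>\<close>, which multiplies all other coordinates
  by \<open>\<zeta>\<close>, preserves \<open>Q\<close> whenever \<open>|\<zeta>| = 1\<close>. The hypersurface \<open>M\<close> arises from \<open>Q\<close> by raising tiny smooth
  bumps over disjoint balls around the points \<open>rot i0 \<zeta> (c j)\<close> with \<open>\<zeta> \<in> H j\<close>, where the points \<open>c j\<close> of
  \<open>Q\<close> tend to the origin. Only the rings of bumps with \<open>j \<ge> k\<close> are visible near the origin, and
  \<open>H k \<subseteq> H j\<close> permutes each of them, so every \<open>rot i0 \<zeta>\<close> with \<open>\<zeta> \<in> G = (\<Union>k. H k)\<close> preserves the germ of
  \<open>M\<close> (\<open>rot_aut_rep\<close>). The bumps are so small that the Levi form stays positive (\<open>spsc_M\<close>).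

  Conversely, let \<open>f\<close> be an automorphism of the germ. A complex line \<open>{x u}\<close> through the origin, with
  \<open>u\<^sub>0 = 1\<close>, meets \<open>Q\<close> in a circle through the origin, and if \<open>u\<close> is long this circle is so small that
  it lies in the domain of \<open>f\<close>. The radii of the rings decrease so fast that between them there are
  wide gaps in which \<open>M = Q\<close>. Hence \<open>f\<close> maps points of the circle that accumulate at the origin into
  \<open>Q\<close>, and by reflection (\<open>reflection_on_circle\<close>) it maps the whole circle into \<open>Q\<close>. Therefore it maps
  points of \<open>Q - M\<close> on such lines, in particular the centres \<open>c j\<close>, into \<open>Q - M\<close>, so that
  \<open>f (c j)\<close> is extremely close to some \<open>rot i0 \<zeta> (c j)\<close> (\<open>f_c_near_orbit\<close>). Each direction of a dense
  sequence occurs for infinitely many \<open>j\<close>. As the error is of infinite order in the distance to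
  the origin, the identity theorem shows for these directions \<open>u\<close> that
  \<open>f (x u) = x (1, C(x) u')\<close>, where \<open>u = (1, u')\<close>. The function \<open>C\<close> has modulus 1 on the circle and does
  not vanish in the disc which the circle bounds, so it is constant by the maximum principle
  (\<open>line_rigidity\<close>). Thus \<open>f\<close> agrees with its derivative on many lines, hence everywhere near the
  origin, and this derivative is \<open>rot i0 p\<close> for some \<open>p\<close> of modulus 1 (\<open>L_is_rot\<close>). A rotation
  which permutes the bumps of a ring \<open>j\<close> belongs to \<open>H j\<close>, so \<open>p \<in> G\<close> (\<open>f_is_rot\<close>).

  The resulting bijection between \<open>G\<close> and the stability group is a homeomorphism because \<open>\<zeta>\<close> is a
  derivative of \<open>rot i0 \<zeta>\<close> at the origin and Cauchy's inequality makes this derivative continuous on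
  the space of germs (\<open>Aut_M\<close>). Finally, the dyadic roots of unity form a countable group without
  isolated points, whereas a countable Lie group is discrete
  (\<open>countable_lie_group_isolated\<close>).
\<close>

section \<open>Smooth functions built from bumps\<close>

text \<open>The iterated derivatives of a function lie in any class that is closed under directional
  derivatives, so smoothness needs no formula for them.\<close>

lemma Ck_on_coinduct:
  assumes "P f"
    and step: "\<And>f. P f \<Longrightarrow> \<exists>f'. (\<forall>x. (f has_derivative f' x) (at x)) \<and> (\<forall>v. P (\<lambda>x. f' x v))"
  shows "Ck_on k UNIV f"
  using \<open>P f\<close>
proof (induction k arbitrary: f)
  case 0
  then obtain f' where "\<And>x. (f has_derivative f' x) (at x)" using step by blast
  then show ?case
    by (auto intro!: continuous_at_imp_continuous_on has_derivative_continuous)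
next
  case (Suc k)
  then obtain f' where f': "\<And>x. (f has_derivative f' x) (at x)" and P: "\<And>v. P (\<lambda>x. f' x v)"
    using step by blast
  have "frechet_derivative f (at x) = f' x" for x
    using frechet_derivative_at[OF f'] by simp
  then show ?case
    using f' P Suc.IH by (auto simp: differentiable_def)
qed

lemma Ck_on_subset: "Ck_on k U f \<Longrightarrow> V \<subseteq> U \<Longrightarrow> Ck_on k V f"
  by (induction k arbitrary: f) (auto intro: continuous_on_subset)

lemma Ck_on_UNIV_add:
  assumes "Ck_on k UNIV f" "Ck_on k UNIV g"
  shows "Ck_on k UNIV (\<lambda>x. f x + g x)"
  using assms
proof (induction k arbitrary: f g)
  case 0
  then show ?case by (simp add: continuous_on_add)
next
  case (Suc k)
  then have d: "f differentiable (at x)" "g differentiable (at x)" for x by auto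
  have "frechet_derivative (\<lambda>x. f x + g x) (at x) =
        (\<lambda>v. frechet_derivative f (at x) v + frechet_derivative g (at x) v)" for x
    using frechet_derivative_at[OF has_derivative_add[OF d(1)[unfolded frechet_derivative_works]
          d(2)[unfolded frechet_derivative_works]]] by metis
  with Suc d show ?case by auto
qed

text \<open>The span of these functions for all \<open>k\<close> is closed under
  differentiation.\<close>

definition flat :: "nat \<Rightarrow> real \<Rightarrow> real" where
  "flat k s = (if s > 0 then (1 / s) ^ k * exp (- 1 / s) else 0)"

lemma flat_nonneg: "flat k s \<ge> 0"
  by (simp add: flat_def)

lemma flat_pos_iff: "flat k s > 0 \<longleftrightarrow> s > 0"
  by (simp add: flat_def)

text \<open>With \<open>x = 1 / s\<close> this is \<open>x ^ n * exp (- x) \<le> fact n\<close>,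
  which holds because \<open>x ^ n / fact n\<close> is a term of the exponential series.\<close>

lemma flat_le:
  assumes "s \<ge> 0"
  shows "flat k s \<le> s ^ m * fact (k + m)"
proof (cases "s = 0")
  case True
  then show ?thesis by (simp add: flat_def)
next
  case False
  with assms have s: "s > 0" by simp
  let ?x = "1 / s" and ?n = "k + m"
  obtain t where t: "exp ?x = (\<Sum>i<Suc ?n. ?x ^ i / fact i) + exp t / fact (Suc ?n) * ?x ^ Suc ?n"
    using Maclaurin_exp_le[of ?x "Suc ?n"] by blast
  have "?x ^ ?n / fact ?n \<le> (\<Sum>i<Suc ?n. ?x ^ i / fact i)"
    using s by (intro member_le_sum) auto
  also have "\<dots> \<le> exp ?x"
    unfolding t using s by simp
  finally have "?x ^ ?n \<le> fact ?n * exp ?x"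
    by (simp add: divide_le_eq mult.commute)
  then have "?x ^ ?n * exp (- ?x) \<le> fact ?n"
    by (simp add: exp_minus divide_le_eq flip: divide_inverse)
  then have "s ^ m * (?x ^ ?n * exp (- ?x)) \<le> s ^ m * fact ?n"
    using s by (intro mult_left_mono) auto
  moreover have "s ^ m * (?x ^ ?n * exp (- ?x)) = flat k s"
    using s by (simp add: flat_def power_add power_divide)
  ultimately show ?thesis by simp
qed

lemma flat_has_derivative:
  assumes "s > 0"
  shows "(flat k has_real_derivative (flat (k + 2) s - real k * flat (k + 1) s)) (at s)"
proof -
  have 1: "((\<lambda>s. exp (- 1 / s)) has_real_derivative (exp (- 1 / s) * (1 / s) ^ 2)) (at s)"
    using assms by (auto intro!: derivative_eq_intros simp: power2_eq_square)
  have "((\<lambda>s. (1 / s) ^ k) has_real_derivative (- real k * ((1 / s)\<^sup>2 * (1 / s) ^ (k - 1)))) (at s)"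
    using assms by (auto intro!: derivative_eq_intros simp: power2_eq_square)
  moreover have "- real k * ((1 / s)\<^sup>2 * (1 / s) ^ (k - 1)) = - real k * (1 / s) ^ (k + 1)"
    by (cases k) (simp_all add: power2_eq_square)
  ultimately have 2: "((\<lambda>s. (1 / s) ^ k) has_real_derivative (- real k * (1 / s) ^ (k + 1))) (at s)"
    by simp
  have "((\<lambda>s. (1 / s) ^ k * exp (- 1 / s)) has_real_derivative
      (flat (k + 2) s - real k * flat (k + 1) s)) (at s)"
  proof (rule DERIV_cong[OF DERIV_mult[OF 2 1]])
    show "- real k * (1 / s) ^ (k + 1) * exp (- 1 / s) + exp (- 1 / s) * (1 / s)\<^sup>2 * (1 / s) ^ k =
        flat (k + 2) s - real k * flat (k + 1) s"
      unfolding flat_def power_add using assms by (simp add: algebra_simps)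
  qed
  moreover have "\<forall>\<^sub>F t in nhds s. flat k t = (1 / t) ^ k * exp (- 1 / t)"
    using eventually_nhds_in_open[of "{0<..}" s] assms by (auto simp: flat_def elim: eventually_mono)
  ultimately show ?thesis
    by (simp add: DERIV_cong_ev[OF refl _ refl])
qed

text \<open>The sum of the bumps \<open>exp (- 1 / (d\<^sup>2 - |x - c|\<^sup>2))\<close> over all
  the balls is smooth even where the balls accumulate: a derivative of any order is bounded by a
  multiple of the squared height \<open>(d\<^sup>2 - |x - c|\<^sup>2)\<^sup>2\<close>, uniformly in
  the balls, and this vanishes to second order at every point outside.\<close>

locale disjoint_balls =
  fixes B :: "('a::euclidean_space \<times> real) set"
  assumes radius: "(c, d) \<in> B \<Longrightarrow> 0 < d \<and> d \<le> 1"
    and disjoint: "(c, d) \<in> B \<Longrightarrow> (c', d') \<in> B \<Longrightarrow> dist x c < d \<Longrightarrow> dist x c' < d' \<Longrightarrow> (c, d) = (c', d')"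
begin

definition inside :: "'a \<Rightarrow> bool" where
  "inside x \<longleftrightarrow> (\<exists>(c, d)\<in>B. dist x c < d)"

text \<open>By disjointness at most one ball contains \<open>x\<close>, so the choice is no
  choice.\<close>

definition the_ball :: "'a \<Rightarrow> 'a \<times> real" where
  "the_ball x = (SOME b. b \<in> B \<and> dist x (fst b) < snd b)"

definition offset :: "'a \<Rightarrow> 'a" where
  "offset x = (if inside x then x - fst (the_ball x) else 0)"

definition height :: "'a \<Rightarrow> real" where
  "height x = (if inside x then (snd (the_ball x))\<^sup>2 - (norm (offset x))\<^sup>2 else 0)"

lemma inside_ball:
  assumes "(c, d) \<in> B" "dist x c < d"
  shows "inside x" "offset x = x - c" "height x = d\<^sup>2 - (norm (x - c))\<^sup>2" "height x > 0"
proof -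
  show i: "inside x" using assms by (auto simp: inside_def)
  have "the_ball x \<in> B \<and> dist x (fst (the_ball x)) < snd (the_ball x)"
    unfolding the_ball_def by (rule someI[of _ "(c, d)"]) (use assms in auto)
  then have b: "the_ball x = (c, d)"
    using disjoint[of c d "fst (the_ball x)" "snd (the_ball x)" x] assms by auto
  show o: "offset x = x - c" and h: "height x = d\<^sup>2 - (norm (x - c))\<^sup>2"
    using i b by (auto simp: offset_def height_def)
  show "height x > 0"
    unfolding h using assms by (simp add: dist_norm power_strict_mono)
qed

lemma insideE:
  assumes "inside x"
  obtains c d where "(c, d) \<in> B" "dist x c < d"
  using assms by (auto simp: inside_def)

lemma outside: "\<not> inside x \<Longrightarrow> offset x = 0" "\<not> inside x \<Longrightarrow> height x = 0"
  by (auto simp: offset_def height_def)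

lemma height_pos_iff: "height x > 0 \<longleftrightarrow> inside x"
  using inside_ball(4) outside(2) by (metis insideE less_irrefl)

lemma height_nonneg: "height x \<ge> 0"
  using height_pos_iff[of x] outside(2)[of x] by (cases "inside x") auto

lemma norm_offset_le: "norm (offset x) \<le> 1"
proof (cases "inside x")
  case True
  then obtain c d where "(c, d) \<in> B" "dist x c < d" by (rule insideE)
  with radius[of c d] inside_ball(2)[of c d x] show ?thesis by (simp add: dist_norm)
qed (simp add: outside)

text \<open>A segment from \<open>x\<close> to a point outside has to leave the ball of
  \<open>x\<close>, so its length is at least \<open>d - |x - c|\<close>, while the other factor
  \<open>d + |x - c|\<close> of the height is at most 2.\<close>

lemma height_le_dist:
  assumes "\<not> inside y"
  shows "height x \<le> 2 * dist x y"
proof (cases "inside x")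
  case True
  then obtain c d where b: "(c, d) \<in> B" "dist x c < d" by (rule insideE)
  have "dist y c \<ge> d" using assms b(1) inside_ball(1) by force
  then have "d - dist x c \<le> dist x y" by metric
  moreover have "0 < d" "d \<le> 1" using radius b by auto
  ultimately have "(d - dist x c) * (d + dist x c) \<le> dist x y * 2"
    using b by (intro mult_mono) (auto intro: add_nonneg_nonneg)
  then show ?thesis
    using inside_ball(3)[OF b] by (simp add: dist_norm power2_eq_square algebra_simps)
qed (simp add: outside)

text \<open>A class that contains the sum of all bumps and is closed under directional derivatives.
  All its members have coefficients which do not depend on the ball; this makes the bound
  \<open>tame_le_height\<close> uniform.\<close>

inductive tame :: "('a \<Rightarrow> real) \<Rightarrow> bool" where
  base: "tame (\<lambda>x. flat k (height x))"
| offset: "tame f \<Longrightarrow> tame (\<lambda>x. (offset x \<bullet> v) * f x)"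
| scale: "tame f \<Longrightarrow> tame (\<lambda>x. r * f x)"
| add: "tame f \<Longrightarrow> tame g \<Longrightarrow> tame (\<lambda>x. f x + g x)"

lemma tame_le_height:
  assumes "tame f"
  shows "\<exists>C. \<forall>x. \<bar>f x\<bar> \<le> C * (height x)\<^sup>2"
  using assms
proof induction
  case (base k)
  have "\<bar>flat k (height x)\<bar> \<le> fact (k + 2) * (height x)\<^sup>2" for x
    using flat_le[OF height_nonneg, of k x 2] flat_nonneg[of k "height x"] by (simp add: mult.commute)
  then show ?case by blast
next
  case (offset f v)
  then obtain C where C: "\<And>x. \<bar>f x\<bar> \<le> C * (height x)\<^sup>2" by blast
  have "\<bar>(offset x \<bullet> v) * f x\<bar> \<le> (norm v * C) * (height x)\<^sup>2" for x
  proof -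
    have "\<bar>offset x \<bullet> v\<bar> \<le> norm (offset x) * norm v" by (rule Cauchy_Schwarz_ineq2)
    also have "\<dots> \<le> norm v" using norm_offset_le[of x] by (simp add: mult_left_le_one_le)
    finally have "\<bar>offset x \<bullet> v\<bar> * \<bar>f x\<bar> \<le> norm v * (C * (height x)\<^sup>2)"
      using C by (intro mult_mono) auto
    then show ?thesis by (simp add: abs_mult)
  qed
  then show ?case by blast
next
  case (scale f r)
  then obtain C where C: "\<And>x. \<bar>f x\<bar> \<le> C * (height x)\<^sup>2" by blast
  have "\<bar>r * f x\<bar> \<le> (\<bar>r\<bar> * C) * (height x)\<^sup>2" for x
    using mult_left_mono[OF C[of x], of "\<bar>r\<bar>"] by (simp add: abs_mult)
  then show ?case by blast
next
  case (add f g)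
  then obtain C C' where C: "\<And>x. \<bar>f x\<bar> \<le> C * (height x)\<^sup>2" "\<And>x. \<bar>g x\<bar> \<le> C' * (height x)\<^sup>2" by blast
  have "\<bar>f x + g x\<bar> \<le> (C + C') * (height x)\<^sup>2" for x
    using C(1)[of x] C(2)[of x] abs_triangle_ineq[of "f x" "g x"] unfolding distrib_right by linarith
  then show ?case by blast
qed

lemma tame_outside: "tame f \<Longrightarrow> \<not> inside x \<Longrightarrow> f x = 0"
  using tame_le_height[of f] outside(2)[of x] by (metis abs_le_zero_iff mult_zero_right zero_power2)

text \<open>Boundary points, exterior points and limit points of the balls are treated alike: at
  each of them \<open>f\<close> is bounded by a multiple of the squared distance.\<close>

lemma tame_has_derivative_outside:
  assumes "tame f" "\<not> inside x"
  shows "(f has_derivative (\<lambda>_. 0)) (at x)"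
proof -
  obtain C where C: "\<And>x. \<bar>f x\<bar> \<le> C * (height x)\<^sup>2" using tame_le_height[OF assms(1)] by blast
  have C0: "\<bar>f y\<bar> \<le> (4 * \<bar>C\<bar>) * (norm (y - x))\<^sup>2" for y
  proof -
    have "(height y)\<^sup>2 \<le> (2 * dist y x)\<^sup>2"
      using height_le_dist[OF assms(2)] height_nonneg by (intro power_mono) auto
    then have "C * (height y)\<^sup>2 \<le> \<bar>C\<bar> * (2 * dist y x)\<^sup>2"
      by (intro mult_mono) auto
    then show ?thesis using C[of y] by (simp add: dist_norm power_mult_distrib)
  qed
  have f0: "f x = 0" using tame_outside assms by blast
  show ?thesis
  proof (rule has_derivativeI_sandwich[where e = 1])
    show "((\<lambda>y. (4 * \<bar>C\<bar>) * norm (y - x)) \<longlongrightarrow> 0) (at x)"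
      by (rule tendsto_eq_intros refl LIM_offset_zero | simp)+
    show "norm (f y - f x - 0) / norm (y - x) \<le> (4 * \<bar>C\<bar>) * norm (y - x)" if "y \<noteq> x" for y
      using C0[of y] that f0 by (simp add: divide_le_eq power2_eq_square mult.assoc)
  qed auto
qed

lemma height_has_derivative:
  assumes "inside x"
  shows "(height has_derivative (\<lambda>v. - 2 * (offset x \<bullet> v))) (at x)"
    and "(offset has_derivative (\<lambda>v. v)) (at x)"
proof -
  obtain c d where b: "(c, d) \<in> B" "dist x c < d" using assms by (rule insideE)
  have eq: "offset y = y - c" "height y = d\<^sup>2 - (norm (y - c))\<^sup>2" if "y \<in> ball c d" for y
    using inside_ball[OF b(1), of y] that by (auto simp: dist_commute)
  have x: "x \<in> ball c d" using b by (simp add: dist_commute)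
  have "((\<lambda>y. d\<^sup>2 - (y - c) \<bullet> (y - c)) has_derivative (\<lambda>v. - 2 * (offset x \<bullet> v))) (at x)"
    using eq(1)[OF x] by (auto intro!: derivative_eq_intros simp: inner_commute)
  then show "(height has_derivative (\<lambda>v. - 2 * (offset x \<bullet> v))) (at x)"
    by (rule has_derivative_transform_within_open[of _ _ _ _ "ball c d"])
      (use x in \<open>auto simp: eq power2_norm_eq_inner\<close>)
  have "((\<lambda>y. y - c) has_derivative (\<lambda>v. v)) (at x)"
    by (auto intro!: derivative_eq_intros)
  then show "(offset has_derivative (\<lambda>v. v)) (at x)"
    by (rule has_derivative_transform_within_open[of _ _ _ _ "ball c d"]) (use x in \<open>auto simp: eq\<close>)
qed

lemma flat_height_has_derivative:
  assumes "inside x"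
  shows "((\<lambda>x. flat k (height x)) has_derivative
     (\<lambda>v. (flat (k + 2) (height x) - real k * flat (k + 1) (height x)) * (- 2 * (offset x \<bullet> v)))) (at x)"
  using has_derivative_compose[OF height_has_derivative(1)[OF assms]
    flat_has_derivative[THEN has_field_derivative_imp_has_derivative]] height_pos_iff assms by simp

lemma tame_has_derivative_inside:
  assumes "tame f"
  shows "\<exists>f'. (\<forall>v. tame (\<lambda>x. f' x v)) \<and> (\<forall>x. inside x \<longrightarrow> (f has_derivative f' x) (at x))"
  using assms
proof induction
  case (base k)
  let ?f' = "\<lambda>x v. (offset x \<bullet> v) * (-2 * (flat (k + 2) (height x) + (- real k) * flat (k + 1) (height x)))"
  have "tame (\<lambda>x. ?f' x v)" for v by (intro tame.intros)
  moreover have "((\<lambda>x. flat k (height x)) has_derivative ?f' x) (at x)" if "inside x" for x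
    using flat_height_has_derivative[OF that, of k] by (rule has_derivative_eq_rhs) (simp add: algebra_simps)
  ultimately show ?case by (intro exI[of _ ?f']) blast
next
  case (offset f w)
  then obtain f' where t: "\<And>v. tame (\<lambda>x. f' x v)" and f': "\<And>x. inside x \<Longrightarrow> (f has_derivative f' x) (at x)"
    by blast
  let ?g' = "\<lambda>x v. (offset x \<bullet> w) * f' x v + (v \<bullet> w) * f x"
  have "tame (\<lambda>x. ?g' x v)" for v by (intro tame.intros t offset)
  moreover have "((\<lambda>x. (offset x \<bullet> w) * f x) has_derivative ?g' x) (at x)" if "inside x" for x
    by (rule has_derivative_mult has_derivative_inner_left height_has_derivative(2) f' that)+
  ultimately show ?case by (intro exI[of _ ?g']) blast
next
  case (scale f r)
  then obtain f' where t: "\<And>v. tame (\<lambda>x. f' x v)" and f': "\<And>x. inside x \<Longrightarrow> (f has_derivative f' x) (at x)"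
    by blast
  then show ?case
    by (intro exI[of _ "\<lambda>x v. r * f' x v"]) (auto intro: tame.intros has_derivative_mult_right)
next
  case (add f g)
  then obtain f' g' where "\<And>v. tame (\<lambda>x. f' x v)" "\<And>x. inside x \<Longrightarrow> (f has_derivative f' x) (at x)"
     "\<And>v. tame (\<lambda>x. g' x v)" "\<And>x. inside x \<Longrightarrow> (g has_derivative g' x) (at x)"
    by blast
  then show ?case
    by (intro exI[of _ "\<lambda>x v. f' x v + g' x v"]) (auto intro: tame.intros has_derivative_add)
qed

lemma tame_has_derivative:
  assumes "tame f" "\<And>v. tame (\<lambda>x. f' x v)" "\<And>x. inside x \<Longrightarrow> (f has_derivative f' x) (at x)"
  shows "(f has_derivative f' x) (at x)"
proof (cases "inside x")
  case False
  have "f' x = (\<lambda>_. 0)" using tame_outside[OF assms(2) False] by blast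
  then show ?thesis using tame_has_derivative_outside[OF assms(1) False] by simp
qed (rule assms(3))

lemma tame_Ck_on: "tame f \<Longrightarrow> Ck_on k UNIV f"
  using tame_has_derivative tame_has_derivative_inside
  by (intro Ck_on_coinduct[of tame]) metis+

definition bump :: "'a \<Rightarrow> real" where
  "bump x = flat 0 (height x)"

definition bump_deriv :: "'a \<Rightarrow> 'a \<Rightarrow> real" where
  "bump_deriv v x = (offset x \<bullet> v) * (- 2 * flat 2 (height x))"

definition bump_deriv2 :: "'a \<Rightarrow> 'a \<Rightarrow> 'a \<Rightarrow> real" where
  "bump_deriv2 v w x = (offset x \<bullet> v) * ((offset x \<bullet> w) * (4 * (flat 4 (height x) + (- 2) * flat 3 (height x))))
      + (w \<bullet> v) * (- 2 * flat 2 (height x))"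

lemma bump_pos_iff: "bump x > 0 \<longleftrightarrow> inside x" and bump_outside: "\<not> inside x \<Longrightarrow> bump x = 0"
  by (simp_all add: bump_def flat_pos_iff height_pos_iff outside flat_def)

lemma bump_has_derivative: "(bump has_derivative (\<lambda>v. bump_deriv v x)) (at x)"
proof (rule tame_has_derivative)
  show "tame bump" unfolding bump_def by (rule tame.intros)
  show "tame (bump_deriv v)" for v unfolding bump_deriv_def by (intro tame.intros)
  show "(bump has_derivative (\<lambda>v. bump_deriv v x)) (at x)" if "inside x" for x
    unfolding bump_def bump_deriv_def
    by (rule has_derivative_eq_rhs[OF flat_height_has_derivative[OF that]])
      (simp add: numeral_2_eq_2 mult.commute mult.left_commute)
qed

lemma bump_deriv_has_derivative: "(bump_deriv v has_derivative (\<lambda>w. bump_deriv2 v w x)) (at x)"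
proof (rule tame_has_derivative)
  show "tame (bump_deriv v)" for v unfolding bump_deriv_def by (intro tame.intros)
  show "tame (bump_deriv2 v w)" for v w unfolding bump_deriv2_def by (intro tame.intros)
  show "(bump_deriv v has_derivative (\<lambda>w. bump_deriv2 v w x)) (at x)" if "inside x" for x
    unfolding bump_deriv_def[abs_def]
    by (rule has_derivative_eq_rhs, rule has_derivative_mult, rule has_derivative_inner_left,
        rule height_has_derivative(2)[OF that], rule has_derivative_mult_right,
        rule flat_height_has_derivative[OF that])
      (simp add: bump_deriv2_def fun_eq_iff eval_nat_numeral algebra_simps)
qed

lemma height_le:
  assumes "\<And>c d. (c, d) \<in> B \<Longrightarrow> d \<le> e" "0 \<le> e"
  shows "height x \<le> e\<^sup>2" "norm (offset x) \<le> e"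
proof -
  have "height x \<le> e\<^sup>2 \<and> norm (offset x) \<le> e"
  proof (cases "inside x")
    case True
    then obtain c d where b: "(c, d) \<in> B" "dist x c < d" by (rule insideE)
    have "d\<^sup>2 \<le> e\<^sup>2" using assms(1)[OF b(1)] radius[OF b(1)] by (intro power_mono) auto
    moreover have "height x \<le> d\<^sup>2" unfolding inside_ball(3)[OF b] by simp
    moreover have "norm (offset x) \<le> e"
      using assms(1)[OF b(1)] b(2) inside_ball(2)[OF b] by (simp add: dist_norm)
    ultimately show ?thesis by linarith
  qed (use assms in \<open>auto simp: outside\<close>)
  then show "height x \<le> e\<^sup>2" "norm (offset x) \<le> e" by auto
qed

text \<open>The constant is generous: the bounds from \<open>flat_le\<close> add up to 684.\<close>

lemma bump_deriv_small:
  assumes "\<And>c d. (c, d) \<in> B \<Longrightarrow> d \<le> e" "0 \<le> e"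
  shows "\<bar>bump_deriv v x\<bar> \<le> 1000 * e\<^sup>2 * norm v" "\<bar>bump_deriv2 v w x\<bar> \<le> 1000 * e\<^sup>2 * norm v * norm w"
proof -
  have h: "height x \<le> e\<^sup>2"
    using height_le(1)[of e x] assms by blast
  have f: "flat 2 (height x) \<le> 6 * e\<^sup>2" "flat 3 (height x) \<le> 24 * e\<^sup>2" "flat 4 (height x) \<le> 120 * e\<^sup>2"
    using flat_le[OF height_nonneg, of 2 x 1] flat_le[OF height_nonneg, of 3 x 1]
      flat_le[OF height_nonneg, of 4 x 1] h by (simp_all add: fact_numeral)
  note p = flat_nonneg[of _ "height x"]
  have ip: "\<bar>offset x \<bullet> v\<bar> \<le> norm v" for v
    using Cauchy_Schwarz_ineq2[of "offset x" v] mult_right_mono[OF norm_offset_le[of x], of "norm v"] by simp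
  have "\<bar>offset x \<bullet> v\<bar> * (2 * flat 2 (height x)) \<le> norm v * (12 * e\<^sup>2)"
    using f(1) p[of 2] by (intro mult_mono[OF ip]) simp_all
  then have b1: "\<bar>offset x \<bullet> v\<bar> * (2 * flat 2 (height x)) \<le> 12 * e\<^sup>2 * norm v" by (simp add: algebra_simps)
  show "\<bar>bump_deriv v x\<bar> \<le> 1000 * e\<^sup>2 * norm v"
    using b1 p[of 2] order.trans[OF b1 mult_right_mono[of "12 * e\<^sup>2" "1000 * e\<^sup>2" "norm v"]]
    by (simp add: bump_deriv_def abs_mult mult.assoc)
  have "\<bar>w \<bullet> v\<bar> * (2 * flat 2 (height x)) \<le> (norm v * norm w) * (12 * e\<^sup>2)"
  proof (rule mult_mono)
    show "\<bar>w \<bullet> v\<bar> \<le> norm v * norm w" using Cauchy_Schwarz_ineq2[of w v] by (simp add: mult.commute)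
  qed (use f(1) p[of 2] in auto)
  moreover have "\<bar>offset x \<bullet> v\<bar> * (\<bar>offset x \<bullet> w\<bar> * \<bar>4 * (flat 4 (height x) + (- 2) * flat 3 (height x))\<bar>)
      \<le> norm v * (norm w * (672 * e\<^sup>2))"
  proof (intro mult_mono ip)
    show "\<bar>4 * (flat 4 (height x) + (- 2) * flat 3 (height x))\<bar> \<le> 672 * e\<^sup>2"
      using f p[of 3] p[of 4] by (simp add: abs_le_iff)
  qed auto
  moreover have "\<bar>bump_deriv2 v w x\<bar> \<le> \<bar>offset x \<bullet> v\<bar> * (\<bar>offset x \<bullet> w\<bar> * \<bar>4 * (flat 4 (height x) + (- 2) * flat 3 (height x))\<bar>)
     + \<bar>w \<bullet> v\<bar> * (2 * flat 2 (height x))"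
    unfolding bump_deriv2_def using p[of 2] by (intro order.trans[OF abs_triangle_ineq]) (simp add: abs_mult)
  ultimately have "\<bar>bump_deriv2 v w x\<bar> \<le> (norm v * norm w) * (684 * e\<^sup>2)"
    by (simp add: algebra_simps)
  also have "\<dots> \<le> (norm v * norm w) * (1000 * e\<^sup>2)"
    by (intro mult_left_mono) auto
  finally show "\<bar>bump_deriv2 v w x\<bar> \<le> 1000 * e\<^sup>2 * norm v * norm w" by (simp add: algebra_simps)
qed

end

section \<open>Holomorphic functions on a disc\<close>

text \<open>The estimate is only assumed at points that accumulate at the origin; this is all that
  an automorphism provides, through the sparse sequence of centres.\<close>

lemma continuous_zero_of_small_values:
  fixes f :: "complex \<Rightarrow> complex"
  assumes "isCont f 0" and small: "\<And>e. e > 0 \<Longrightarrow> \<exists>z. z \<noteq> 0 \<and> norm z < e \<and> norm (f z) \<le> A * norm z"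
  shows "f 0 = 0"
proof (rule ccontr)
  assume f0: "f 0 \<noteq> 0"
  obtain d where d: "d > 0" "\<And>z. dist z 0 < d \<Longrightarrow> dist (f z) (f 0) < norm (f 0) / 2"
    using assms(1) f0 unfolding continuous_at_eps_delta by (metis half_gt_zero zero_less_norm_iff)
  define e where "e = min d (norm (f 0) / (2 * (\<bar>A\<bar> + 1)))"
  have "e > 0" using d f0 by (simp add: e_def)
  then obtain z where z: "norm z < e" "norm (f z) \<le> A * norm z" using small by blast
  have "norm (f 0) \<le> norm (f z) + dist (f z) (f 0)" by norm
  moreover have "dist (f z) (f 0) < norm (f 0) / 2" using d(2)[of z] z by (simp add: e_def)
  moreover have "norm (f z) \<le> norm (f 0) / 2"
  proof -
    have "A * norm z \<le> (\<bar>A\<bar> + 1) * (norm (f 0) / (2 * (\<bar>A\<bar> + 1)))"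
      using z by (intro mult_mono) (auto simp: e_def)
    also have "\<dots> = norm (f 0) / 2" by (simp add: field_simps)
    finally show ?thesis using z by simp
  qed
  ultimately show False by simp
qed

text \<open>Otherwise \<open>f\<close> is \<open>z\<^sup>n\<close> times a function without zeros
  near the origin, which the estimate for \<open>m = n + 1\<close> contradicts.\<close>

lemma holomorphic_zero_of_flat_values:
  assumes hol: "f holomorphic_on ball 0 R" and "R > 0"
    and small: "\<And>m e. e > 0 \<Longrightarrow> \<exists>z. z \<noteq> 0 \<and> norm z < e \<and> norm (f z) \<le> A * norm z ^ m"
    and w: "w \<in> ball 0 R"
  shows "f w = 0"
proof (rule ccontr)
  assume fw: "f w \<noteq> 0"
  have cont: "isCont f 0"
    using hol \<open>R > 0\<close> by (meson centre_in_ball continuous_on_eq_continuous_at holomorphic_on_imp_continuous_on open_ball)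
  have f0: "f 0 = 0"
  proof (rule continuous_zero_of_small_values[OF cont])
    show "\<exists>z. z \<noteq> 0 \<and> norm z < e \<and> norm (f z) \<le> A * norm z" if "e > 0" for e
      using small[OF that, of 1] by simp
  qed
  then have nc: "\<not> f constant_on ball 0 R"
    using fw w \<open>R > 0\<close> unfolding constant_on_def by (metis centre_in_ball)
  obtain g r n where n: "0 < n" "0 < r" "ball (0::complex) r \<subseteq> ball 0 R" "g holomorphic_on ball 0 r"
      "\<And>w. w \<in> ball 0 r \<Longrightarrow> f w = (w - 0) ^ n * g w" "\<And>w. w \<in> ball 0 r \<Longrightarrow> g w \<noteq> 0"
  proof (rule holomorphic_factor_zero_nonconstant[OF hol open_ball connected_ball _ f0 nc])
    show "0 \<in> ball 0 R" using \<open>R > 0\<close> by simp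
  qed (rule that)
  have "isCont g 0"
    using n by (meson centre_in_ball continuous_on_eq_continuous_at holomorphic_on_imp_continuous_on open_ball)
  moreover have "\<exists>z. z \<noteq> 0 \<and> norm z < e \<and> norm (g z) \<le> A * norm z" if "e > 0" for e
  proof -
    have "min e r > 0" using n(2) that by simp
    from small[OF this, of "Suc n"]
    obtain z where z: "z \<noteq> 0" "norm z < min e r" "norm (f z) \<le> A * norm z ^ Suc n" by blast
    then have "norm z ^ n * norm (g z) \<le> norm z ^ n * (A * norm z)"
      using n(5)[of z] by (simp add: norm_mult norm_power algebra_simps)
    then have "norm (g z) \<le> A * norm z"
      using z(1) by (subst (asm) mult_le_cancel_left_pos) auto
    then show ?thesis using z by auto
  qed
  ultimately have "g 0 = 0" by (rule continuous_zero_of_small_values)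
  then show False using n(2,6) by auto
qed

text \<open>For \<open>a = |u|\<^sup>2\<close> and \<open>u\<^sub>0 = 1\<close>, the equation
  \<open>a |x|\<^sup>2 = Re x\<close> says that \<open>x u\<close> lies on the sphere
  \<open>|Z|\<^sup>2 = Re Z\<^sub>0\<close>.\<close>

lemma circle_disc:
  assumes "a > 0"
  defines "m \<equiv> complex_of_real (1 / (2 * a))"
  shows "a * (norm x)\<^sup>2 \<le> Re x \<longleftrightarrow> norm (x - m) \<le> 1 / (2 * a)"
    and "a * (norm x)\<^sup>2 = Re x \<longleftrightarrow> norm (x - m) = 1 / (2 * a)"
    and "a * (norm x)\<^sup>2 = Re x \<longleftrightarrow> norm (2 * a * x - 1) = 1"
proof -
  have "(norm (x - m))\<^sup>2 = (norm x)\<^sup>2 - Re x / a + (1 / (2 * a))\<^sup>2"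
    unfolding cmod_power2 m_def using assms(1) by (simp add: power2_eq_square algebra_simps)
  then have eq: "(norm (x - m))\<^sup>2 - (1 / (2 * a))\<^sup>2 = (a * (norm x)\<^sup>2 - Re x) / a"
    using assms by (simp add: diff_divide_distrib)
  have "norm (x - m) \<le> 1 / (2 * a) \<longleftrightarrow> (norm (x - m))\<^sup>2 - (1 / (2 * a))\<^sup>2 \<le> 0"
    using assms by (simp add: abs_le_square_iff[symmetric])
  then show "a * (norm x)\<^sup>2 \<le> Re x \<longleftrightarrow> norm (x - m) \<le> 1 / (2 * a)"
    unfolding eq using assms by (simp add: divide_le_0_iff)
  have "norm (x - m) = 1 / (2 * a) \<longleftrightarrow> (norm (x - m))\<^sup>2 - (1 / (2 * a))\<^sup>2 = 0"
    using assms by (subst power2_eq_iff_nonneg[symmetric]) auto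
  then show *: "a * (norm x)\<^sup>2 = Re x \<longleftrightarrow> norm (x - m) = 1 / (2 * a)"
    unfolding eq using assms by simp
  have "2 * a * x - 1 = 2 * a * (x - m)" using assms by (simp add: algebra_simps)
  then have "norm (2 * a * x - 1) = 2 * a * norm (x - m)"
    using assms by (metis abs_of_pos mult_pos_pos norm_mult norm_of_real of_real_mult of_real_numeral zero_less_numeral)
  then show "a * (norm x)\<^sup>2 = Re x \<longleftrightarrow> norm (2 * a * x - 1) = 1"
    unfolding * using assms by (simp add: field_simps)
qed

text \<open>A rational parametrization of the circle, with the origin at \<open>t =
  0\<close>.\<close>

lemma circle_point:
  fixes a t :: real
  defines "x \<equiv> complex_of_real t / (complex_of_real (a * t) + \<i>)"
  shows "a * (norm x)\<^sup>2 = Re x" "norm x \<le> \<bar>t\<bar>" "t \<noteq> 0 \<Longrightarrow> x \<noteq> 0"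
    "\<bar>a * t\<bar> \<le> 1 \<Longrightarrow> \<bar>t\<bar> \<le> 2 * norm x"
proof -
  define d where "d = complex_of_real (a * t) + \<i>"
  have d0: "d \<noteq> 0" by (simp add: d_def complex_eq_iff)
  have nx: "norm x = \<bar>t\<bar> / norm d" by (simp add: x_def d_def norm_divide)
  have "Re x = Re (of_real t * cnj d) / (norm d)\<^sup>2"
    unfolding x_def d_def[symmetric] by (simp add: complex_div_cnj[of _ d] flip: of_real_power)
  then show "a * (norm x)\<^sup>2 = Re x"
    unfolding nx using d0 by (simp add: d_def power_divide power2_eq_square)
  have "\<bar>Im d\<bar> \<le> norm d" by (rule abs_Im_le_cmod)
  then have "1 \<le> norm d" by (simp add: d_def)
  then have "\<bar>t\<bar> * 1 \<le> \<bar>t\<bar> * norm d" by (intro mult_left_mono) auto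
  then show "norm x \<le> \<bar>t\<bar>" unfolding nx using d0 by (simp add: divide_le_eq)
  have "\<bar>t\<bar> * norm d \<le> \<bar>t\<bar> * 2" if "\<bar>a * t\<bar> \<le> 1"
    using norm_triangle_ineq[of "complex_of_real (a * t)" \<i>] that
    by (intro mult_left_mono) (simp_all add: d_def norm_of_real del: of_real_mult)
  then show "\<bar>a * t\<bar> \<le> 1 \<Longrightarrow> \<bar>t\<bar> \<le> 2 * norm x"
    unfolding nx using d0 by (simp add: field_simps)
  show "t \<noteq> 0 \<Longrightarrow> x \<noteq> 0" using d0 by (simp add: x_def d_def)
qed

text \<open>In the coordinate \<open>w = 2 a x - 1\<close> the circle is the unit circle, on which
  \<open>cnj w = 1 / w\<close>. Substituting this turns the two sides into a function that is
  holomorphic on an annulus, to which the identity theorem applies.\<close>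

lemma reflection_on_circle:
  fixes f :: "'n::finite \<Rightarrow> complex \<Rightarrow> complex"
  assumes f: "\<And>i. f i holomorphic_on ball 0 R" and h: "h holomorphic_on ball 0 R"
    and "a > 0" and aR: "1 / a < R"
    and lim: "0 islimpt {x. a * (norm x)\<^sup>2 = Re x \<and> (\<Sum>i\<in>UNIV. (norm (f i x))\<^sup>2) = Re (h x)}"
    and x: "a * (norm x)\<^sup>2 = Re x"
  shows "(\<Sum>i\<in>UNIV. (norm (f i x))\<^sup>2) = Re (h x)"
proof -
  define r where "r = 2 * a * R - 1"
  define A where "A = {w :: complex. 1 / r < norm (w - 0) \<and> norm (w - 0) < r}"
  define p where "p = (\<lambda>w. (1 + w) / (2 * complex_of_real a))"
  \<comment> \<open>On the unit circle the map \<open>q\<close> agrees with the conjugate of \<open>p\<close>.\<close>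
  define q where "q = (\<lambda>w. p (1 / w))"
  define F where "F = (\<lambda>w. (\<Sum>i\<in>UNIV. f i (p w) * (cnj \<circ> f i \<circ> cnj) (q w)) - (h (p w) + (cnj \<circ> h \<circ> cnj) (q w)) / 2)"
  have r: "r > 1" using aR \<open>a > 0\<close> by (simp add: r_def field_simps)
  have "open A"
    unfolding A_def by (intro open_Collect_conj open_Collect_less continuous_intros)
  have "connected A" unfolding A_def by (rule connected_annulus) simp
  have A0: "w \<noteq> 0" if "w \<in> A" for w using that r by (auto simp: A_def)
  have pb: "p w \<in> ball 0 R" if "norm w < r" for w
  proof -
    have "norm (1 + w) < 2 * a * R" using that norm_triangle_ineq[of 1 w] by (simp add: r_def)
    then show ?thesis using \<open>a > 0\<close> by (simp add: p_def norm_divide norm_mult field_simps)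
  qed
  have pA: "p w \<in> ball 0 R" "q w \<in> ball 0 R" if "w \<in> A" for w
  proof -
    show "p w \<in> ball 0 R" using pb that by (simp add: A_def)
    have "1 / norm w < r" using that A0[OF that] r by (simp add: A_def field_simps)
    then show "q w \<in> ball 0 R" unfolding q_def by (intro pb) (simp add: norm_divide)
  qed
  have hp: "p holomorphic_on A" unfolding p_def using \<open>a > 0\<close> by (intro holomorphic_intros) auto
  have hq: "q holomorphic_on A" unfolding q_def p_def using \<open>a > 0\<close> A0 by (intro holomorphic_intros) auto
  have comp: "(\<lambda>w. g (p w)) holomorphic_on A" "(\<lambda>w. (cnj \<circ> g \<circ> cnj) (q w)) holomorphic_on A"
    if "g holomorphic_on ball 0 R" for g
  proof -
    show "(\<lambda>w. g (p w)) holomorphic_on A"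
      using holomorphic_on_compose_gen[OF hp that image_subsetI[OF pA(1)]] by (simp add: o_def)
    have "cnj ` ball 0 R = ball (0::complex) R"
    proof (intro equalityI subsetI)
      fix z :: complex assume "z \<in> ball 0 R" then show "z \<in> cnj ` ball 0 R" by (intro image_eqI[of _ _ "cnj z"]) auto
    qed auto
    then have "cnj \<circ> g \<circ> cnj holomorphic_on ball 0 R"
      using that by (intro holomorphic_on_compose_cnj_cnj) auto
    from holomorphic_on_compose_gen[OF hq this image_subsetI[OF pA(2)]]
    show "(\<lambda>w. (cnj \<circ> g \<circ> cnj) (q w)) holomorphic_on A" by (simp add: o_def)
  qed
  have hF: "F holomorphic_on A"
    unfolding F_def by (intro holomorphic_intros comp f h) auto
  have F: "F w = complex_of_real ((\<Sum>i\<in>UNIV. (norm (f i (p w)))\<^sup>2) - Re (h (p w)))" if "norm w = 1" for w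
  proof -
    have "w * cnj w = 1" using that by (simp flip: complex_norm_square)
    then have "cnj (1 / w) = w" by (auto simp: divide_eq_eq)
    then have "cnj (q w) = p w" by (simp add: q_def p_def)
    then show ?thesis
      by (simp add: F_def complex_norm_square[symmetric] complex_add_cnj)
  qed
  define U where "U = {w. norm w = 1 \<and> F w = 0}"
  have pinv: "p (2 * a * y - 1) = y" for y :: complex using \<open>a > 0\<close> by (simp add: p_def)
  have "-1 islimpt U"
    unfolding islimpt_approachable
  proof (intro allI impI)
    fix e :: real assume "e > 0"
    then have "e / (2 * a) > 0" using \<open>a > 0\<close> by simp
    then obtain y where y: "a * (norm y)\<^sup>2 = Re y" "(\<Sum>i\<in>UNIV. (norm (f i y))\<^sup>2) = Re (h y)" "y \<noteq> 0" "norm y < e / (2 * a)"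
      using lim unfolding islimpt_approachable by (force simp: dist_norm)
    let ?w = "2 * a * y - 1"
    have n: "norm ?w = 1" using y(1) circle_disc(3)[OF \<open>a > 0\<close>] by simp
    then have "F ?w = 0" using F[OF n] y(2) by (simp only: pinv) simp
    then have "?w \<in> U" using n by (simp add: U_def)
    moreover have "?w \<noteq> -1" using y \<open>a > 0\<close> by simp
    moreover have "dist ?w (-1) < e"
      using y(4) \<open>a > 0\<close> by (simp add: dist_norm norm_mult field_simps)
    ultimately show "\<exists>w\<in>U. w \<noteq> -1 \<and> dist w (-1) < e" by blast
  qed
  note lim_U = this
  have onA: "z \<in> A" if "norm z = 1" for z using that r by (simp add: A_def)
  have nx: "norm (2 * a * x - 1) = 1" using x circle_disc(3)[OF \<open>a > 0\<close>] by simp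
  have "F (2 * a * x - 1) = 0"
  proof (rule analytic_continuation[OF hF \<open>open A\<close> \<open>connected A\<close> _ _ lim_U])
    show "U \<subseteq> A" "-1 \<in> A" "2 * a * x - 1 \<in> A" using onA nx unfolding U_def by auto
    show "F z = 0" if "z \<in> U" for z using that by (simp add: U_def)
  qed
  then have "complex_of_real ((\<Sum>i\<in>UNIV. (norm (f i x))\<^sup>2) - Re (h x)) = 0"
    using F[OF nx] by (simp only: pinv)
  then show ?thesis by (simp only: of_real_eq_0_iff)
qed

text \<open>The maximum principle for \<open>C\<close> and for \<open>1 / C\<close> forces
  \<open>|C| = 1\<close> on the disc.\<close>

lemma unimodular_on_circle_imp_constant:
  assumes C: "C holomorphic_on ball 0 R" and "a > 0" and aR: "1 / a < R"
    and one: "\<And>x. a * (norm x)\<^sup>2 = Re x \<Longrightarrow> norm (C x) = 1"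
    and nz: "\<And>x. a * (norm x)\<^sup>2 \<le> Re x \<Longrightarrow> C x \<noteq> 0"
  shows "\<exists>c. norm c = 1 \<and> (\<forall>x\<in>ball 0 R. C x = c)"
proof -
  define s where "s = 1 / (2 * a)"
  define m where "m = complex_of_real s"
  have s: "s > 0" "2 * s < R" using \<open>a > 0\<close> aR by (simp_all add: s_def)
  have sub: "cball m s \<subseteq> ball 0 R"
  proof
    fix x assume "x \<in> cball m s"
    then have "norm (x - m) \<le> s" by (simp add: dist_norm norm_minus_commute)
    moreover have "norm m = s" using s by (simp add: m_def)
    ultimately show "x \<in> ball 0 R" using norm_triangle_ineq[of "x - m" m] s by simp
  qed
  have cb: "x \<in> cball m s \<longleftrightarrow> a * (norm x)\<^sup>2 \<le> Re x" "x \<in> sphere m s \<longleftrightarrow> a * (norm x)\<^sup>2 = Re x" for x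
    using circle_disc(1,2)[OF \<open>a > 0\<close>, of x] by (auto simp: m_def s_def dist_norm norm_minus_commute)
  have C': "C holomorphic_on cball m s" using C sub by (rule holomorphic_on_subset)
  have I: "(\<lambda>x. inverse (C x)) holomorphic_on cball m s"
    by (intro holomorphic_intros C') (use nz cb(1) in blast)
  have le: "norm (g x) \<le> 1" if "g holomorphic_on cball m s" "\<And>x. x \<in> sphere m s \<Longrightarrow> norm (g x) = 1" "x \<in> cball m s" for g x
  proof (rule maximum_modulus_frontier[of g "cball m s"])
    show "g holomorphic_on interior (cball m s)" "continuous_on (closure (cball m s)) g"
      using that(1) by (auto intro: holomorphic_on_subset holomorphic_on_imp_continuous_on)
    show "norm (g z) \<le> 1" if "z \<in> frontier (cball m s)" for z
      using that s \<open>\<And>x. x \<in> sphere m s \<Longrightarrow> norm (g x) = 1\<close>[of z] by (simp add: frontier_cball)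
  qed (use that in auto)
  have norm1: "norm (C x) = 1" if x: "x \<in> cball m s" for x
  proof -
    have "norm (C x) \<le> 1" using le[OF C' _ x] one cb(2) by blast
    moreover have "norm (inverse (C x)) \<le> 1" using le[OF I _ x] one cb(2) by (simp add: norm_inverse)
    moreover have "norm (C x) > 0" using nz cb(1) x by simp
    ultimately show ?thesis by (simp add: norm_inverse inverse_le_1_iff)
  qed
  have "C constant_on ball 0 R"
  proof (rule maximum_modulus_principle[OF C, of "ball m s" m])
    show "norm (C z) \<le> norm (C m)" if "z \<in> ball m s" for z
      using that norm1[of z] norm1[of m] s by auto
  qed (use sub s in auto)
  then obtain c where c: "\<And>x. x \<in> ball 0 R \<Longrightarrow> C x = c" by (auto simp: constant_on_def)
  moreover have "m \<in> cball m s" using s by simp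
  then have "norm c = 1" using norm1 c sub by fastforce
  ultimately show ?thesis by blast
qed

section \<open>Rotations fixing one coordinate\<close>

definition rot :: "'n \<Rightarrow> complex \<Rightarrow> complex^'n \<Rightarrow> complex^'n" where
  "rot i0 \<zeta> Z = (\<chi> i. if i = i0 then Z $ i else \<zeta> * Z $ i)"

definition tail :: "'n \<Rightarrow> complex^'n \<Rightarrow> complex^'n" where
  "tail i0 Z = (\<chi> i. if i = i0 then 0 else Z $ i)"

lemma norm_vec_power2: "(norm (Z :: complex^'n))\<^sup>2 = (\<Sum>i\<in>UNIV. (norm (Z $ i))\<^sup>2)"
  by (simp add: norm_vec_def L2_set_def sum_nonneg)

lemma norm_smult [simp]: "norm (c *s Z) = norm c * norm (Z :: complex^'n)"
proof -
  have "(norm (c *s Z))\<^sup>2 = (norm c * norm Z)\<^sup>2"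
    by (simp add: norm_vec_power2 power_mult_distrib norm_mult sum_distrib_left)
  then show ?thesis by (rule power2_eq_imp_eq) auto
qed

lemma norm_tail: "(norm Z)\<^sup>2 = (norm (Z $ i0))\<^sup>2 + (norm (tail i0 Z))\<^sup>2"
proof -
  have "(norm Z)\<^sup>2 = (norm (Z $ i0))\<^sup>2 + (\<Sum>i\<in>UNIV - {i0}. (norm (Z $ i))\<^sup>2)"
    unfolding norm_vec_power2 by (rule sum.remove) auto
  also have "(\<Sum>i\<in>UNIV - {i0}. (norm (Z $ i))\<^sup>2) = (norm (tail i0 Z))\<^sup>2"
    unfolding norm_vec_power2 by (rule sum.mono_neutral_cong_left) (auto simp: tail_def)
  finally show ?thesis .
qed

lemma tail_le: "norm (tail i0 Z) \<le> norm Z"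
  using norm_tail[of Z i0] by (auto intro: power2_le_imp_le[OF _ norm_ge_zero])

lemma rot_diff_rot: "rot i0 \<zeta> Z - rot i0 \<xi> Z = (\<zeta> - \<xi>) *s tail i0 Z"
  by (simp add: rot_def tail_def vec_eq_iff algebra_simps)

lemma rot_rot: "rot i0 \<zeta> (rot i0 \<xi> Z) = rot i0 (\<zeta> * \<xi>) Z"
  by (simp add: rot_def vec_eq_iff)

lemma rot_one [simp]: "rot i0 1 Z = Z"
  by (simp add: rot_def vec_eq_iff)

lemma rot_nth: "rot i0 \<zeta> Z $ i = (if i = i0 then Z $ i else \<zeta> * Z $ i)"
  by (simp add: rot_def)

lemma rot_smult: "rot i0 \<zeta> (c *s Z) = c *s rot i0 \<zeta> Z"
  by (simp add: rot_def vec_eq_iff)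

lemma rot_diff: "rot i0 \<zeta> (Y - Z) = rot i0 \<zeta> Y - rot i0 \<zeta> Z"
  by (simp add: rot_def vec_eq_iff algebra_simps)

lemma norm_rot_power2: "(norm (rot i0 \<zeta> Z))\<^sup>2 = (norm (Z $ i0))\<^sup>2 + (norm \<zeta>)\<^sup>2 * (norm (tail i0 Z))\<^sup>2"
proof -
  have "tail i0 (rot i0 \<zeta> Z) = \<zeta> *s tail i0 Z" by (simp add: rot_def tail_def vec_eq_iff)
  then show ?thesis using norm_tail[of "rot i0 \<zeta> Z" i0] by (simp add: rot_nth power_mult_distrib)
qed

lemma norm_rot: "norm \<zeta> = 1 \<Longrightarrow> norm (rot i0 \<zeta> Z) = norm Z"
  using norm_rot_power2[of i0 \<zeta> Z] norm_tail[of Z i0] by (auto intro: power2_eq_imp_eq)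

lemma dist_rot: "norm \<zeta> = 1 \<Longrightarrow> dist (rot i0 \<zeta> Y) (rot i0 \<zeta> Z) = dist Y Z"
  by (simp add: dist_norm norm_rot flip: rot_diff)

lemma bounded_linear_rot: "bounded_linear (rot i0 \<zeta> :: complex^'n \<Rightarrow> complex^'n)"
proof -
  have "linear (rot i0 \<zeta> :: complex^'n \<Rightarrow> complex^'n)"
    by (rule linearI) (simp_all add: rot_def vec_eq_iff algebra_simps)
  then show ?thesis by (simp add: linear_conv_bounded_linear)
qed

text \<open>The function \<open>\<phi>\<close> is an automorphism restricted to the line spanned by
  \<open>u\<close>. The assumptions \<open>first\<close> and \<open>par\<close> say that it
  multiplies the part of \<open>x u\<close> off the coordinate \<open>i0\<close> by a factor
  \<open>C x\<close>. A zero of \<open>C\<close> at \<open>x\<close> would give \<open>|\<phi> x| =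
  |x|\<close>, which is too short for the lower bound \<open>lower\<close> once \<open>u\<close> is
  longer than \<open>K\<close>; this is why only long directions are considered.\<close>

lemma line_rigidity:
  fixes \<phi> :: "complex \<Rightarrow> complex^'n" and u :: "complex^'n"
  defines "a \<equiv> (norm u)\<^sup>2"
  assumes hol: "\<And>i. (\<lambda>x. \<phi> x $ i) holomorphic_on ball 0 R"
    and u0: "u $ i0 = 1" and u: "1 < norm u" "K < norm u" and aR: "1 / a < R"
    and first: "\<And>x. x \<in> ball 0 R \<Longrightarrow> \<phi> x $ i0 = x"
    and par: "\<And>x i j. x \<in> ball 0 R \<Longrightarrow> i \<noteq> i0 \<Longrightarrow> j \<noteq> i0 \<Longrightarrow> \<phi> x $ i * u $ j = \<phi> x $ j * u $ i"
    and lim: "0 islimpt {x. a * (norm x)\<^sup>2 = Re x \<and> (norm (\<phi> x))\<^sup>2 = Re (\<phi> x $ i0)}"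
    and lower: "\<And>x. x \<in> ball 0 R \<Longrightarrow> norm u * norm x \<le> K * norm (\<phi> x)"
  shows "\<exists>C. norm C = 1 \<and> (\<forall>x\<in>ball 0 R. \<phi> x = x *s rot i0 C u)"
proof -
  have a: "a > 1" using u(1) by (simp add: a_def)
  have R: "R > 0" using aR a by (smt (verit) divide_pos_pos)
  have tu: "(norm (tail i0 u))\<^sup>2 = a - 1" using norm_tail[of u i0] u0 by (simp add: a_def)
  have circ: "(norm (\<phi> x))\<^sup>2 = Re (\<phi> x $ i0)" if "a * (norm x)\<^sup>2 = Re x" for x
  proof -
    have "(\<Sum>i\<in>UNIV. (norm (\<phi> x $ i))\<^sup>2) = Re (\<phi> x $ i0)"
      by (rule reflection_on_circle[OF hol hol, of a])
        (use a aR lim that in \<open>auto simp: norm_vec_power2\<close>)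
    then show ?thesis by (simp add: norm_vec_power2)
  qed
  have \<phi>0: "\<phi> 0 = 0" using circ[of 0] first[of 0] R by simp
  obtain b where b: "b \<noteq> i0" "u $ b \<noteq> 0"
  proof (rule ccontr)
    assume "\<not> thesis"
    then have "tail i0 u = 0" using that by (auto simp: tail_def vec_eq_iff)
    then show False using tu a by simp
  qed
  define C where "C = (\<lambda>x. (if x = 0 then deriv (\<lambda>x. \<phi> x $ b) 0 else (\<phi> x $ b - \<phi> 0 $ b) / (x - 0)) / u $ b)"
  have hC: "C holomorphic_on ball 0 R"
    unfolding C_def using pole_lemma_open[OF hol[of b] open_ball, of 0] b
    by (intro holomorphic_intros) auto
  have \<phi>: "\<phi> x = x *s rot i0 (C x) u" if "x \<in> ball 0 R" for x
  proof (cases "x = 0")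
    case False
    have "\<phi> x $ i = x * rot i0 (C x) u $ i" for i
      using first[OF that] par[OF that, of i b] b False
      by (auto simp: rot_nth u0 C_def \<phi>0 field_simps)
    then show ?thesis by (simp add: vec_eq_iff)
  qed (simp add: \<phi>0)
  have circ_ball: "x \<in> ball 0 R" if "a * (norm x)\<^sup>2 = Re x" for x
  proof (cases "x = 0")
    case False
    have "a * norm x * norm x \<le> 1 * norm x"
      using that complex_Re_le_cmod[of x] by (simp add: power2_eq_square mult.assoc)
    then have "a * norm x \<le> 1" using False by (metis mult_le_cancel_right_pos zero_less_norm_iff)
    then have "norm x \<le> 1 / a" using a by (simp add: field_simps)
    then show ?thesis using aR by simp
  qed (use R in simp)
  have one: "norm (C x) = 1" if x: "a * (norm x)\<^sup>2 = Re x" "x \<noteq> 0" for x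
  proof -
    have "(norm x)\<^sup>2 * (1 + (norm (C x))\<^sup>2 * (a - 1)) = (norm (\<phi> x))\<^sup>2"
      unfolding \<phi>[OF circ_ball[OF x(1)]] by (simp add: power_mult_distrib norm_rot_power2 u0 tu)
    also have "\<dots> = (norm x)\<^sup>2 * a"
      using circ[OF x(1)] first[OF circ_ball[OF x(1)]] x(1) by (simp add: mult.commute)
    finally have "1 + (norm (C x))\<^sup>2 * (a - 1) = a" using x(2) by simp
    then have "(norm (C x))\<^sup>2 * (a - 1) = 1 * (a - 1)" by (simp add: algebra_simps)
    then have "(norm (C x))\<^sup>2 = 1" using a by (metis less_irrefl mult_right_cancel right_minus_eq)
    then show ?thesis by (simp add: power2_eq_1_iff) (smt (verit) norm_ge_zero)
  qed
  have C0: "norm (C 0) = 1"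
  proof (rule ccontr)
    assume "norm (C 0) \<noteq> 1"
    moreover have "isCont (\<lambda>x. norm (C x)) 0"
      using hC R by (intro continuous_norm) (meson centre_in_ball continuous_on_eq_continuous_at holomorphic_on_imp_continuous_on open_ball)
    ultimately have "\<forall>\<^sub>F x in at 0. norm (C x) \<noteq> 1"
      unfolding isCont_def by (rule tendsto_imp_eventually_ne[rotated])
    then obtain d where d: "d > 0" "\<And>x. x \<noteq> 0 \<Longrightarrow> dist x 0 < d \<Longrightarrow> norm (C x) \<noteq> 1"
      unfolding eventually_at by auto
    obtain x where "a * (norm x)\<^sup>2 = Re x" "x \<noteq> 0" "dist x 0 < d"
      using lim d(1) unfolding islimpt_approachable by blast
    then show False using one d(2) by blast
  qed
  have nz: "C x \<noteq> 0" if x: "a * (norm x)\<^sup>2 \<le> Re x" for x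
  proof
    assume C: "C x = 0"
    then have "x \<noteq> 0" using C0 by auto
    have "a * norm x * norm x \<le> 1 * norm x"
      using x complex_Re_le_cmod[of x] by (simp add: power2_eq_square mult.assoc)
    then have "a * norm x \<le> 1" using \<open>x \<noteq> 0\<close> by (metis mult_le_cancel_right_pos zero_less_norm_iff)
    then have "norm x \<le> 1 / a" using a by (simp add: field_simps)
    then have xR: "x \<in> ball 0 R" using aR by simp
    have "(norm (rot i0 (C x) u))\<^sup>2 = 1" by (simp add: norm_rot_power2 u0 C)
    then have "norm (rot i0 (C x) u) = 1" by (simp add: power2_eq_1_iff) (smt (verit) norm_ge_zero)
    then have "norm u * norm x \<le> K * norm x"
      using lower[OF xR] unfolding \<phi>[OF xR] by simp
    then show False using u(2) \<open>x \<noteq> 0\<close> by simp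
  qed
  obtain c where "norm c = 1" "\<And>x. x \<in> ball 0 R \<Longrightarrow> C x = c"
    using unimodular_on_circle_imp_constant[OF hC _ aR _ nz] one C0 a by (metis less_trans zero_less_one)
  then show ?thesis using \<phi> by auto
qed

section \<open>Strong pseudoconvexity of a bumpy sphere\<close>

lemma d_z_d_zbar:
  fixes \<rho> :: "complex^'n \<Rightarrow> real" and \<rho>1 :: "complex^'n \<Rightarrow> complex^'n \<Rightarrow> real"
    and \<rho>2 :: "complex^'n \<Rightarrow> complex^'n \<Rightarrow> complex^'n \<Rightarrow> real"
  assumes 1: "\<And>z. (\<rho> has_derivative (\<lambda>v. \<rho>1 v z)) (at z)"
    and 2: "\<And>v z. (\<rho>1 v has_derivative (\<lambda>w. \<rho>2 v w z)) (at z)"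
  shows "d_z j (d_zbar k (\<lambda>w. of_real (\<rho> w))) z =
    ((\<rho>2 (axis k 1) (axis j 1) z + \<i> * \<rho>2 (axis k \<i>) (axis j 1) z)
      - \<i> * (\<rho>2 (axis k 1) (axis j \<i>) z + \<i> * \<rho>2 (axis k \<i>) (axis j \<i>) z)) / 4"
proof -
  have f1: "frechet_derivative (\<lambda>w. complex_of_real (\<rho> w)) (at z) = (\<lambda>v. of_real (\<rho>1 v z))" for z
    by (rule frechet_derivative_at[symmetric]) (rule has_derivative_of_real[OF 1])
  have d1: "d_zbar k (\<lambda>w. complex_of_real (\<rho> w)) = (\<lambda>z. (of_real (\<rho>1 (axis k 1) z) + \<i> * of_real (\<rho>1 (axis k \<i>) z)) / 2)"
    by (simp add: d_zbar_def f1 fun_eq_iff)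
  have "((\<lambda>z. (complex_of_real (\<rho>1 (axis k 1) z) + \<i> * of_real (\<rho>1 (axis k \<i>) z)) / 2) has_derivative
      (\<lambda>w. (of_real (\<rho>2 (axis k 1) w z) + \<i> * of_real (\<rho>2 (axis k \<i>) w z)) / 2)) (at z)"
    unfolding divide_inverse
    by (intro has_derivative_mult_left has_derivative_add has_derivative_mult_right has_derivative_of_real 2)
  note f2 = frechet_derivative_at[OF this, symmetric]
  show ?thesis
    unfolding d_z_def d1 f2 by (simp add: algebra_simps add_divide_distrib diff_divide_distrib)
qed

text \<open>The error term \<open>e\<close> is the Hessian of the bumps; without it the Levi form is
  \<open>|v|\<^sup>2\<close>, for all \<open>v\<close> and not just for tangent vectors.\<close>

lemma levi_form_pos:
  fixes \<rho> :: "complex^'n \<Rightarrow> real" and \<rho>1 :: "complex^'n \<Rightarrow> complex^'n \<Rightarrow> real"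
    and e :: "complex^'n \<Rightarrow> complex^'n \<Rightarrow> complex^'n \<Rightarrow> real"
  assumes 1: "\<And>z. (\<rho> has_derivative (\<lambda>v. \<rho>1 v z)) (at z)"
    and 2: "\<And>v z. (\<rho>1 v has_derivative (\<lambda>w. 2 * (w \<bullet> v) - e v w z)) (at z)"
    and e: "\<And>v w z. norm v = 1 \<Longrightarrow> norm w = 1 \<Longrightarrow> \<bar>e v w z\<bar> \<le> b" and b: "b * (real CARD('n))\<^sup>2 \<le> 1 / 4"
    and v: "v \<noteq> 0"
  shows "levi_form \<rho> z v > 0"
proof -
  define E where "E = (\<lambda>j k :: 'n. ((e (axis k 1) (axis j 1) z + \<i> * e (axis k \<i>) (axis j 1) z)
      - \<i> * (e (axis k 1) (axis j \<i>) z + \<i> * e (axis k \<i>) (axis j \<i>) z)) / 4)"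
  have na: "norm (axis j (1::complex) :: complex^'n) = 1" "norm (axis j \<i> :: complex^'n) = 1" for j
    by (simp_all add: norm_eq_1 inner_axis_axis)
  have E: "norm (E j k) \<le> b" for j k
  proof -
    let ?x = "of_real (e (axis k 1) (axis j 1) z) :: complex" and ?y = "\<i> * of_real (e (axis k \<i>) (axis j 1) z)"
      and ?x' = "of_real (e (axis k 1) (axis j \<i>) z) :: complex" and ?y' = "\<i> * of_real (e (axis k \<i>) (axis j \<i>) z)"
    have "norm ((?x + ?y) - \<i> * (?x' + ?y')) \<le> norm (?x + ?y) + norm (\<i> * (?x' + ?y'))"
      by (rule norm_triangle_ineq4)
    also have "\<dots> = norm (?x + ?y) + norm (?x' + ?y')" by (simp add: norm_mult)
    also have "\<dots> \<le> (norm ?x + norm ?y) + (norm ?x' + norm ?y')" by (intro add_mono norm_triangle_ineq)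
    also have "\<dots> \<le> (b + b) + (b + b)"
      by (intro add_mono) (simp_all add: norm_mult e na)
    finally show ?thesis by (simp add: E_def norm_divide)
  qed
  have L: "d_z j (d_zbar k (\<lambda>w. of_real (\<rho> w))) z = (if j = k then 1 else 0) - E j k" for j k
    unfolding d_z_d_zbar[OF 1 2] E_def
    by (auto simp: inner_axis_axis inner_complex_def field_simps)
  have "(\<Sum>j\<in>UNIV. \<Sum>k\<in>UNIV. d_z j (d_zbar k (\<lambda>w. of_real (\<rho> w))) z * v $ j * cnj (v $ k))
      = (\<Sum>j\<in>UNIV. \<Sum>k\<in>UNIV. (if j = k then v $ j * cnj (v $ k) else 0) - E j k * v $ j * cnj (v $ k))"
    unfolding L by (intro sum.cong refl) (simp add: algebra_simps)
  also have "\<dots> = of_real ((norm v)\<^sup>2) - (\<Sum>j\<in>UNIV. \<Sum>k\<in>UNIV. E j k * v $ j * cnj (v $ k))"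
    by (simp add: sum_subtractf norm_vec_power2 flip: complex_norm_square)
  finally have levi: "levi_form \<rho> z v = (norm v)\<^sup>2 - Re (\<Sum>j\<in>UNIV. \<Sum>k\<in>UNIV. E j k * v $ j * cnj (v $ k))"
    unfolding levi_form_def by simp
  have "norm (\<Sum>j\<in>UNIV. \<Sum>k\<in>UNIV. E j k * v $ j * cnj (v $ k)) \<le> (\<Sum>j\<in>(UNIV::'n set). \<Sum>k\<in>(UNIV::'n set). b * norm v * norm v)"
  proof (intro sum_norm_le)
    fix j k
    have "0 \<le> b" using E[of j k] norm_ge_zero order_trans by blast
    then show "norm (E j k * v $ j * cnj (v $ k)) \<le> b * norm v * norm v"
      unfolding norm_mult complex_mod_cnj
      by (intro mult_mono E Finite_Cartesian_Product.norm_nth_le) auto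
  qed
  also have "\<dots> = (b * (real CARD('n))\<^sup>2) * (norm v)\<^sup>2"
    by (simp add: power2_eq_square)
  also have "\<dots> \<le> 1 / 4 * (norm v)\<^sup>2"
    by (intro mult_right_mono b) simp
  finally have "Re (\<Sum>j\<in>UNIV. \<Sum>k\<in>UNIV. E j k * v $ j * cnj (v $ k)) \<le> 1 / 4 * (norm v)\<^sup>2"
    using complex_Re_le_cmod order_trans by blast
  moreover have "(norm v)\<^sup>2 > 0" using v by simp
  ultimately show ?thesis unfolding levi by linarith
qed

text \<open>The data of the construction: centres \<open>c j\<close> on the sphere, with directions
  \<open>u j\<close> and radii \<open>\<delta> j\<close>. The assumption \<open>c_decrease\<close>
  separates the rings of bumps by gaps of growing relative width, \<open>d_separation\<close> keeps
  the bumps of one ring apart, \<open>d_flat\<close> makes them small to infinite order, and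
  \<open>directions_dense\<close> says that the multiples of the directions which occur infinitely
  often are dense. By \<open>d_small\<close> the second derivatives of the bumps are small enough
  for \<open>levi_form_pos\<close>.\<close>

locale bumpy_sphere =
  fixes i0 :: "'n::finite" and H :: "nat \<Rightarrow> complex set" and u c :: "nat \<Rightarrow> complex^'n" and \<delta> :: "nat \<Rightarrow> real"
  assumes H_circle: "\<zeta> \<in> H k \<Longrightarrow> norm \<zeta> = 1"
    and H_one: "1 \<in> H k"
    and H_mult: "\<zeta> \<in> H k \<Longrightarrow> \<xi> \<in> H k \<Longrightarrow> \<zeta> * \<xi> \<in> H k"
    and H_inverse: "\<zeta> \<in> H k \<Longrightarrow> inverse \<zeta> \<in> H k"
    and H_mono: "j \<le> k \<Longrightarrow> H j \<subseteq> H k"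
    and u_first: "u j $ i0 = 1"
    and c_direction: "c j = (c j $ i0) *s u j"
    and c_sphere: "(norm (c j))\<^sup>2 = Re (c j $ i0)"
    and c_tail: "tail i0 (c j) \<noteq> 0"
    and c_decrease: "real (j + 2) * norm (c (Suc j)) \<le> norm (c j)"
    and d_pos: "0 < \<delta> j"
    and d_tail: "4 * \<delta> j \<le> norm (tail i0 (c j))"
    and d_separation: "\<zeta> \<in> H j \<Longrightarrow> \<xi> \<in> H j \<Longrightarrow> \<zeta> \<noteq> \<xi> \<Longrightarrow> 4 * \<delta> j \<le> norm (\<zeta> - \<xi>) * norm (tail i0 (c j))"
    and d_flat: "\<delta> j \<le> norm (c j $ i0) ^ j"
    and d_small: "4000 * (real CARD('n))\<^sup>2 * \<delta> j \<le> 1"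
    and directions_dense: "closure {x. x $ i0 \<noteq> 0 \<and> infinite {j. x = x $ i0 *s u j}} = UNIV"
begin

definition balls :: "((complex^'n) \<times> real) set" where
  "balls = {(rot i0 \<zeta> (c j), \<delta> j) | \<zeta> j. \<zeta> \<in> H j}"

lemma other_index: "\<exists>b. b \<noteq> i0"
proof (rule ccontr)
  assume "\<not> ?thesis"
  then have "tail i0 (c 0) = 0" by (auto simp: tail_def vec_eq_iff)
  then show False using c_tail by blast
qed

lemma norm_c_pos: "norm (c j) > 0"
  using c_tail[of j] tail_le[of i0 "c j"] by (metis less_le_trans zero_less_norm_iff)

lemma d_le_norm: "4 * \<delta> j \<le> norm (c j)"
  using d_tail[of j] tail_le[of i0 "c j"] by linarith

lemma norm_c_decrease:
  assumes "i < j"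
  shows "real (i + 2) * norm (c j) \<le> norm (c i)"
proof -
  have le: "norm (c (Suc k)) \<le> norm (c k)" for k
  proof -
    have "1 * norm (c (Suc k)) \<le> real (k + 2) * norm (c (Suc k))" by (intro mult_right_mono) auto
    then show ?thesis using c_decrease[of k] by linarith
  qed
  have "norm (c j) \<le> norm (c (Suc i))"
    using lift_Suc_antimono_le[of "\<lambda>k. norm (c k)", OF le] assms by simp
  then have "real (i + 2) * norm (c j) \<le> real (i + 2) * norm (c (Suc i))" by (intro mult_left_mono) auto
  then show ?thesis using c_decrease[of i] by linarith
qed

lemma norm_c_antimono: "i \<le> j \<Longrightarrow> norm (c j) \<le> norm (c i)"
proof (cases "i = j")
  case False
  assume "i \<le> j"
  then have "1 * norm (c j) \<le> real (i + 2) * norm (c j)" by (intro mult_right_mono) auto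
  then show ?thesis using norm_c_decrease[of i j] False \<open>i \<le> j\<close> by simp
qed simp

lemma norm_c_tendsto: "(\<lambda>j. norm (c j)) \<longlonglongrightarrow> 0"
proof (rule tendsto_sandwich[of "\<lambda>_. 0" _ _ "\<lambda>j. norm (c 0) / real j"])
  have "norm (c j) \<le> norm (c 0) / real j" if j: "j > 0" for j
  proof -
    obtain k where k: "j = Suc k" using j by (cases j) auto
    have "real j * norm (c j) \<le> real (k + 2) * norm (c j)" unfolding k by (intro mult_right_mono) auto
    also have "\<dots> \<le> norm (c k)" unfolding k by (rule norm_c_decrease) simp
    also have "\<dots> \<le> norm (c 0)" by (rule norm_c_antimono) simp
    finally show ?thesis using j by (simp add: field_simps)
  qed
  then show "\<forall>\<^sub>F j in sequentially. norm (c j) \<le> norm (c 0) / real j"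
    using eventually_gt_at_top[of 0] by (rule eventually_mono[rotated])
  show "(\<lambda>j. norm (c 0) / real j) \<longlonglongrightarrow> 0"
    by (rule tendsto_divide_0[OF tendsto_const]) (rule filterlim_real_at_infinity_sequentially)
qed auto

lemma norm_in_ball:
  assumes "\<zeta> \<in> H j" "dist Z (rot i0 \<zeta> (c j)) < \<delta> j"
  shows "3 * norm (c j) < 4 * norm Z" "4 * norm Z < 5 * norm (c j)"
proof -
  have "norm (rot i0 \<zeta> (c j)) = norm (c j)" using H_circle assms(1) by (simp add: norm_rot)
  moreover have "dist Z (rot i0 \<zeta> (c j)) < norm (c j) / 4"
    using assms(2) d_le_norm[of j] by linarith
  ultimately show "3 * norm (c j) < 4 * norm Z" "4 * norm Z < 5 * norm (c j)"
    using norm_triangle_ineq2[of Z "rot i0 \<zeta> (c j)"] norm_triangle_ineq3[of Z "rot i0 \<zeta> (c j)"]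
    unfolding dist_norm by linarith+
qed

text \<open>Points of the balls around the orbit of \<open>c i\<close> have norm within a quarter of
  \<open>|c i|\<close> of \<open>|c i|\<close>, and these ranges are disjoint since \<open>|c (i +
  1)| \<le> |c i| / 2\<close>.\<close>

lemma ring_unique:
  assumes i: "3 * norm (c i) < 4 * x" "4 * x < 5 * norm (c i)" and j: "3 * norm (c j) < 4 * x" "4 * x < 5 * norm (c j)"
  shows "i = j"
proof -
  have *: False if "i < j" "3 * norm (c i) < 4 * x" "4 * x < 5 * norm (c j)" for i j
  proof -
    have "2 * norm (c j) \<le> real (i + 2) * norm (c j)" by (intro mult_right_mono) auto
    then show False using norm_c_decrease[OF that(1)] that(2,3) norm_c_pos[of j] by linarith
  qed
  show ?thesis using *[of i j] *[of j i] i j by (meson nat_neq_iff)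
qed

lemma orbit_separated:
  assumes "\<zeta> \<in> H j" "\<xi> \<in> H j" "dist (rot i0 \<zeta> (c j)) (rot i0 \<xi> (c j)) < 4 * \<delta> j"
  shows "\<zeta> = \<xi>"
proof (rule ccontr)
  assume "\<zeta> \<noteq> \<xi>"
  from d_separation[OF assms(1,2) this] assms(3)[unfolded dist_norm rot_diff_rot norm_smult]
  show False by linarith
qed

lemma d_le_one: "\<delta> j \<le> 1 / (4000 * (real CARD('n))\<^sup>2)" "\<delta> j \<le> 1"
proof -
  have "real CARD('n) \<ge> 1" by (simp add: Suc_le_eq)
  then have *: "(real CARD('n))\<^sup>2 \<ge> 1" by simp
  then show 1: "\<delta> j \<le> 1 / (4000 * (real CARD('n))\<^sup>2)"
    using d_small[of j] by (simp add: field_simps)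
  have "1 * \<delta> j \<le> (4000 * (real CARD('n))\<^sup>2) * \<delta> j"
    by (rule mult_right_mono) (use d_pos[of j] * in linarith)+
  then show "\<delta> j \<le> 1" using d_small[of j] by linarith
qed

sublocale disjoint_balls balls
proof
  fix z and d :: real assume "(z, d) \<in> balls"
  then show "0 < d \<and> d \<le> 1" using d_pos d_le_one by (auto simp: balls_def)
next
  fix z z' x and d d' :: real
  assume b: "(z, d) \<in> balls" "(z', d') \<in> balls" and x: "dist x z < d" "dist x z' < d'"
  obtain \<zeta> j where 1: "z = rot i0 \<zeta> (c j)" "d = \<delta> j" "\<zeta> \<in> H j" using b(1) by (auto simp: balls_def)
  obtain \<xi> i where 2: "z' = rot i0 \<xi> (c i)" "d' = \<delta> i" "\<xi> \<in> H i" using b(2) by (auto simp: balls_def)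
  have ij: "i = j"
    using ring_unique[of i "norm x" j] norm_in_ball[of \<zeta> j x] norm_in_ball[of \<xi> i x] x 1 2 by simp
  have "dist z z' < 2 * \<delta> j"
    using x 1 2 ij dist_triangle2[of z z' x] by (simp add: dist_commute)
  then have "\<zeta> = \<xi>"
    using orbit_separated[of \<zeta> j \<xi>] 1 2 ij d_pos[of j] by simp
  then show "(z, d) = (z', d')" using 1 2 ij by simp
qed

lemma insideI: "\<zeta> \<in> H j \<Longrightarrow> dist Z (rot i0 \<zeta> (c j)) < \<delta> j \<Longrightarrow> inside Z"
  unfolding inside_def by (auto simp: balls_def)

lemma inside_cases:
  assumes "inside Z"
  obtains \<zeta> j where "\<zeta> \<in> H j" "dist Z (rot i0 \<zeta> (c j)) < \<delta> j"
  using assms unfolding inside_def by (auto simp: balls_def)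

definition \<rho> :: "complex^'n \<Rightarrow> real" where
  "\<rho> Z = (norm Z)\<^sup>2 - Re (Z $ i0) - bump Z"

definition M :: "(complex^'n) set" where
  "M = {Z. norm Z < 1 / 4 \<and> \<rho> Z = 0}"

lemma Re_first: "Re (Z $ i0) = Z \<bullet> axis i0 1"
  by (simp add: inner_axis inner_complex_def)

lemma rho_has_derivative:
  "(\<rho> has_derivative (\<lambda>v. 2 * (Z \<bullet> v) - v \<bullet> axis i0 1 - bump_deriv v Z)) (at Z)"
  unfolding \<rho>_def[abs_def] Re_first power2_norm_eq_inner
  by (auto intro!: derivative_eq_intros bump_has_derivative simp: inner_commute)

lemma rho1_has_derivative:
  "((\<lambda>Z. 2 * (Z \<bullet> v) - v \<bullet> axis i0 1 - bump_deriv v Z) has_derivative (\<lambda>w. 2 * (w \<bullet> v) - bump_deriv2 v w Z)) (at Z)"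
  by (auto intro!: derivative_eq_intros bump_deriv_has_derivative)

lemma rho_Ck_on: "Ck_on k UNIV \<rho>"
proof -
  let ?P = "\<lambda>f :: complex^'n \<Rightarrow> real. \<exists>r w s. f = (\<lambda>Z. r * (Z \<bullet> Z) + Z \<bullet> w + s)"
  have "Ck_on k UNIV (\<lambda>Z :: complex^'n. Z \<bullet> Z - Z \<bullet> axis i0 1)"
  proof (rule Ck_on_coinduct[of ?P])
    show "?P (\<lambda>Z. Z \<bullet> Z - Z \<bullet> axis i0 1)"
      by (rule exI[of _ 1], rule exI[of _ "- axis i0 1"], rule exI[of _ 0]) simp
    fix f assume "?P f"
    then obtain r w s where f: "f = (\<lambda>Z. r * (Z \<bullet> Z) + Z \<bullet> w + s)" by blast
    have "(f has_derivative (\<lambda>v. Z \<bullet> ((2 * r) *\<^sub>R v) + v \<bullet> w)) (at Z)" for Z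
      unfolding f by (auto intro!: derivative_eq_intros simp: inner_commute algebra_simps)
    moreover have "?P (\<lambda>Z. Z \<bullet> ((2 * r) *\<^sub>R v) + v \<bullet> w)" for v
      by (rule exI[of _ 0], rule exI[of _ "(2 * r) *\<^sub>R v"], rule exI[of _ "v \<bullet> w"]) simp
    ultimately show "\<exists>f'. (\<forall>x. (f has_derivative f' x) (at x)) \<and> (\<forall>v. ?P (\<lambda>x. f' x v))"
      by (intro exI[of _ "\<lambda>Z v. Z \<bullet> ((2 * r) *\<^sub>R v) + v \<bullet> w"]) blast
  qed
  moreover have "Ck_on k UNIV (\<lambda>Z. (- 1) * bump Z)"
    by (rule tame_Ck_on, unfold bump_def) (intro tame.intros)
  ultimately have "Ck_on k UNIV (\<lambda>Z. (Z \<bullet> Z - Z \<bullet> axis i0 1) + (- 1) * bump Z)"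
    by (rule Ck_on_UNIV_add)
  then show ?thesis by (simp add: \<rho>_def[abs_def] Re_first power2_norm_eq_inner)
qed

lemma bump_deriv_bounds:
  "\<bar>bump_deriv v Z\<bar> \<le> 1 / 4 * norm v"
  "norm v = 1 \<Longrightarrow> norm w = 1 \<Longrightarrow> \<bar>bump_deriv2 v w Z\<bar> \<le> 1 / (4 * (real CARD('n))\<^sup>2)"
proof -
  let ?n = "(real CARD('n))\<^sup>2" and ?e = "1 / (4000 * (real CARD('n))\<^sup>2)"
  have n: "?n \<ge> 1" using one_le_power[of "real CARD('n)" 2] by (simp add: Suc_le_eq)
  have e: "?e \<ge> 0" "d \<le> ?e" if "(z, d) \<in> balls" for z d
    using that d_le_one(1) by (auto simp: balls_def)
  have "?e \<le> 1" by (subst divide_le_eq_1_pos) (use n in linarith)+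
  then have "1000 * ?e\<^sup>2 \<le> 1000 * ?e * 1"
    unfolding power2_eq_square mult.assoc by (intro mult_left_mono) auto
  then have le: "1000 * ?e\<^sup>2 \<le> 1 / (4 * ?n)" by simp
  have ge: "0 \<le> ?e" by simp
  have "\<bar>bump_deriv v Z\<bar> \<le> 1000 * ?e\<^sup>2 * norm v"
    by (rule bump_deriv_small(1)[OF e(2) ge])
  also have "\<dots> \<le> 1 / (4 * ?n) * norm v" by (intro mult_right_mono le) simp
  also have "\<dots> \<le> 1 / 4 * norm v" using n by (intro mult_right_mono) (auto simp: field_simps)
  finally show "\<bar>bump_deriv v Z\<bar> \<le> 1 / 4 * norm v" .
  have b2: "\<bar>bump_deriv2 v w Z\<bar> \<le> 1000 * ?e\<^sup>2 * norm v * norm w"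
    by (rule bump_deriv_small(2)[OF e(2) ge])
  assume "norm v = 1" "norm w = 1"
  then show "\<bar>bump_deriv2 v w Z\<bar> \<le> 1 / (4 * ?n)"
    using order.trans[OF b2, of "1 / (4 * (real CARD('n))\<^sup>2)"] le by (simp only: mult_1_right)
qed

lemma spsc_M: "spsc_hypersurface M"
  unfolding spsc_hypersurface_def
proof (intro ballI exI conjI impI)
  fix q assume q: "q \<in> M"
  show "q \<in> ball 0 (1 / 4)" using q by (simp add: M_def)
  show "local_defining_function M (ball 0 (1 / 4)) \<rho>"
    unfolding local_defining_function_def smooth_on_def
  proof (intro conjI allI ballI)
    show "Ck_on k (ball 0 (1 / 4)) \<rho>" for k by (rule Ck_on_subset[OF rho_Ck_on]) simp
    show "M \<inter> ball 0 (1 / 4) = {z \<in> ball 0 (1 / 4). \<rho> z = 0}" by (auto simp: M_def)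
    fix z assume z: "z \<in> ball (0 :: complex^'n) (1 / 4)"
    let ?v = "axis i0 1 :: complex^'n"
    have v: "norm ?v = 1" by (simp add: norm_eq_1 inner_axis_axis)
    have "z \<bullet> ?v \<le> 1 / 4" using norm_cauchy_schwarz[of z ?v] z v by simp
    moreover have "?v \<bullet> ?v = 1" using v by (simp add: norm_eq_1)
    moreover have "\<bar>bump_deriv ?v z\<bar> \<le> 1 / 4" using bump_deriv_bounds(1)[of ?v z] v by simp
    ultimately have "2 * (z \<bullet> ?v) - ?v \<bullet> axis i0 1 - bump_deriv ?v z < 0" by linarith
    then have "frechet_derivative \<rho> (at z) ?v \<noteq> 0"
      unfolding frechet_derivative_at[OF rho_has_derivative, symmetric] by simp
    then show "\<exists>v. frechet_derivative \<rho> (at z) v \<noteq> 0" ..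
  qed simp
  fix v assume "v \<noteq> (0 :: complex^'n)"
  show "levi_form \<rho> q v > 0"
    by (rule levi_form_pos[OF rho_has_derivative rho1_has_derivative bump_deriv_bounds(2) _ \<open>v \<noteq> 0\<close>]) auto
qed

lemma not_inside_zero: "\<not> inside 0"
  using norm_in_ball(1) norm_c_pos by (metis inside_cases mult_zero_right norm_zero not_less_iff_gr_or_eq zero_less_mult_iff zero_less_numeral)

lemma zero_in_M: "0 \<in> M"
  using not_inside_zero by (simp add: M_def \<rho>_def bump_outside)

lemma in_M_iff:
  assumes "(norm Z)\<^sup>2 = Re (Z $ i0)" "norm Z < 1 / 4"
  shows "Z \<in> M \<longleftrightarrow> \<not> inside Z"
  using assms bump_pos_iff[of Z] bump_outside[of Z] by (auto simp: M_def \<rho>_def)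

text \<open>In this range of norms only rings \<open>j \<ge> k\<close> occur, and \<open>H j\<close>
  contains \<open>\<zeta>\<close>.\<close>

lemma bump_rot:
  assumes "\<zeta> \<in> H k" "4 * norm Z \<le> 3 * norm (c k)"
  shows "bump (rot i0 \<zeta> Z) = bump Z"
proof -
  have *: "inside (rot i0 \<zeta> Y) \<and> height (rot i0 \<zeta> Y) = height Y"
    if Y: "inside Y" "4 * norm Y \<le> 3 * norm (c k)" and \<zeta>: "\<zeta> \<in> H k" for \<zeta> Y
  proof -
    obtain \<xi> j where \<xi>: "\<xi> \<in> H j" "dist Y (rot i0 \<xi> (c j)) < \<delta> j" using Y(1) by (rule inside_cases)
    have "\<not> j < k"
      using norm_in_ball(1)[OF \<xi>] Y(2) norm_c_antimono[of j k] by force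
    then have "\<zeta> * \<xi> \<in> H j" using H_mono[of k j] \<zeta> \<xi>(1) H_mult by auto
    then have b: "(rot i0 (\<zeta> * \<xi>) (c j), \<delta> j) \<in> balls" "(rot i0 \<xi> (c j), \<delta> j) \<in> balls"
      using \<xi> by (auto simp: balls_def)
    have d: "dist (rot i0 \<zeta> Y) (rot i0 (\<zeta> * \<xi>) (c j)) = dist Y (rot i0 \<xi> (c j))"
      using H_circle[OF \<zeta>] by (simp add: dist_rot flip: rot_rot)
    show ?thesis
      using inside_ball(1,3)[OF b(1), of "rot i0 \<zeta> Y"] inside_ball(3)[OF b(2), of Y] d \<xi>(2)
      by (simp add: dist_norm)
  qed
  show ?thesis
  proof (cases "inside Z")
    case True
    then show ?thesis using *[OF True assms(2,1)] by (simp add: bump_def)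
  next
    case False
    have n: "norm \<zeta> = 1" using H_circle assms(1) .
    have "\<not> inside (rot i0 \<zeta> Z)"
    proof
      assume i: "inside (rot i0 \<zeta> Z)"
      have "rot i0 (inverse \<zeta>) (rot i0 \<zeta> Z) = Z"
        using n by (simp add: rot_rot) (metis left_inverse norm_zero rot_one zero_neq_one)
      then show False
        using *[OF i _ H_inverse[OF assms(1)]] assms(2) n False by (simp add: norm_rot)
    qed
    then show ?thesis using False by (simp add: bump_outside)
  qed
qed

lemma holo_on_rot: "open U \<Longrightarrow> holo_on U (rot i \<zeta> :: complex^'n \<Rightarrow> complex^'n)"
  unfolding holo_on_def
  using bounded_linear_imp_has_derivative[OF bounded_linear_rot, of i \<zeta>]
  by (auto simp: rot_smult intro!: exI[of _ "rot i \<zeta>"])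

lemma rot_aut_rep:
  assumes "\<zeta> \<in> H k"
  shows "aut_rep M 0 (rot i0 \<zeta>)"
proof -
  define U where "U = ball (0 :: complex^'n) (3 / 4 * norm (c k))"
  have n: "norm \<zeta> = 1" and z: "\<zeta> \<noteq> 0" using H_circle[OF assms] by auto
  have inv: "rot i0 (inverse \<zeta>) (rot i0 \<zeta> Z) = Z" "rot i0 \<zeta> (rot i0 (inverse \<zeta>) Z) = Z" for Z :: "complex^'n"
    using z by (simp_all add: rot_rot)
  have nr: "norm (rot i0 \<zeta> Z) = norm Z" "norm (rot i0 (inverse \<zeta>) Z) = norm Z" for Z
    using n by (simp_all add: norm_rot norm_inverse)
  have U: "rot i0 \<zeta> Z \<in> U \<longleftrightarrow> Z \<in> U" "rot i0 (inverse \<zeta>) Z \<in> U \<longleftrightarrow> Z \<in> U" for Z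
    by (simp_all add: U_def nr)
  have "homeomorphism U U (rot i0 \<zeta>) (rot i0 (inverse \<zeta>))"
    using U inv by (intro homeomorphismI linear_continuous_on bounded_linear_rot) auto
  then have "biholo U U (rot i0 \<zeta>)"
    unfolding biholo_def using holo_on_rot by (auto simp: U_def)
  moreover have mem: "rot i0 \<zeta> Z \<in> M \<longleftrightarrow> Z \<in> M" if "Z \<in> U" for Z
    using bump_rot[OF assms, of Z] that nr by (simp add: M_def \<rho>_def U_def rot_nth)
  have "rot i0 \<zeta> ` (M \<inter> U) = M \<inter> U"
  proof (intro equalityI subsetI)
    fix Z assume "Z \<in> M \<inter> U"
    then show "Z \<in> rot i0 \<zeta> ` (M \<inter> U)"
      using mem[of "rot i0 (inverse \<zeta>) Z"] U inv by (intro image_eqI[of _ _ "rot i0 (inverse \<zeta>) Z"]) auto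
  qed (use mem U in auto)
  moreover have "rot i0 \<zeta> 0 = 0" by (simp add: rot_def vec_eq_iff)
  moreover have "0 \<in> U" using norm_c_pos[of k] by (simp add: U_def)
  ultimately show ?thesis unfolding aut_rep_def by blast
qed

end

section \<open>Rigidity of automorphisms\<close>

lemma linear_smult: "bounded_linear (\<lambda>x :: complex. x *s (B :: complex^'n))"
proof -
  have "linear (\<lambda>x :: complex. x *s B)"
    by (rule linearI) (simp_all add: vec_eq_iff algebra_simps)
  then show ?thesis by (simp add: linear_conv_bounded_linear)
qed

lemma holo_on_line:
  fixes f :: "complex^'n \<Rightarrow> complex^'m" and A B :: "complex^'n"
  assumes "holo_on U f"
  shows "(\<lambda>x. f (A + x *s B) $ i) holomorphic_on {x. A + x *s B \<in> U}"
  unfolding holomorphic_on_def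
proof
  fix x assume "x \<in> {x. A + x *s B \<in> U}"
  then obtain D where D: "(f has_derivative D) (at (A + x *s B))" "\<And>c v. D (c *s v) = c *s D v"
    using assms unfolding holo_on_def by blast
  have "((\<lambda>x. A + x *s B) has_derivative (\<lambda>h. h *s B)) (at x)"
    using has_derivative_add[OF has_derivative_const bounded_linear_imp_has_derivative[OF linear_smult[of B]], of A "at x"]
    by simp
  from has_derivative_compose[OF this D(1)]
  have "((\<lambda>x. f (A + x *s B) $ i) has_derivative (\<lambda>h. D (h *s B) $ i)) (at x)"
    by (rule bounded_linear.has_derivative[OF bounded_linear_vec_nth])
  then have "((\<lambda>x. f (A + x *s B) $ i) has_field_derivative (D B $ i)) (at x)"
    unfolding has_field_derivative_def D(2) by (simp add: mult.commute[of _ "D B $ i"])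
  then show "(\<lambda>x. f (A + x *s B) $ i) field_differentiable at x within {x. A + x *s B \<in> U}"
    using field_differentiable_at_within field_differentiable_def by blast
qed

lemma has_derivative_imp_linear_bound:
  fixes f :: "'a::real_normed_vector \<Rightarrow> 'b::real_normed_vector"
  assumes "(f has_derivative D) (at 0)" "f 0 = 0"
  shows "\<exists>K d. K \<ge> 1 \<and> d > 0 \<and> (\<forall>z. norm z < d \<longrightarrow> norm (f z) \<le> K * norm z)"
proof -
  interpret bounded_linear D using assms(1) by (rule has_derivative_bounded_linear)
  obtain B where B: "B > 0" "\<And>z. norm (D z) \<le> norm z * B" using pos_bounded by blast
  obtain d where d: "d > 0" "\<And>z. norm z < d \<Longrightarrow> norm (f z - D z) \<le> norm z"
    using assms unfolding has_derivative_at_alt by (metis diff_zero mult_1 zero_less_one)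
  have "norm (f z) \<le> (B + 1) * norm z" if "norm z < d" for z
    using d(2)[OF that] B(2)[of z] norm_triangle_ineq[of "f z - D z" "D z"] by (simp add: algebra_simps)
  then show ?thesis using B(1) d(1) by (intro exI[of _ "B + 1"] exI[of _ d]) auto
qed

text \<open>If all powers stay within \<open>1 / 2\<close> of 1, then squaring enlarges the distance
  to 1 by a factor \<open>|x + 1| \<ge> 3 / 2\<close> each time.\<close>

lemma eq_one_of_powers_near_one:
  fixes \<eta> :: complex
  assumes "\<And>k. norm (\<eta> ^ k - 1) < 1 / 2"
  shows "\<eta> = 1"
proof (rule ccontr)
  assume "\<eta> \<noteq> 1"
  have "(3 / 2) ^ m * norm (\<eta> - 1) \<le> norm (\<eta> ^ (2 ^ m) - 1)" for m
  proof (induction m)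
    case (Suc m)
    let ?x = "\<eta> ^ (2 ^ m)"
    have "\<eta> ^ (2 ^ Suc m) = ?x\<^sup>2" unfolding power_Suc2 power_mult ..
    then have "\<eta> ^ (2 ^ Suc m) - 1 = (?x - 1) * (?x + 1)"
      by (simp only:) (simp add: algebra_simps power2_eq_square)
    moreover have "norm (?x + 1) \<ge> 3 / 2"
      using assms[of "2 ^ m"] norm_triangle_ineq4[of "?x + 1" "?x - 1"] by simp
    moreover have "3 / 2 * ((3 / 2) ^ m * norm (\<eta> - 1)) \<le> norm (?x + 1) * norm (?x - 1)"
      by (intro mult_mono Suc.IH calculation(2)) auto
    ultimately show ?case by (simp add: norm_mult mult.commute)
  qed simp
  moreover obtain m where "1 / norm (\<eta> - 1) < (3 / 2) ^ m"
    using real_arch_pow[of "3 / 2" "1 / norm (\<eta> - 1)"] by auto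
  then have "1 < (3 / 2) ^ m * norm (\<eta> - 1)" using \<open>\<eta> \<noteq> 1\<close> by (simp add: divide_less_eq)
  ultimately show False using assms[of "2 ^ m"] by (smt (verit) half_gt_zero_iff field_sum_of_halves)
qed

text \<open>An automorphism of the germ on a small ball. The two-sided bound \<open>f_upper\<close>,
  \<open>f_lower\<close> is available because \<open>f\<close> and its inverse are differentiable at
  the origin; it limits by how much \<open>f\<close> can move a point between rings.\<close>

locale bumpy_automorphism = bumpy_sphere i0 H u c \<delta>
  for i0 :: "'n::finite" and H :: "nat \<Rightarrow> complex set" and u c :: "nat \<Rightarrow> complex^'n" and \<delta> :: "nat \<Rightarrow> real" +
  fixes f L :: "complex^'n \<Rightarrow> complex^'n" and r K :: real
  assumes r_pos: "0 < r" and K_ge: "1 \<le> K" and Kr: "4 * (K * r) \<le> 1"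
    and f_holo: "holo_on (ball 0 r) f"
    and L_deriv: "(f has_derivative L) (at 0)" and L_smult: "L (x *s Z) = x *s L Z"
    and f_upper: "norm Z < r \<Longrightarrow> norm (f Z) \<le> K * norm Z"
    and f_lower: "norm Z < r \<Longrightarrow> norm Z \<le> K * norm (f Z)"
    and f_M: "norm Z < r \<Longrightarrow> f Z \<in> M \<longleftrightarrow> Z \<in> M"
begin

lemma small: "norm Z < r \<Longrightarrow> norm Z < 1 / 4" "norm Z < r \<Longrightarrow> norm (f Z) < 1 / 4"
proof -
  assume Z: "norm Z < r"
  have "1 * r \<le> K * r" using K_ge r_pos by (intro mult_right_mono) auto
  then show "norm Z < 1 / 4" using Z Kr by linarith
  have "K * norm Z < K * r" using Z K_ge by (intro mult_strict_left_mono) auto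
  then show "norm (f Z) < 1 / 4" using f_upper[OF Z] Kr by linarith
qed

lemma f_sphere_of_outside:
  assumes "norm Z < r" "(norm Z)\<^sup>2 = Re (Z $ i0)" "\<not> inside Z" "\<not> inside (f Z)"
  shows "(norm (f Z))\<^sup>2 = Re (f Z $ i0)"
proof -
  have "f Z \<in> M" using f_M in_M_iff small assms by blast
  then show ?thesis using bump_outside[OF assms(4)] by (simp add: M_def \<rho>_def)
qed

lemma f_inside:
  assumes "norm Z < r" "(norm Z)\<^sup>2 = Re (Z $ i0)" "inside Z" "(norm (f Z))\<^sup>2 = Re (f Z $ i0)"
  shows "inside (f Z)"
  using f_M in_M_iff small assms by blast

lemma not_inside_gap:
  assumes "5 * norm (c (Suc k)) \<le> 4 * norm Z" "4 * norm Z \<le> 3 * norm (c k)"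
  shows "\<not> inside Z"
proof
  assume "inside Z"
  then obtain \<zeta> j where "\<zeta> \<in> H j" "dist Z (rot i0 \<zeta> (c j)) < \<delta> j" by (rule inside_cases)
  note n = norm_in_ball[OF this]
  show False
  proof (cases "j \<le> k")
    case True
    then show False using norm_c_antimono[OF True] n assms by linarith
  next
    case False
    then show False using norm_c_antimono[of "Suc k" j] n assms by linarith
  qed
qed

text \<open>The bound \<open>1 / r < |w|\<close> puts the circle in which the line through
  \<open>w\<close> meets the sphere, together with the disc it bounds, inside the domain of
  \<open>f\<close>; the bound \<open>K < |w|\<close> is required in
  \<open>line_rigidity\<close>.\<close>

definition good :: "complex^'n \<Rightarrow> bool" where
  "good w \<longleftrightarrow> infinite {j. u j = w} \<and> K < norm w \<and> 1 / r < norm w"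

lemma good_props:
  assumes "good w"
  shows "w $ i0 = 1" "1 < norm w" "0 < (norm w)\<^sup>2" "1 / (norm w)\<^sup>2 < r / norm w"
proof -
  obtain j where "u j = w" using assms unfolding good_def by (metis (mono_tags) finite.emptyI empty_Collect_eq)
  then show "w $ i0 = 1" using u_first by blast
  show w: "1 < norm w" using assms K_ge by (auto simp: good_def)
  then show "0 < (norm w)\<^sup>2" by (intro zero_less_power) linarith
  have "1 < r * norm w" using assms r_pos by (simp add: good_def divide_less_eq mult.commute)
  moreover have w0: "0 < norm w" using w by linarith
  ultimately have "1 / norm w < r" by (simp only: divide_less_eq if_True mult.commute)
  then have "(1 / norm w) / norm w < r / norm w" by (rule divide_strict_right_mono[OF _ w0])
  then show "1 / (norm w)\<^sup>2 < r / norm w" by (simp add: power2_eq_square)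
qed

lemma good_index:
  assumes "good w" "e > 0"
  shows "\<exists>j\<ge>m. u j = w \<and> norm (c j) < e"
proof -
  obtain N where N: "\<And>j. j \<ge> N \<Longrightarrow> norm (c j) < e"
    using LIMSEQ_D[OF norm_c_tendsto assms(2)] by auto
  obtain j where "j \<ge> max m N" "u j = w"
    using assms(1) unfolding good_def infinite_nat_iff_unbounded_le by blast
  then show ?thesis using N by auto
qed

lemma ball_line: "x \<in> ball 0 (r / norm w) \<Longrightarrow> norm (x *s (w :: complex^'n)) < r"
  by (cases "w = 0") (auto simp: less_divide_eq r_pos)

lemma line_holo: "(\<lambda>x. f (x *s w) $ i) holomorphic_on ball 0 (r / norm w)"
  by (rule holomorphic_on_subset[OF holo_on_line[OF f_holo, of 0 w i, unfolded add_0]])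
    (use ball_line in auto)

text \<open>Choose \<open>k\<close> so large that the gap between the rings \<open>k\<close> and
  \<open>k + 1\<close> is wide compared with \<open>K\<^sup>2\<close>. The point of the circle with
  norm about \<open>4 K |c (k + 1)|\<close> and its image both lie in this gap, where
  \<open>M\<close> is the sphere.\<close>

lemma circle_limit:
  assumes w: "good w"
  shows "0 islimpt {x. (norm w)\<^sup>2 * (norm x)\<^sup>2 = Re x \<and> (norm (f (x *s w)))\<^sup>2 = Re (f (x *s w) $ i0)}"
  unfolding islimpt_approachable
proof (intro allI impI)
  fix e :: real assume "e > 0"
  note wp = good_props[OF w]
  have w0: "norm w > 0" using wp(2) by linarith
  define \<epsilon> where "\<epsilon> = min (1 / norm w) (min r e)"
  have "\<epsilon> > 0" using \<open>e > 0\<close> r_pos w0 by (simp add: \<epsilon>_def)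
  have K4: "0 < 4 * K" using K_ge by simp
  obtain N where N: "\<And>j. j \<ge> N \<Longrightarrow> norm (c j) < \<epsilon> / (4 * K)"
    using LIMSEQ_D[OF norm_c_tendsto, of "\<epsilon> / (4 * K)"] \<open>\<epsilon> > 0\<close> K4 by auto
  obtain k where k: "k \<ge> N" "32 * K\<^sup>2 \<le> 3 * real (k + 2)"
  proof -
    obtain m :: nat where m: "32 * K\<^sup>2 < real m" using reals_Archimedean2 by blast
    show thesis by (rule that[of "max N m"]) (use m in auto)
  qed
  define q where "q = norm (c (Suc k))"
  have q: "q > 0" using norm_c_pos by (simp add: q_def)
  \<comment> \<open>Up to a factor of 2 the norm of the point below. The factor 4 leaves room for the distortion \<open>K\<close> of \<open>f\<close>.\<close>
  define s where "s = 4 * K * q"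
  have s: "s > 0" using q K_ge by (simp add: s_def)
  have s\<epsilon>: "s < \<epsilon>" using N[of "Suc k"] k(1) K4 by (simp add: s_def q_def field_simps)
  have sp: "8 * K * s \<le> 3 * norm (c k)"
  proof -
    have "8 * K * s = (32 * K\<^sup>2) * q" by (simp add: s_def power2_eq_square)
    also have "\<dots> \<le> 3 * real (k + 2) * q" using k(2) q by (intro mult_right_mono) auto
    finally show ?thesis using norm_c_decrease[of k "Suc k"] by (simp add: q_def algebra_simps)
  qed
  define t where "t = s / norm w"
  have t: "t > 0" using s w0 by (simp add: t_def)
  have tN: "t * norm w = s" using w0 by (simp add: t_def)
  define x where "x = complex_of_real t / (complex_of_real ((norm w)\<^sup>2 * t) + \<i>)"
  note xp = circle_point[where a = "(norm w)\<^sup>2" and t = t, folded x_def]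
  note circ = xp(1)
  define Z where "Z = x *s w"
  have "(norm w)\<^sup>2 * t = norm w * s" by (simp add: power2_eq_square t_def)
  also have "\<dots> \<le> 1" using s\<epsilon> w0 by (simp add: \<epsilon>_def field_simps)
  finally have "\<bar>(norm w)\<^sup>2 * t\<bar> \<le> 1" using t by (simp add: abs_mult)
  then have "t * norm w \<le> 2 * norm x * norm w" "norm x * norm w \<le> t * norm w"
    using xp(2,4) t by (intro mult_right_mono; simp)+
  then have Z1: "s \<le> 2 * norm Z" "norm Z \<le> s"
    unfolding tN Z_def norm_smult by (simp_all only: mult.assoc)
  have sphere: "(norm Z)\<^sup>2 = Re (Z $ i0)"
    using circ wp(1) by (simp add: Z_def power_mult_distrib mult.commute)
  have Zr: "norm Z < r" using Z1(2) s\<epsilon> by (simp add: \<epsilon>_def)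
  have Ks: "s \<le> K * s" using mult_right_mono[OF K_ge] s by fastforce
  have sq: "q \<le> K * q" using mult_right_mono[OF K_ge, of q] q by simp
  have "\<not> inside Z"
  proof (rule not_inside_gap[of k])
    have "4 * q \<le> s" using sq unfolding s_def by linarith
    then show "5 * norm (c (Suc k)) \<le> 4 * norm Z" using Z1(1) q unfolding q_def[symmetric] by linarith
    show "4 * norm Z \<le> 3 * norm (c k)" using sp Z1(2) Ks s unfolding mult.assoc by linarith
  qed
  moreover have "\<not> inside (f Z)"
  proof (rule not_inside_gap[of k])
    have "K * (4 * q) \<le> K * (2 * norm (f Z))"
      using f_lower[OF Zr] Z1(1) by (simp add: s_def)
    then have "4 * q \<le> 2 * norm (f Z)" using K_ge by simp
    then show "5 * norm (c (Suc k)) \<le> 4 * norm (f Z)" using q by (simp flip: q_def)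
    have "norm (f Z) \<le> K * s"
      using f_upper[OF Zr] Z1(2) K_ge by (smt (verit) mult_left_mono)
    then show "4 * norm (f Z) \<le> 3 * norm (c k)" using sp Ks s unfolding mult.assoc by linarith
  qed
  ultimately have "(norm (f Z))\<^sup>2 = Re (f Z $ i0)"
    using f_sphere_of_outside[OF Zr sphere] by blast
  moreover have "x \<noteq> 0" using t xp(3) by simp
  moreover have "dist x 0 < e"
  proof -
    have "norm x \<le> norm Z" using wp(2) by (simp add: Z_def mult_le_cancel_left1)
    then show ?thesis using Z1(2) s\<epsilon> by (simp add: \<epsilon>_def)
  qed
  ultimately show "\<exists>x\<in>{x. (norm w)\<^sup>2 * (norm x)\<^sup>2 = Re x \<and> (norm (f (x *s w)))\<^sup>2 = Re (f (x *s w) $ i0)}. x \<noteq> 0 \<and> dist x 0 < e"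
    using circ unfolding Z_def by blast
qed

lemma circle_to_sphere:
  assumes w: "good w" and x: "(norm w)\<^sup>2 * (norm x)\<^sup>2 = Re x"
  shows "(norm (f (x *s w)))\<^sup>2 = Re (f (x *s w) $ i0)"
  unfolding norm_vec_power2
  by (rule reflection_on_circle[OF line_holo line_holo good_props(3,4)[OF w] _ x])
    (use circle_limit[OF w] in \<open>simp add: norm_vec_power2\<close>)

text \<open>The centre lies on the sphere but not on \<open>M\<close>, hence so does its image. By
  \<open>f_upper\<close> and \<open>f_lower\<close> the image cannot reach another ring.\<close>

lemma f_c_near_orbit:
  assumes w: "good w" and j: "u j = w" "2 * K \<le> real j" "norm (c j) < r"
  shows "\<exists>\<zeta>\<in>H j. dist (f (c j)) (rot i0 \<zeta> (c j)) < \<delta> j"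
proof -
  let ?n = "\<lambda>j. norm (c j)"
  have cw: "c j = (c j $ i0) *s w" using c_direction[of j] j(1) by simp
  have "(norm w)\<^sup>2 * (norm (c j $ i0))\<^sup>2 = Re (c j $ i0)"
    using c_sphere[of j] arg_cong[OF cw, of norm] by (simp add: power_mult_distrib mult.commute)
  from circle_to_sphere[OF w this] have sph: "(norm (f (c j)))\<^sup>2 = Re (f (c j) $ i0)"
    unfolding cw[symmetric] .
  have "inside (c j)" using insideI[OF H_one, of "c j" j] d_pos[of j] by simp
  from f_inside[OF j(3) c_sphere this sph] obtain \<zeta> i
    where \<zeta>: "\<zeta> \<in> H i" "dist (f (c j)) (rot i0 \<zeta> (c i)) < \<delta> i" by (rule inside_cases)
  note n = norm_in_ball[OF \<zeta>]
  have up: "norm (f (c j)) \<le> K * ?n j" and low: "?n j \<le> K * norm (f (c j))"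
    using f_upper f_lower j(3) by auto
  have "\<not> i < j"
  proof
    assume "i < j"
    then obtain k where k: "j = Suc k" "i \<le> k" by (cases j) auto
    have "(2 * K) * ?n j \<le> real (k + 2) * ?n j" using j(2) k(1) by (intro mult_right_mono) auto
    also have "\<dots> \<le> ?n k" unfolding k(1) by (rule norm_c_decrease) simp
    also have "\<dots> \<le> ?n i" by (rule norm_c_antimono[OF k(2)])
    finally show False using n(1) up norm_c_pos[of i] by linarith
  qed
  moreover have "\<not> j < i"
  proof
    assume "j < i"
    have "(2 * K) * ?n i \<le> real (j + 2) * ?n i" using j(2) by (intro mult_right_mono) auto
    also have "\<dots> \<le> ?n j" by (rule norm_c_decrease[OF \<open>j < i\<close>])
    finally have "K * (2 * ?n i) \<le> K * norm (f (c j))" using low by simp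
    then show False using n(2) K_ge norm_c_pos[of i] by simp
  qed
  ultimately have "i = j" by simp
  then show ?thesis using \<zeta> by blast
qed

text \<open>The identity theorem in the form in which it is applied to automorphisms: it is enough
  that \<open>g\<close> is of the order \<open>\<delta> j\<close> at the centres on the line, since
  \<open>\<delta> j \<le> |c j $ i0|\<^sup>j\<close>.\<close>

lemma line_zero:
  assumes w: "good w" and g: "g holomorphic_on ball 0 (r / norm w)"
    and le: "\<And>j \<zeta>. u j = w \<Longrightarrow> norm (c j) < r \<Longrightarrow> dist (f (c j)) (rot i0 \<zeta> (c j)) < \<delta> j \<Longrightarrow> norm (g (c j $ i0)) \<le> A * \<delta> j"
    and A: "A \<ge> 0" and x: "x \<in> ball 0 (r / norm w)"
  shows "g x = 0"
proof (rule holomorphic_zero_of_flat_values[OF g _ _ x, of A])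
  show "0 < r / norm w" using good_props(2)[OF w] r_pos by (intro divide_pos_pos) linarith+
  fix m :: nat and e :: real assume "e > 0"
  obtain m' :: nat where m': "2 * K \<le> real m'" using real_arch_simple by blast
  obtain j where j: "j \<ge> max m m'" "u j = w" "norm (c j) < min (min e r) 1"
    using good_index[OF w, of "min (min e r) 1" "max m m'"] \<open>e > 0\<close> r_pos by auto
  let ?x = "c j $ i0"
  have nx: "norm ?x \<le> norm (c j)" by (rule Finite_Cartesian_Product.norm_nth_le)
  obtain \<zeta> where "dist (f (c j)) (rot i0 \<zeta> (c j)) < \<delta> j"
    using f_c_near_orbit[OF w j(2)] j m' by fastforce
  then have "norm (g ?x) \<le> A * \<delta> j" using le j by simp
  also have "\<dots> \<le> A * norm ?x ^ j" using d_flat A by (intro mult_left_mono) auto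
  also have "\<dots> \<le> A * norm ?x ^ m" using nx j A by (intro mult_left_mono power_decreasing) auto
  finally have "norm (g ?x) \<le> A * norm ?x ^ m" .
  moreover have "?x \<noteq> 0" using c_direction[of j] norm_c_pos[of j] by (metis norm_zero less_irrefl vector_smult_lzero)
  ultimately show "\<exists>z. z \<noteq> 0 \<and> norm z < e \<and> norm (g z) \<le> A * norm z ^ m" using nx j by auto
qed

lemma f_on_line:
  assumes w: "good w"
  shows "\<exists>C. norm C = 1 \<and> (\<forall>x\<in>ball 0 (r / norm w). f (x *s w) = x *s rot i0 C w)"
proof (rule line_rigidity[where K = K])
  note wp = good_props[OF w]
  show "(\<lambda>x. f (x *s w) $ i) holomorphic_on ball 0 (r / norm w)" for i by (rule line_holo)
  show "w $ i0 = 1" "1 < norm w" "K < norm w" "1 / (norm w)\<^sup>2 < r / norm w"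
    using wp w by (auto simp: good_def)
  show "0 islimpt {x. (norm w)\<^sup>2 * (norm x)\<^sup>2 = Re x \<and> (norm (f (x *s w)))\<^sup>2 = Re (f (x *s w) $ i0)}"
    by (rule circle_limit[OF w])
  show "norm w * norm x \<le> K * norm (f (x *s w))" if "x \<in> ball 0 (r / norm w)" for x
    using f_lower[OF ball_line[OF that]] by (simp add: mult.commute)
  have cw: "c j = (c j $ i0) *s w" if "u j = w" for j using c_direction[of j] that by simp
  have D: "norm ((f (c j) - rot i0 \<zeta> (c j)) $ i) \<le> \<delta> j" if "dist (f (c j)) (rot i0 \<zeta> (c j)) < \<delta> j" for j \<zeta> i
    using that Finite_Cartesian_Product.norm_nth_le[of "f (c j) - rot i0 \<zeta> (c j)" i] by (simp add: dist_norm)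
  show "f (x *s w) $ i0 = x" if x: "x \<in> ball 0 (r / norm w)" for x
  proof -
    have "f (x *s w) $ i0 - x = 0"
    proof (rule line_zero[OF w _ _ _ x, of "\<lambda>x. f (x *s w) $ i0 - x" 1])
      show "(\<lambda>x. f (x *s w) $ i0 - x) holomorphic_on ball 0 (r / norm w)"
        by (intro holomorphic_intros line_holo)
      fix j \<zeta> assume j: "u j = w" "dist (f (c j)) (rot i0 \<zeta> (c j)) < \<delta> j"
      show "norm (f ((c j $ i0) *s w) $ i0 - c j $ i0) \<le> 1 * \<delta> j"
        unfolding cw[OF j(1), symmetric] using D[OF j(2), of i0] by (simp add: rot_nth)
    qed simp
    then show ?thesis by simp
  qed
  show "f (x *s w) $ i * w $ k = f (x *s w) $ k * w $ i"
    if x: "x \<in> ball 0 (r / norm w)" and ik: "i \<noteq> i0" "k \<noteq> i0" for x i k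
  proof -
    have "f (x *s w) $ i * w $ k - f (x *s w) $ k * w $ i = 0"
    proof (rule line_zero[OF w _ _ _ x, of "\<lambda>x. f (x *s w) $ i * w $ k - f (x *s w) $ k * w $ i" "2 * norm w"])
      show "(\<lambda>x. f (x *s w) $ i * w $ k - f (x *s w) $ k * w $ i) holomorphic_on ball 0 (r / norm w)"
        by (intro holomorphic_intros line_holo)
      fix j \<zeta> assume j: "u j = w" "dist (f (c j)) (rot i0 \<zeta> (c j)) < \<delta> j"
      let ?D = "f (c j) - rot i0 \<zeta> (c j)"
      have c: "c j $ l = c j $ i0 * w $ l" for l using arg_cong[OF cw[OF j(1)], of "\<lambda>v. v $ l"] by simp
      have "f (c j) $ i * w $ k - f (c j) $ k * w $ i = ?D $ i * w $ k - ?D $ k * w $ i"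
        using ik by (simp add: rot_nth c[of i] c[of k] algebra_simps)
      also have "norm \<dots> \<le> norm (?D $ i) * norm (w $ k) + norm (?D $ k) * norm (w $ i)"
        using norm_triangle_ineq4 by (metis norm_mult)
      also have "\<dots> \<le> \<delta> j * norm w + \<delta> j * norm w"
        by (intro add_mono mult_mono D j(2) Finite_Cartesian_Product.norm_nth_le less_imp_le[OF d_pos]) auto
      finally show "norm (f ((c j $ i0) *s w) $ i * w $ k - f ((c j $ i0) *s w) $ k * w $ i) \<le> 2 * norm w * \<delta> j"
        unfolding cw[OF j(1), symmetric] by simp
    qed simp
    then show ?thesis by simp
  qed
qed

end

lemma parallelogram: "(norm (x + y))\<^sup>2 + (norm (x - y))\<^sup>2 = 2 * (norm x)\<^sup>2 + 2 * (norm (y :: 'a::real_inner))\<^sup>2"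
  by (simp add: power2_norm_eq_inner inner_add_left inner_add_right inner_diff_left inner_diff_right inner_commute)

lemma norm_axis_one: "norm (axis i (1 :: complex) :: complex^'n) = 1"
  by (simp add: norm_eq_1 inner_axis_axis)

context bumpy_automorphism
begin

lemma L_bounded_linear: "bounded_linear L"
  using L_deriv by (rule has_derivative_bounded_linear)

lemma L_linear: "linear L"
  using L_bounded_linear by (simp add: linear_conv_bounded_linear)

lemma L_on_good:
  assumes w: "good w"
  shows "\<exists>C. norm C = 1 \<and> L w = rot i0 C w" "\<And>x. norm (x *s w) < r \<Longrightarrow> f (x *s w) = x *s L w"
proof -
  obtain C where C: "norm C = 1" "\<And>x. x \<in> ball 0 (r / norm w) \<Longrightarrow> f (x *s w) = x *s rot i0 C w"
    using f_on_line[OF w] by blast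
  have w0: "norm w > 0" using good_props(2)[OF w] by linarith
  have R: "r / norm w > 0" using w0 r_pos by simp
  have 1: "((\<lambda>x. f (x *s w)) has_derivative (\<lambda>x. L (x *s w))) (at 0)"
  proof -
    have "((\<lambda>x. x *s w) has_derivative (\<lambda>x. x *s w)) (at (0 :: complex))"
      by (rule bounded_linear_imp_has_derivative[OF linear_smult])
    from has_derivative_compose[OF this, of f L] L_deriv show ?thesis by simp
  qed
  have "((\<lambda>x. x *s rot i0 C w) has_derivative (\<lambda>x. x *s rot i0 C w)) (at 0)"
    by (rule bounded_linear_imp_has_derivative[OF linear_smult])
  then have "((\<lambda>x. f (x *s w)) has_derivative (\<lambda>x. x *s rot i0 C w)) (at 0)"
    by (rule has_derivative_transform_within_open[of _ _ _ _ "ball 0 (r / norm w)"]) (use C(2) R in auto)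
  from fun_cong[OF has_derivative_unique[OF 1 this], of 1] have L: "L w = rot i0 C w" by simp
  then show "\<exists>C. norm C = 1 \<and> L w = rot i0 C w" using C(1) by blast
  show "f (x *s w) = x *s L w" if "norm (x *s w) < r" for x
    unfolding L using C(2)[of x] that w0 by (simp add: less_divide_eq)
qed

text \<open>The points whose line through the origin is long enough for \<open>f_on_line\<close>
  form a cone around the hyperplane \<open>Z $ i0 = 0\<close>.\<close>

definition slope :: real where
  "slope = max K (1 / r)"

definition steep_cone :: "(complex^'n) set" where
  "steep_cone = {Z. slope * norm (Z $ i0) < norm Z}"

lemma open_steep_cone: "open steep_cone"
  unfolding steep_cone_def by (intro open_Collect_less continuous_intros)

lemma slope_ge: "1 \<le> slope"
  using K_ge by (simp add: slope_def)

lemma L_on_dense: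
  assumes Z: "Z \<in> steep_cone" "Z $ i0 \<noteq> 0" "infinite {j. Z = Z $ i0 *s u j}"
  shows "\<exists>C. norm C = 1 \<and> L Z = rot i0 C Z" "norm Z < r \<Longrightarrow> f Z = L Z"
proof -
  define w where "w = inverse (Z $ i0) *s Z"
  have Zw: "Z = Z $ i0 *s w" using Z(2) by (simp add: w_def)
  have "{j. Z = Z $ i0 *s u j} = {j. u j = w}"
    using Z(2) by (auto simp: w_def) (metis left_inverse vector_smult_assoc vector_smult_lid)
  moreover have "norm w = norm Z / norm (Z $ i0)"
    by (simp add: w_def norm_inverse divide_inverse mult.commute)
  then have "slope < norm w" using Z(1,2) by (simp add: steep_cone_def less_divide_eq)
  ultimately have w: "good w" using Z(3) by (simp add: good_def slope_def)
  obtain C where C: "norm C = 1" "L w = rot i0 C w" using L_on_good(1)[OF w] by blast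
  have "L Z = Z $ i0 *s L w" using L_smult Zw by metis
  also have "\<dots> = rot i0 C Z" unfolding C(2) using rot_smult Zw by metis
  finally show "\<exists>C. norm C = 1 \<and> L Z = rot i0 C Z" using C(1) by blast
  show "f Z = L Z" if "norm Z < r"
    using L_on_good(2)[OF w, of "Z $ i0"] that L_smult Zw by metis
qed

lemma cone_closure: "open S \<Longrightarrow> S \<subseteq> closure (S \<inter> {x. x $ i0 \<noteq> 0 \<and> infinite {j. x = x $ i0 *s u j}})"
  using open_Int_closure_subset[of S] directions_dense by fastforce

text \<open>These properties hold on a dense set of the cone and are closed conditions.\<close>

lemma L_on_cone:
  assumes Z: "Z \<in> steep_cone"
  shows "norm (L Z) = norm Z" "L Z $ i0 = Z $ i0" "i \<noteq> i0 \<Longrightarrow> k \<noteq> i0 \<Longrightarrow> L Z $ i * Z $ k = L Z $ k * Z $ i"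
proof -
  let ?T = "{x. x $ i0 \<noteq> 0 \<and> infinite {j. x = x $ i0 *s u j}}"
  let ?P = "{Z. norm (L Z) = norm Z} \<inter> {Z. L Z $ i0 = Z $ i0} \<inter>
    (\<Inter>i\<in>-{i0}. \<Inter>k\<in>-{i0}. {Z. L Z $ i * Z $ k = L Z $ k * Z $ i})"
  have [continuous_intros]: "continuous_on UNIV L" by (rule linear_continuous_on[OF L_bounded_linear])
  have "closed ?P"
    by (intro closed_Int closed_INT ballI closed_Collect_eq continuous_intros)
  moreover have "steep_cone \<inter> ?T \<subseteq> ?P"
  proof
    fix Z assume "Z \<in> steep_cone \<inter> ?T"
    then obtain C where "norm C = 1" "L Z = rot i0 C Z" using L_on_dense(1) by blast
    then show "Z \<in> ?P" by (auto simp: norm_rot rot_nth)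
  qed
  ultimately have "closure (steep_cone \<inter> ?T) \<subseteq> ?P" by (rule closure_minimal[rotated])
  then have "Z \<in> ?P" using cone_closure[OF open_steep_cone] Z by blast
  then show "norm (L Z) = norm Z" "L Z $ i0 = Z $ i0" "i \<noteq> i0 \<Longrightarrow> k \<noteq> i0 \<Longrightarrow> L Z $ i * Z $ k = L Z $ k * Z $ i"
    by auto
qed

lemma f_on_cone:
  assumes Z: "Z \<in> steep_cone" "norm Z < r"
  shows "f Z = L Z"
proof -
  let ?T = "{x. x $ i0 \<noteq> 0 \<and> infinite {j. x = x $ i0 *s u j}}"
  have "Z \<in> closure ((steep_cone \<inter> ball 0 r) \<inter> ?T)"
  proof -
    have "open (steep_cone \<inter> ball 0 r)" "Z \<in> steep_cone \<inter> ball 0 r" using open_steep_cone Z by auto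
    then show ?thesis using cone_closure by blast
  qed
  then obtain y where y: "\<And>n. y n \<in> (steep_cone \<inter> ball 0 r) \<inter> ?T" "y \<longlonglongrightarrow> Z"
    unfolding closure_sequential by blast
  have eq: "f (y n) = L (y n)" for n using y(1)[of n] L_on_dense(2) by auto
  have "isCont f Z"
    using f_holo Z(2) unfolding holo_on_def by (auto intro: has_derivative_continuous)
  then have "(\<lambda>n. f (y n)) \<longlonglongrightarrow> f Z" using y(2) by (rule isCont_tendsto_compose)
  moreover have "(\<lambda>n. L (y n)) \<longlonglongrightarrow> L Z"
    using y(2) by (rule bounded_linear.tendsto[OF L_bounded_linear])
  ultimately show ?thesis unfolding eq by (rule LIMSEQ_unique)
qed

lemma far_in_cone:
  assumes "b \<noteq> i0" "(slope + 1) * norm Z < norm x"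
  shows "x *s axis b 1 + Z \<in> steep_cone" "x *s axis b 1 - Z \<in> steep_cone" "x *s axis b 1 \<in> steep_cone"
proof -
  let ?Y = "x *s axis b 1 :: complex^'n"
  have Y: "?Y $ i0 = 0" "norm ?Y = norm x"
    using assms(1) by (simp add: axis_def) (simp add: norm_axis_one)
  have Z: "slope * norm (Z $ i0) \<le> slope * norm Z"
    using slope_ge by (intro mult_left_mono Finite_Cartesian_Product.norm_nth_le) auto
  have a: "slope * norm Z + norm Z < norm x" using assms(2) by (simp add: algebra_simps)
  have "norm ?Y - norm Z \<le> norm (?Y + Z)" "norm ?Y - norm Z \<le> norm (?Y - Z)"
    using norm_triangle_ineq2[of ?Y "- Z"] norm_triangle_ineq2[of ?Y Z] by simp_all
  then show "?Y + Z \<in> steep_cone" "?Y - Z \<in> steep_cone"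
    using a Z unfolding steep_cone_def mem_Collect_eq vector_add_component vector_minus_component Y by simp_all
  have "0 \<le> (slope + 1) * norm Z" using slope_ge by simp
  then have "0 < norm ?Y" unfolding Y using assms(2) by linarith
  then show "?Y \<in> steep_cone" unfolding steep_cone_def mem_Collect_eq Y(1) by simp
qed

text \<open>The cone contains \<open>Y\<close>, \<open>Y + Z\<close> and \<open>Y - Z\<close> if
  \<open>Y\<close> is a long vector along a coordinate axis other than \<open>i0\<close>, so the
  parallelogram law transfers the isometry from the cone to \<open>Z\<close>.\<close>

lemma L_isometry: "norm (L Z) = norm Z" and L_first: "L Z $ i0 = Z $ i0"
proof -
  obtain b where b: "b \<noteq> i0" using other_index by blast
  define x where "x = complex_of_real ((slope + 1) * norm Z + 1)"
  have "0 \<le> (slope + 1) * norm Z" using slope_ge by simp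
  then have "(slope + 1) * norm Z < norm x" unfolding x_def norm_of_real by linarith
  note steep_cone = far_in_cone[OF b this]
  let ?Y = "x *s axis b 1 :: complex^'n"
  have "(norm (L ?Y + L Z))\<^sup>2 + (norm (L ?Y - L Z))\<^sup>2 = (norm (?Y + Z))\<^sup>2 + (norm (?Y - Z))\<^sup>2"
    using L_on_cone(1)[OF steep_cone(1)] L_on_cone(1)[OF steep_cone(2)] linear_add[OF L_linear] linear_diff[OF L_linear] by simp
  then have "(norm (L Z))\<^sup>2 = (norm Z)\<^sup>2"
    unfolding parallelogram L_on_cone(1)[OF steep_cone(3)] by simp
  then show "norm (L Z) = norm Z" by (rule power2_eq_imp_eq) auto
  show "L Z $ i0 = Z $ i0"
    using L_on_cone(2)[OF steep_cone(1)] L_on_cone(2)[OF steep_cone(3)] linear_add[OF L_linear, of ?Y Z] by simp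
qed

text \<open>Nonzero vectors with \<open>Z $ i0 = 0\<close> lie in the cone, so each of them is
  mapped to a multiple of itself, and the factor is the same for all. An isometry that fixes the
  coordinate \<open>i0\<close> also fixes its axis.\<close>

lemma L_is_rot: "\<exists>p. norm p = 1 \<and> L = rot i0 p"
proof -
  obtain b where b: "b \<noteq> i0" using other_index by blast
  have e_cone: "Z \<in> steep_cone" if "Z $ i0 = 0" "Z \<noteq> 0" for Z using that by (simp add: steep_cone_def)
  let ?e = "\<lambda>i. axis i (1::complex) :: complex^'n"
  have en: "norm (?e i) = 1" for i by (rule norm_axis_one)
  define p where "p = L (?e b) $ b"
  have ax: "L (?e i) $ k = 0" if "i \<noteq> i0" "k \<noteq> i" for i k
  proof (cases "k = i0")
    case True
    then show ?thesis using L_first[of "?e i"] that by (simp add: axis_def)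
  next
    case False
    have "?e i \<noteq> 0" using en[of i] by force
    moreover have "?e i $ i0 = 0" "?e i $ k = 0" "?e i $ i = 1" using that by (auto simp: axis_def)
    ultimately show ?thesis
      using L_on_cone(3)[OF e_cone[of "?e i"] False that(1)] by simp
  qed
  have diag: "L (?e i) $ i = p" if i: "i \<noteq> i0" for i
  proof (cases "i = b")
    case False
    let ?Z = "?e i + ?e b"
    have "?Z $ i0 = 0" "?Z $ i = 1" "?Z $ b = 1" using b i False by (auto simp: axis_def)
    then have "L ?Z $ i = L ?Z $ b"
      using L_on_cone(3)[OF e_cone[of ?Z], of i b] b i by (metis mult.right_neutral zero_index zero_neq_one)
    then show ?thesis
      using ax[OF b, of i] ax[OF i, of b] False linear_add[OF L_linear] by (simp add: p_def)
  qed (simp add: p_def)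
  have L_e: "L (?e i) = rot i0 p (?e i)" for i
  proof (cases "i = i0")
    case True
    have "L (?e i0) $ i0 = 1" using L_first[of "?e i0"] by (simp add: axis_def)
    then have "tail i0 (L (?e i0)) = 0"
      using norm_tail[of "L (?e i0)" i0] L_isometry[of "?e i0"] en[of i0] by simp
    then have "L (?e i0) $ k = 0" if "k \<noteq> i0" for k
      using that by (auto simp: tail_def vec_eq_iff) (metis)
    then show ?thesis
      using \<open>L (?e i0) $ i0 = 1\<close> True by (auto simp: vec_eq_iff rot_nth axis_def)
  next
    case False
    have "L (?e i) $ k = (if k = i then p else 0)" for k
      using ax[OF False] diag[OF False] by simp
    then show ?thesis using False by (auto simp: vec_eq_iff rot_nth axis_def)
  qed
  have "L Z = rot i0 p Z" for Z
  proof -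
    have "L Z = L (\<Sum>i\<in>UNIV. Z $ i *s ?e i)" by (simp add: basis_expansion)
    also have "\<dots> = (\<Sum>i\<in>UNIV. Z $ i *s rot i0 p (?e i))"
      by (simp add: linear_sum[OF L_linear] L_smult L_e)
    also have "\<dots> = rot i0 p (\<Sum>i\<in>UNIV. Z $ i *s ?e i)"
      by (simp add: linear_sum[OF bounded_linear.linear[OF bounded_linear_rot]] rot_smult)
    finally show ?thesis by (simp add: basis_expansion)
  qed
  moreover have "norm p = 1"
  proof -
    have "L (?e b) = p *s ?e b" using ax[OF b] by (auto simp: vec_eq_iff axis_def p_def)
    then show ?thesis using L_isometry[of "?e b"] en[of b] by simp
  qed
  ultimately show ?thesis by blast
qed

definition lin_radius :: real where
  "lin_radius = r / (4 * (slope + 2))"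

text \<open>On the line through \<open>Z\<close> parallel to another axis all points far from
  \<open>Z\<close> lie in the cone, so the identity theorem carries \<open>f = L\<close> from there
  to \<open>Z\<close>.\<close>

lemma f_eq_L:
  assumes Z: "norm Z < lin_radius"
  shows "f Z = L Z"
proof -
  obtain b where b: "b \<noteq> i0" using other_index by blast
  let ?l = "\<lambda>x. Z + x *s axis b 1"
  have lr: "4 * (slope + 2) * lin_radius = r" using slope_ge by (simp add: lin_radius_def)
  have sZ: "(slope + 1) * norm Z < r / 4"
  proof -
    have "(slope + 1) * norm Z \<le> (slope + 1) * lin_radius" using Z slope_ge by (intro mult_left_mono) auto
    moreover have "lin_radius > 0" using slope_ge r_pos by (simp add: lin_radius_def)
    ultimately show ?thesis using lr by (simp add: algebra_simps)
  qed
  have "1 * norm Z \<le> (slope + 1) * norm Z" using slope_ge by (intro mult_right_mono) auto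
  then have Zr: "norm Z < r / 4" using sZ by simp
  have ball: "norm (?l x) < r" if "x \<in> ball 0 (r / 2)" for x
  proof -
    have "norm (?l x) \<le> norm Z + norm x" using norm_triangle_ineq[of Z "x *s axis b 1"] by (simp add: norm_axis_one)
    moreover have "norm x < r / 2" using that by simp
    ultimately show ?thesis using Zr r_pos by linarith
  qed
  have "f (?l 0) $ i = L (?l 0) $ i" for i
  proof (rule analytic_continuation_open[where s = "ball (of_real (3 * r / 8)) (r / 8)" and s' = "ball 0 (r / 2)"
        and f = "\<lambda>x. f (?l x) $ i" and g = "\<lambda>x. L (?l x) $ i"])
    show "(\<lambda>x. f (?l x) $ i) holomorphic_on ball 0 (r / 2)"
      by (rule holomorphic_on_subset[OF holo_on_line[OF f_holo]]) (use ball in auto)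
    have "holo_on UNIV L"
      unfolding holo_on_def using bounded_linear_imp_has_derivative[OF L_bounded_linear] L_smult by blast
    from holo_on_line[OF this] show "(\<lambda>x. L (?l x) $ i) holomorphic_on ball 0 (r / 2)"
      by (rule holomorphic_on_subset) auto
    show "f (?l x) $ i = L (?l x) $ i" if x: "x \<in> ball (of_real (3 * r / 8)) (r / 8)" for x
    proof -
      have n: "norm (complex_of_real (3 * r / 8)) = 3 * r / 8" using r_pos by (simp only: norm_of_real)
      have d: "norm (complex_of_real (3 * r / 8) - x) < r / 8" using x by (simp add: dist_norm)
      have "r / 4 < norm x" "norm x < r / 2"
        using n d norm_triangle_ineq2[of "complex_of_real (3 * r / 8)" x]
          norm_triangle_ineq2[of x "complex_of_real (3 * r / 8)"] by (simp_all only: norm_minus_commute)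
      then have "?l x \<in> steep_cone" "norm (?l x) < r"
        using far_in_cone(1)[OF b, of Z x] sZ ball by (simp_all add: add.commute)
      then show ?thesis using f_on_cone by simp
    qed
    show "ball (complex_of_real (3 * r / 8)) (r / 8) \<subseteq> ball 0 (r / 2)"
    proof
      fix x assume "x \<in> ball (complex_of_real (3 * r / 8)) (r / 8)"
      then have d: "norm (complex_of_real (3 * r / 8) - x) < r / 8" by (simp add: dist_norm)
      have n: "norm (complex_of_real (3 * r / 8)) = 3 * r / 8" using r_pos by (simp only: norm_of_real)
      have "norm x < r / 2"
        using n d norm_triangle_ineq2[of x "complex_of_real (3 * r / 8)"] by (simp only: norm_minus_commute)
      then show "x \<in> ball 0 (r / 2)" by simp
    qed
  qed (use r_pos in auto)
  then show ?thesis by (simp add: vec_eq_iff)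
qed

text \<open>The rotation by \<open>p\<close> carries points of the sphere in the ball around
  \<open>c j\<close> into the ball around \<open>rot i0 \<zeta> (c j)\<close> for some
  \<open>\<zeta> \<in> H j\<close>. Hence all powers of \<open>\<eta> = p / \<zeta>\<close> keep
  \<open>c j\<close> in its own ball, which forces \<open>\<eta> = 1\<close>.\<close>

lemma f_is_rot: "\<exists>\<zeta>\<in>(\<Union>k. H k). \<forall>\<^sub>F Z in nhds 0. f Z = rot i0 \<zeta> Z"
proof -
  obtain p where p: "norm p = 1" "L = rot i0 p" using L_is_rot by blast
  have e: "lin_radius > 0" "lin_radius \<le> r"
  proof -
    show "lin_radius > 0" using slope_ge r_pos by (simp add: lin_radius_def)
    then have "1 * lin_radius \<le> 4 * (slope + 2) * lin_radius" using slope_ge by (intro mult_right_mono) auto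
    also have "\<dots> = r" using slope_ge by (simp add: lin_radius_def)
    finally show "lin_radius \<le> r" by simp
  qed
  have f: "f Z = rot i0 p Z" if "norm Z < lin_radius" for Z using f_eq_L[OF that] p by simp
  obtain j where j: "norm (c j) < lin_radius"
    using LIMSEQ_D[OF norm_c_tendsto e(1)] by auto
  let ?d = "\<lambda>\<zeta>. rot i0 \<zeta> (c j)"
  have step: "\<exists>\<xi>\<in>H j. dist (?d (p * q)) (?d \<xi>) < \<delta> j" if q: "norm q = 1" "inside (?d q)" for q
  proof -
    have n: "norm (?d q) = norm (c j)" "norm (?d (p * q)) = norm (c j)" using p q by (simp_all add: norm_rot norm_mult)
    have s: "(norm (?d q))\<^sup>2 = Re (?d q $ i0)" "(norm (?d (p * q)))\<^sup>2 = Re (?d (p * q) $ i0)"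
      unfolding n by (simp_all add: rot_nth c_sphere)
    have "f (?d q) = ?d (p * q)" using f[of "?d q"] n j by (simp add: rot_rot)
    then have "inside (?d (p * q))" using f_inside[of "?d q"] n s j e q(2) by simp
    then obtain \<xi> i where \<xi>: "\<xi> \<in> H i" "dist (?d (p * q)) (rot i0 \<xi> (c i)) < \<delta> i" by (rule inside_cases)
    have "i = j"
      using ring_unique[OF norm_in_ball[OF \<xi>], of j] n norm_c_pos[of j] by simp
    then show ?thesis using \<xi> by blast
  qed
  have "inside (?d 1)" using insideI[OF H_one, of "c j" j] d_pos[of j] by simp
  then obtain \<zeta> where \<zeta>: "\<zeta> \<in> H j" "dist (?d p) (?d \<zeta>) < \<delta> j" using step[of 1] by auto
  have z: "norm \<zeta> = 1" "\<zeta> \<noteq> 0" using H_circle[OF \<zeta>(1)] by auto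
  define \<eta> where "\<eta> = p * inverse \<zeta>"
  have n\<eta>: "norm (\<eta> ^ k) = 1" for k using p z by (simp add: \<eta>_def norm_mult norm_inverse norm_power)
  have near: "dist (?d (\<eta> ^ k)) (c j) < \<delta> j" for k
  proof (induction k)
    case 0
    then show ?case using d_pos by simp
  next
    case (Suc k)
    have "inside (?d (\<eta> ^ k))" using insideI[OF H_one] Suc.IH by simp
    then obtain \<xi> where \<xi>: "\<xi> \<in> H j" "dist (?d (p * \<eta> ^ k)) (?d \<xi>) < \<delta> j" using step n\<eta> by blast
    have "dist (?d (p * \<eta> ^ k)) (?d p) < \<delta> j"
      using Suc.IH dist_rot[OF p(1), of i0 "?d (\<eta> ^ k)" "c j"] by (simp add: rot_rot)
    then have "dist (?d \<xi>) (?d \<zeta>) < 4 * \<delta> j"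
      using \<xi>(2) \<zeta>(2) dist_triangle[of "?d \<xi>" "?d \<zeta>" "?d p"] dist_triangle3[of "?d \<xi>" "?d p" "?d (p * \<eta> ^ k)"]
        d_pos[of j] by linarith
    then have "\<xi> = \<zeta>" using orbit_separated \<xi>(1) \<zeta>(1) by blast
    moreover have "?d (\<eta> ^ Suc k) = rot i0 (inverse \<zeta>) (?d (p * \<eta> ^ k))" "c j = rot i0 (inverse \<zeta>) (?d \<zeta>)"
      using z by (simp_all add: rot_rot \<eta>_def algebra_simps)
    ultimately show ?case
      using \<xi>(2) dist_rot[of "inverse \<zeta>" i0 "?d (p * \<eta> ^ k)" "?d \<zeta>"] z by (simp add: norm_inverse)
  qed
  have "\<eta> = 1"
  proof (rule eq_one_of_powers_near_one)
    fix k
    have t: "norm (tail i0 (c j)) > 0" using c_tail by simp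
    have "dist (?d (\<eta> ^ k)) (?d 1) = norm (\<eta> ^ k - 1) * norm (tail i0 (c j))"
      by (simp only: dist_norm rot_diff_rot norm_smult)
    then have "norm (\<eta> ^ k - 1) * norm (tail i0 (c j)) < \<delta> j"
      using near[of k] by simp
    also have "\<dots> < 1 / 2 * norm (tail i0 (c j))" using d_tail[of j] t by linarith
    finally show "norm (\<eta> ^ k - 1) < 1 / 2" using t by (simp only: mult_less_cancel_right_pos)
  qed
  then have "p = \<zeta>" using z by (simp add: \<eta>_def divide_inverse[symmetric])
  moreover have "\<forall>\<^sub>F Z in nhds 0. f Z = rot i0 p Z"
    using f e(1) by (intro eventually_nhds_metric[THEN iffD2]) auto
  ultimately show ?thesis using \<zeta>(1) by blast
qed

end

context bumpy_sphere
begin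

lemma aut_rep_is_rot:
  assumes "aut_rep M 0 f"
  shows "\<exists>\<zeta>\<in>(\<Union>k. H k). \<forall>\<^sub>F Z in nhds 0. f Z = rot i0 \<zeta> Z"
proof -
  obtain U V where UV: "0 \<in> U" "biholo U V f" "f 0 = 0" "f ` (M \<inter> U) = M \<inter> V"
    using assms unfolding aut_rep_def by blast
  obtain g where g: "homeomorphism U V f g" "holo_on U f" "holo_on V g"
    using UV(2) unfolding biholo_def by blast
  have gf: "g (f Z) = Z" "f Z \<in> V" if "Z \<in> U" for Z
    using g(1) that by (auto simp: homeomorphism_def)
  have V0: "0 \<in> V" "g 0 = 0" using gf[OF UV(1)] UV(3) by auto
  obtain L where L: "(f has_derivative L) (at 0)" "\<And>x Z. L (x *s Z) = x *s L Z"
    using g(2) UV(1) unfolding holo_on_def by blast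
  obtain L' where L': "(g has_derivative L') (at 0)"
    using g(3) V0(1) unfolding holo_on_def by blast
  obtain K1 d1 where K1: "K1 \<ge> 1" "d1 > 0" "\<And>Z. norm Z < d1 \<Longrightarrow> norm (f Z) \<le> K1 * norm Z"
    using has_derivative_imp_linear_bound[OF L(1) UV(3)] by blast
  obtain K2 d2 where K2: "K2 \<ge> 1" "d2 > 0" "\<And>Z. norm Z < d2 \<Longrightarrow> norm (g Z) \<le> K2 * norm Z"
    using has_derivative_imp_linear_bound[OF L' V0(2)] by blast
  obtain d3 where d3: "d3 > 0" "ball 0 d3 \<subseteq> U"
    using UV(1) biholo_open(1)[OF UV(2)] open_contains_ball by blast
  define K where "K = max K1 K2"
  have K: "1 \<le> K" "K1 \<le> K" "K2 \<le> K" using K1(1) by (auto simp: K_def)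
  define r where "r = min (min d1 d3) (min (d2 / K) (1 / (4 * K)))"
  have "r > 0" using K1 K2 d3 K by (simp add: r_def)
  have "r \<le> 1 / (4 * K)" by (simp add: r_def)
  then have Kr: "4 * (K * r) \<le> 1" using K(1) by (simp add: field_simps)
  have rU: "Z \<in> U" if "norm Z < r" for Z using d3 that by (auto simp: r_def)
  have up: "norm (f Z) \<le> K * norm Z" if "norm Z < r" for Z
  proof -
    have "norm (f Z) \<le> K1 * norm Z" using K1(3) that by (simp add: r_def)
    also have "\<dots> \<le> K * norm Z" using K by (intro mult_right_mono) auto
    finally show ?thesis .
  qed
  have "bumpy_automorphism i0 H u c \<delta> f L r K"
  proof unfold_locales
    show "holo_on (ball 0 r) f" by (rule holo_on_subset[OF g(2)]) (use rU in auto)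
    fix Z :: "complex^'n" assume Z: "norm Z < r"
    show "norm (f Z) \<le> K * norm Z" by (rule up[OF Z])
    have "K * norm Z < K * (d2 / K)" using Z K(1) by (intro mult_strict_left_mono) (auto simp: r_def)
    then have "norm (f Z) < d2" using up[OF Z] K(1) by simp
    then have "norm Z \<le> K2 * norm (f Z)" using K2(3)[of "f Z"] gf(1)[OF rU[OF Z]] by simp
    also have "\<dots> \<le> K * norm (f Z)" using K by (intro mult_right_mono) auto
    finally show "norm Z \<le> K * norm (f Z)" .
    show "f Z \<in> M \<longleftrightarrow> Z \<in> M"
    proof
      assume "f Z \<in> M"
      then have "f Z \<in> f ` (M \<inter> U)" using UV(4) gf(2)[OF rU[OF Z]] by simp
      then obtain Y where "Y \<in> M" "Y \<in> U" "f Z = f Y" by blast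
      then show "Z \<in> M" using gf(1)[of Y] gf(1)[OF rU[OF Z]] by simp
    qed (use UV(4) rU[OF Z] in blast)
  qed (use \<open>r > 0\<close> K Kr L in auto)
  then show ?thesis by (rule bumpy_automorphism.f_is_rot)
qed

end

section \<open>The topology of the stability group\<close>

text \<open>This derivative recovers \<open>\<zeta>\<close> from \<open>rot i0 \<zeta>\<close> if
  \<open>b \<noteq> i0\<close>.\<close>

definition diag_deriv :: "'n \<Rightarrow> (complex^'n \<Rightarrow> complex^'n) \<Rightarrow> complex" where
  "diag_deriv b f = deriv (\<lambda>x. f (x *s axis b 1) $ b) 0"

text \<open>The derivative is the same for all representatives of a germ
  (\<open>germ_deriv_germ\<close>), so any of them may be chosen.\<close>

definition germ_deriv :: "'n::finite \<Rightarrow> (complex^'n \<Rightarrow> complex^'n) set \<Rightarrow> complex" where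
  "germ_deriv b A = diag_deriv b (SOME f. f \<in> A)"

lemma germ_deriv_germ:
  fixes f :: "complex^'n \<Rightarrow> complex^'n"
  shows "germ_deriv b (germ 0 f) = diag_deriv b f"
proof -
  have "f \<in> germ 0 f" by (simp add: germ_def)
  then have "(SOME g. g \<in> germ 0 f) \<in> germ 0 f" by (rule someI[of "\<lambda>g. g \<in> germ 0 f"])
  then have ev: "\<forall>\<^sub>F z in nhds 0. (SOME g. g \<in> germ 0 f) z = f z" by (simp add: germ_def)
  have "isCont (\<lambda>x. x *s (axis b 1 :: complex^'n)) 0"
    by (rule linear_continuous_at[OF linear_smult])
  then have "((\<lambda>x. x *s (axis b 1 :: complex^'n)) \<longlongrightarrow> 0) (nhds 0)"
    using tendsto_at_iff_tendsto_nhds[of "\<lambda>x. x *s (axis b 1 :: complex^'n)" 0] by (simp add: isCont_def)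
  from eventually_compose_filterlim[OF ev this] show ?thesis
    unfolding germ_deriv_def diag_deriv_def by (intro deriv_cong_ev) (auto elim: eventually_mono)
qed

lemma diag_deriv_rot: "b \<noteq> i0 \<Longrightarrow> diag_deriv b (rot i0 \<zeta>) = \<zeta>"
  unfolding diag_deriv_def by (simp add: rot_def axis_def)

lemma line_holo_maps:
  fixes f :: "complex^'n \<Rightarrow> complex^'n"
  assumes f: "f \<in> holo_maps U" and s: "cball 0 s \<subseteq> U"
  shows "(\<lambda>x. f (x *s axis b 1) $ b) holomorphic_on cball 0 s"
proof (rule holomorphic_on_subset)
  have "holo_on U f" using f by (simp add: holo_maps_def)
  from holo_on_line[OF this, of 0 "axis b 1" b]
  show "(\<lambda>x. f (x *s axis b 1) $ b) holomorphic_on {x. x *s axis b 1 \<in> U}" by simp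
  show "cball 0 s \<subseteq> {x. x *s axis b 1 \<in> U}"
    using s by (auto simp: norm_axis_one subset_iff)
qed

lemma diag_deriv_diff_le:
  fixes f g :: "complex^'n \<Rightarrow> complex^'n"
  assumes f: "f \<in> holo_maps U" and g: "g \<in> holo_maps U" and s: "0 < s" "cball 0 s \<subseteq> U"
    and close: "\<And>x. norm x = s \<Longrightarrow> dist (g (x *s axis b 1)) (f (x *s axis b 1)) \<le> e"
  shows "dist (diag_deriv b g) (diag_deriv b f) \<le> e / s"
proof -
  let ?F = "\<lambda>x. f (x *s axis b 1) $ b" and ?G = "\<lambda>x. g (x *s axis b 1) $ b"
  note hol = line_holo_maps[OF f s(2), of b] line_holo_maps[OF g s(2), of b]
  have D: "?F field_differentiable at 0" "?G field_differentiable at 0"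
    using hol s(1) by (auto intro!: holomorphic_on_imp_differentiable_at[of _ "ball 0 s"] intro: holomorphic_on_subset)
  have h: "(\<lambda>x. ?G x - ?F x) holomorphic_on cball 0 s" by (intro holomorphic_intros hol)
  have "norm ((deriv ^^ 1) (\<lambda>x. ?G x - ?F x) 0) \<le> fact 1 * e / s ^ 1"
  proof (rule Cauchy_inequality)
    show "(\<lambda>x. ?G x - ?F x) holomorphic_on ball 0 s" by (rule holomorphic_on_subset[OF h]) auto
    show "continuous_on (cball 0 s) (\<lambda>x. ?G x - ?F x)" by (rule holomorphic_on_imp_continuous_on[OF h])
    show "norm (?G x - ?F x) \<le> e" if "norm (0 - x) = s" for x
      using close[of x] that Finite_Cartesian_Product.norm_nth_le[of "g (x *s axis b 1) - f (x *s axis b 1)" b]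
      by (simp add: dist_norm)
  qed (rule s)
  moreover have "deriv (\<lambda>x. ?G x - ?F x) 0 = diag_deriv b g - diag_deriv b f"
    unfolding diag_deriv_def using D by (intro deriv_diff)
  ultimately show ?thesis by (simp add: dist_norm)
qed

text \<open>By Cauchy's inequality the derivative is continuous for uniform convergence on a disc in
  the axis \<open>b\<close>, and every neighbourhood of the origin contains such a disc.\<close>

lemma continuous_map_germ_deriv:
  "continuous_map (germ_topology (0 :: complex^'n)) euclidean (germ_deriv b)"
  unfolding continuous_map_def topspace_germ_topology
proof (intro conjI allI impI)
  fix S :: "complex set" assume "openin euclidean S"
  then have "open S" by simp
  show "openin (germ_topology (0 :: complex^'n)) {A \<in> holo_germs 0. germ_deriv b A \<in> S}"
    unfolding openin_germ_topology openin_compact_convergence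
  proof (intro conjI allI impI ballI)
    fix U :: "(complex^'n) set" and f
    assume U: "open U \<and> 0 \<in> U" and f: "f \<in> {f \<in> holo_maps U. germ 0 f \<in> {A \<in> holo_germs 0. germ_deriv b A \<in> S}}"
    then have f': "f \<in> holo_maps U" "diag_deriv b f \<in> S" by (auto simp: germ_deriv_germ)
    obtain e where e: "e > 0" "ball (diag_deriv b f) e \<subseteq> S"
      using \<open>open S\<close> f'(2) open_contains_ball by blast
    obtain s where s: "s > 0" "cball 0 s \<subseteq> U" using U open_contains_cball by blast
    let ?K = "(\<lambda>x. x *s axis b 1) ` cball (0 :: complex) s :: (complex^'n) set"
    have "compact ?K"
      by (intro compact_continuous_image linear_continuous_on linear_smult compact_cball)
    moreover have "?K \<subseteq> U" using s(2) by (auto simp: norm_axis_one subset_iff)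
    moreover have "e * s / 2 > 0" using e s by simp
    moreover have "{g \<in> holo_maps U. \<forall>z\<in>?K. dist (g z) (f z) < e * s / 2}
        \<subseteq> {f \<in> holo_maps U. germ 0 f \<in> {A \<in> holo_germs 0. germ_deriv b A \<in> S}}"
    proof
      fix g assume g: "g \<in> {g \<in> holo_maps U. \<forall>z\<in>?K. dist (g z) (f z) < e * s / 2}"
      then have "dist (diag_deriv b g) (diag_deriv b f) \<le> (e * s / 2) / s"
        by (intro diag_deriv_diff_le[OF f'(1) _ s]) (auto intro: less_imp_le)
      then have "diag_deriv b g \<in> ball (diag_deriv b f) e" using e s by (simp add: dist_commute)
      then have "diag_deriv b g \<in> S" using e(2) by blast
      then show "g \<in> {f \<in> holo_maps U. germ 0 f \<in> {A \<in> holo_germs 0. germ_deriv b A \<in> S}}"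
        using g U by (auto simp: germ_deriv_germ holo_germs_def)
    qed
    ultimately show "\<exists>K e. compact K \<and> K \<subseteq> U \<and> 0 < e \<and>
        {g \<in> holo_maps U. \<forall>z\<in>K. dist (g z) (f z) < e}
        \<subseteq> {f \<in> holo_maps U. germ 0 f \<in> {A \<in> holo_germs 0. germ_deriv b A \<in> S}}" by blast
  qed auto
qed auto

lemma continuous_map_germ_rot:
  "continuous_map (top_of_set G) (germ_topology (0 :: complex^'n)) (\<lambda>\<zeta>. germ 0 (rot i0 \<zeta>))"
  unfolding continuous_map_def topspace_germ_topology
proof (intro conjI allI impI)
  have rot_maps: "rot i0 \<zeta> \<in> holo_maps (UNIV :: (complex^'n) set)" for \<zeta>
    using bounded_linear_imp_has_derivative[OF bounded_linear_rot, of i0 \<zeta>]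
    by (auto simp: holo_maps_def holo_on_def rot_smult intro!: exI[of _ "rot i0 \<zeta>"])
  then show "(\<lambda>\<zeta>. germ 0 (rot i0 \<zeta>)) \<in> topspace (top_of_set G) \<rightarrow> holo_germs (0 :: complex^'n)"
    unfolding holo_germs_def by blast
  fix W :: "(complex^'n \<Rightarrow> complex^'n) set set" assume "openin (germ_topology 0) W"
  then have W: "openin (compact_convergence UNIV) {f \<in> holo_maps UNIV. germ 0 f \<in> W}"
    unfolding openin_germ_topology by blast
  show "openin (top_of_set G) {\<zeta> \<in> topspace (top_of_set G). germ 0 (rot i0 \<zeta>) \<in> W}"
    unfolding openin_euclidean_subtopology_iff
  proof (intro conjI ballI)
    fix \<zeta> assume "\<zeta> \<in> {\<zeta> \<in> topspace (top_of_set G). germ 0 (rot i0 \<zeta>) \<in> W}"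
    then have "rot i0 \<zeta> \<in> {f \<in> holo_maps UNIV. germ 0 f \<in> W}" using rot_maps by auto
    then obtain K e where K: "compact K" "e > 0"
        "{g \<in> holo_maps UNIV. \<forall>z\<in>K. dist (g z) (rot i0 \<zeta> z) < e} \<subseteq> {f \<in> holo_maps UNIV. germ 0 f \<in> W}"
      using W unfolding openin_compact_convergence by blast
    obtain R where R: "R > 0" "\<And>z. z \<in> K \<Longrightarrow> norm z \<le> R"
      using compact_imp_bounded[OF K(1)] bounded_pos by blast
    have "germ 0 (rot i0 \<xi>) \<in> W" if "dist \<xi> \<zeta> < e / R" for \<xi>
    proof -
      have "dist (rot i0 \<xi> z) (rot i0 \<zeta> z) < e" if z: "z \<in> K" for z
      proof -
        have "dist (rot i0 \<xi> z) (rot i0 \<zeta> z) = dist \<xi> \<zeta> * norm (tail i0 z)"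
          by (simp only: dist_norm rot_diff_rot norm_smult)
        also have "\<dots> \<le> dist \<xi> \<zeta> * R"
          using R(2)[OF z] tail_le[of i0 z] by (intro mult_left_mono) auto
        also have "\<dots> < e" using \<open>dist \<xi> \<zeta> < e / R\<close> R(1) by (simp add: pos_less_divide_eq)
        finally show ?thesis .
      qed
      then show ?thesis using K(3) rot_maps by blast
    qed
    then show "\<exists>d>0. \<forall>\<xi>\<in>G. dist \<xi> \<zeta> < d \<longrightarrow> \<xi> \<in> {\<zeta> \<in> topspace (top_of_set G). germ 0 (rot i0 \<zeta>) \<in> W}"
      using K(2) R(1) by (intro exI[of _ "e / R"]) auto
  qed auto
qed

context bumpy_sphere
begin

lemma aut_germs_M: "aut_germs M 0 = (\<lambda>\<zeta>. germ 0 (rot i0 \<zeta>)) ` (\<Union>k. H k)"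
proof (intro equalityI subsetI)
  fix A assume "A \<in> aut_germs M 0"
  then obtain f where f: "A = germ 0 f" "aut_rep M 0 f" by (auto simp: aut_germs_alt)
  then obtain \<zeta> where "\<zeta> \<in> (\<Union>k. H k)" "\<forall>\<^sub>F Z in nhds 0. f Z = rot i0 \<zeta> Z"
    using aut_rep_is_rot by blast
  then show "A \<in> (\<lambda>\<zeta>. germ 0 (rot i0 \<zeta>)) ` (\<Union>k. H k)" using f(1) germ_eqI by blast
qed (use rot_aut_rep in \<open>auto simp: aut_germs_alt\<close>)

lemma Aut_M: "topologically_isomorphic (Aut M 0) (Aut_topology M 0)
    (circle_group\<lparr>carrier := \<Union>k. H k\<rparr>) (top_of_set (\<Union>k. H k))"
proof -
  let ?G = "\<Union>k. H k" and ?germ = "\<lambda>\<zeta>. germ 0 (rot i0 \<zeta>)"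
  obtain b where b: "b \<noteq> i0" using other_index by blast
  have inv: "germ_deriv b (?germ \<zeta>) = \<zeta>" for \<zeta>
    by (simp add: germ_deriv_germ diag_deriv_rot b)
  have car: "carrier (Aut M 0) = ?germ ` ?G" by (simp add: Aut_def aut_germs_M)
  have "germ_deriv b \<in> iso (Aut M 0) (circle_group\<lparr>carrier := ?G\<rparr>)"
  proof (rule isoI)
    show "germ_deriv b \<in> hom (Aut M 0) (circle_group\<lparr>carrier := ?G\<rparr>)"
    proof (rule homI)
      fix A B assume "A \<in> carrier (Aut M 0)" "B \<in> carrier (Aut M 0)"
      then obtain \<zeta> \<xi> where AB: "A = ?germ \<zeta>" "B = ?germ \<xi>" "\<zeta> \<in> ?G" "\<xi> \<in> ?G" unfolding car by blast
      have "aut_rep M 0 (rot i0 \<xi>)" using AB(4) rot_aut_rep by blast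
      then have "germ_comp 0 A B = ?germ (\<zeta> * \<xi>)"
        unfolding AB(1,2) by (subst germ_comp_germ[OF aut_rep_tendsto]) (auto simp: o_def rot_rot)
      then show "germ_deriv b (A \<otimes>\<^bsub>Aut M 0\<^esub> B) =
          germ_deriv b A \<otimes>\<^bsub>circle_group\<lparr>carrier := ?G\<rparr>\<^esub> germ_deriv b B"
        by (simp add: Aut_def circle_group_def inv AB(1,2))
    qed (auto simp: car inv)
    show "bij_betw (germ_deriv b) (carrier (Aut M 0)) (carrier (circle_group\<lparr>carrier := ?G\<rparr>))"
      unfolding car by (rule bij_betw_byWitness[where f' = ?germ]) (auto simp: inv)
  qed
  moreover have "homeomorphic_maps (Aut_topology M 0) (top_of_set ?G) (germ_deriv b) ?germ"
    unfolding homeomorphic_maps_def topspace_Aut_topology car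
  proof (intro conjI)
    have "continuous_map (Aut_topology M 0) euclidean (germ_deriv b)"
      unfolding Aut_topology_def by (intro continuous_map_from_subtopology continuous_map_germ_deriv)
    then show "continuous_map (Aut_topology M 0) (top_of_set ?G) (germ_deriv b)"
      unfolding continuous_map_in_subtopology topspace_Aut_topology car by (auto simp: inv)
    show "continuous_map (top_of_set ?G) (Aut_topology M 0) ?germ"
      unfolding Aut_topology_def continuous_map_in_subtopology car
      using continuous_map_germ_rot by auto
  qed (auto simp: inv)
  ultimately show ?thesis
    unfolding topologically_isomorphic_def homeomorphic_map_maps by blast
qed

end

section \<open>Construction of the bumps\<close>

lemma finite_pos_lower_bound:
  fixes S :: "real set"
  assumes "finite S" "\<And>x. x \<in> S \<Longrightarrow> 0 < x"
  shows "\<exists>d>0. \<forall>x\<in>S. d \<le> x"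
proof -
  have "Min (insert 1 S) > 0" "\<forall>x\<in>S. Min (insert 1 S) \<le> x" using assms by auto
  then show ?thesis by blast
qed

text \<open>Points with \<open>x $ i0 = 0\<close> cannot be scaled to \<open>x $ i0 = 1\<close>, and
  on the axis \<open>i0\<close> all rotations act trivially; both have to be avoided by the
  directions.\<close>

lemma countable_dense_off_axes:
  assumes "b \<noteq> (i0 :: 'n::finite)"
  shows "\<exists>T :: (complex^'n) set. countable T \<and> closure T = UNIV \<and> (\<forall>x\<in>T. x $ i0 \<noteq> 0 \<and> tail i0 x \<noteq> 0)"
proof -
  obtain D :: "(complex^'n) set" where D: "countable D" "\<And>X. open X \<Longrightarrow> X \<noteq> {} \<Longrightarrow> \<exists>d\<in>D. d \<in> X"
    using countable_dense_exists by blast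
  define S where "S = {x :: complex^'n. x $ i0 \<noteq> 0 \<and> x $ b \<noteq> 0}"
  have "open S" unfolding S_def
    by (intro open_Collect_conj open_Collect_neq continuous_intros)
  have dense: "\<exists>d\<in>D \<inter> S. d \<in> X" if X: "open X" "X \<noteq> {}" for X
  proof -
    obtain z where "z \<in> X" using X(2) by blast
    then obtain e where z: "e > 0" "ball z e \<subseteq> X"
      using X(1) open_contains_ball by blast
    let ?v = "axis i0 1 + axis b 1 :: complex^'n"
    have "infinite ({0<..<e / 2} - {- Re (z $ i0), - Re (z $ b)})"
      using z(1) by (intro Diff_infinite_finite) auto
    from infinite_imp_nonempty[OF this]
    obtain t where "t \<in> {0<..<e / 2} - {- Re (z $ i0), - Re (z $ b)}" by blast
    then have t: "0 < t" "t < e / 2" "t \<noteq> - Re (z $ i0)" "t \<noteq> - Re (z $ b)" by auto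
    let ?y = "z + complex_of_real t *s ?v"
    have "norm ?v \<le> 2" using norm_triangle_ineq[of "axis i0 1 :: complex^'n" "axis b 1"] by (simp add: norm_axis_one)
    then have "norm (complex_of_real t *s ?v) \<le> t * 2"
      unfolding norm_smult using t(1) by (intro mult_mono) auto
    moreover have "dist z ?y = norm (complex_of_real t *s ?v)"
      by (metis add_diff_cancel_left' dist_commute dist_norm)
    ultimately have "?y \<in> ball z e" using t(2) by (simp only: mem_ball)
    then have "?y \<in> X" using z(2) by blast
    moreover have "?y $ i0 = z $ i0 + of_real t" "?y $ b = z $ b + of_real t"
      using assms by (simp_all add: axis_def)
    then have "?y \<in> S" using t(3,4) by (auto simp: S_def complex_eq_iff)
    ultimately show ?thesis using D(2)[of "X \<inter> S"] X \<open>open S\<close> by blast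
  qed
  have "closure (D \<inter> S) = UNIV"
  proof (rule ccontr)
    assume "closure (D \<inter> S) \<noteq> UNIV"
    then obtain d where "d \<in> D \<inter> S" "d \<in> - closure (D \<inter> S)" using dense[of "- closure (D \<inter> S)"] by blast
    then show False using closure_subset[of "D \<inter> S"] by blast
  qed
  moreover have "x $ i0 \<noteq> 0 \<and> tail i0 x \<noteq> 0" if "x \<in> D \<inter> S" for x
    using that assms by (auto simp: S_def tail_def vec_eq_iff intro!: exI[of _ b])
  ultimately show ?thesis using D(1) by (intro exI[of _ "D \<inter> S"]) auto
qed

text \<open>Each centre is the point of the circle in direction \<open>u j\<close> with a parameter
  \<open>t\<close> as in \<open>circle_point\<close>; as the norm of this point is at most \<open>t
  |u j|\<close>, the choice of \<open>t\<close> ensures the decrease of the norms.\<close>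

primrec centre :: "(nat \<Rightarrow> complex^'n) \<Rightarrow> nat \<Rightarrow> complex^'n" where
  "centre u 0 = (1 / (of_real ((norm (u 0))\<^sup>2) + \<i>)) *s u 0"
| "centre u (Suc j) = (let t = norm (centre u j) / (real (j + 2) * norm (u (Suc j)))
     in (of_real t / (of_real ((norm (u (Suc j)))\<^sup>2 * t) + \<i>)) *s u (Suc j))"

lemma centre_props:
  fixes u :: "nat \<Rightarrow> complex^'n"
  assumes u: "\<And>j. u j $ i0 = 1" "\<And>j. tail i0 (u j) \<noteq> 0"
  shows "centre u j = (centre u j $ i0) *s u j" "(norm (centre u j))\<^sup>2 = Re (centre u j $ i0)"
    "centre u j $ i0 \<noteq> 0" "tail i0 (centre u j) \<noteq> 0"
    "real (j + 2) * norm (centre u (Suc j)) \<le> norm (centre u j)"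
proof -
  have u0: "norm (u j) > 0" for j using u(1)[of j] by (metis zero_index zero_less_norm_iff zero_neq_one)
  have main: "Z = (Z $ i0) *s u j \<and> (norm Z)\<^sup>2 = Re (Z $ i0) \<and> Z $ i0 \<noteq> 0 \<and> norm Z \<le> t * norm (u j)"
    if t: "t > 0" and Z: "Z = (of_real t / (of_real ((norm (u j))\<^sup>2 * t) + \<i>)) *s u j" for Z t j
  proof -
    let ?x = "complex_of_real t / (of_real ((norm (u j))\<^sup>2 * t) + \<i>)"
    have Z0: "Z $ i0 = ?x" by (simp add: Z u)
    note x = circle_point[where a = "(norm (u j))\<^sup>2" and t = t]
    have "norm Z = norm ?x * norm (u j)" by (simp only: Z norm_smult)
    moreover have "norm ?x * norm (u j) \<le> t * norm (u j)" using x(2) t by (intro mult_right_mono) auto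
    ultimately show ?thesis unfolding Z0 using Z x(1,3) t by (simp add: power_mult_distrib mult.commute)
  qed
  have step: "\<exists>t>0. centre u j = (of_real t / (of_real ((norm (u j))\<^sup>2 * t) + \<i>)) *s u j" for j
  proof (induction j)
    case 0
    then show ?case by (intro exI[of _ 1]) simp
  next
    case (Suc j)
    then obtain t where "t > 0" "centre u j = (of_real t / (of_real ((norm (u j))\<^sup>2 * t) + \<i>)) *s u j" by blast
    from main[OF this] have "centre u j \<noteq> 0" by (metis zero_index)
    then show ?case
      using u0[of "Suc j"] by (intro exI[of _ "norm (centre u j) / (real (j + 2) * norm (u (Suc j)))"]) (simp add: Let_def)
  qed
  obtain t where "t > 0" "centre u j = (of_real t / (of_real ((norm (u j))\<^sup>2 * t) + \<i>)) *s u j" using step by blast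
  from main[OF this] show c: "centre u j = (centre u j $ i0) *s u j" "(norm (centre u j))\<^sup>2 = Re (centre u j $ i0)"
    "centre u j $ i0 \<noteq> 0" by auto
  have "tail i0 (x *s u j) = x *s tail i0 (u j)" for x by (simp add: tail_def vec_eq_iff)
  then show "tail i0 (centre u j) \<noteq> 0" using c(1,3) u(2)[of j] by (metis vector_mul_eq_0)
  have "centre u j \<noteq> 0" using c(3) by (metis zero_index)
  define s where "s = norm (centre u j) / (real (j + 2) * norm (u (Suc j)))"
  have "s > 0" using \<open>centre u j \<noteq> 0\<close> u0[of "Suc j"] by (simp add: s_def)
  moreover have "centre u (Suc j) = (of_real s / (of_real ((norm (u (Suc j)))\<^sup>2 * s) + \<i>)) *s u (Suc j)"
    by (simp only: centre.simps Let_def s_def)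
  ultimately have "norm (centre u (Suc j)) \<le> s * norm (u (Suc j))" using main by blast
  also have "\<dots> = norm (centre u j) / real (j + 2)" using u0[of "Suc j"] by (simp add: s_def)
  finally show "real (j + 2) * norm (centre u (Suc j)) \<le> norm (centre u j)"
    by (simp add: pos_le_divide_eq mult.commute)
qed

text \<open>The directions enumerate a dense sequence, each term infinitely often by means of the
  pairing function; given the centres, every radius has to satisfy finitely many upper
  bounds.\<close>

lemma exists_bumpy_sphere:
  fixes i0 b :: "'n::finite"
  assumes b: "b \<noteq> i0"
    and H: "\<And>k \<zeta>. \<zeta> \<in> H k \<Longrightarrow> norm \<zeta> = 1" "\<And>k. 1 \<in> H k" "\<And>k \<zeta> \<xi>. \<zeta> \<in> H k \<Longrightarrow> \<xi> \<in> H k \<Longrightarrow> \<zeta> * \<xi> \<in> H k"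
      "\<And>k \<zeta>. \<zeta> \<in> H k \<Longrightarrow> inverse \<zeta> \<in> H k" "\<And>j k. j \<le> k \<Longrightarrow> H j \<subseteq> H k" "\<And>k. finite (H k)"
  shows "\<exists>u c \<delta>. bumpy_sphere i0 H u c \<delta>"
proof -
  obtain T :: "(complex^'n) set" where T: "countable T" "closure T = UNIV" "\<And>x. x \<in> T \<Longrightarrow> x $ i0 \<noteq> 0 \<and> tail i0 x \<noteq> 0"
    using countable_dense_off_axes[OF b] by blast
  have "T \<noteq> {}" using T(2) by auto
  define w where "w = (\<lambda>n. inverse (from_nat_into T n $ i0) *s from_nat_into T n)"
  define u where "u = (\<lambda>j. w (fst (prod_decode j)))"
  have inT: "from_nat_into T n \<in> T" for n using from_nat_into[OF \<open>T \<noteq> {}\<close>] .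
  have tail_s: "tail i0 (x *s y) = x *s tail i0 y" for x and y :: "complex^'n" by (simp add: tail_def vec_eq_iff)
  have u: "u j $ i0 = 1" "tail i0 (u j) \<noteq> 0" for j
    using T(3)[OF inT] by (auto simp: u_def w_def tail_s)
  note c = centre_props[of u i0, OF u]
  let ?S = "\<lambda>j. {norm (tail i0 (centre u j)) / 4, norm (centre u j $ i0) ^ j, 1 / (4000 * (real CARD('n))\<^sup>2)}
     \<union> (\<lambda>(\<zeta>, \<xi>). norm (\<zeta> - \<xi>) * norm (tail i0 (centre u j)) / 4) ` {(\<zeta>, \<xi>) \<in> H j \<times> H j. \<zeta> \<noteq> \<xi>}"
  have "\<exists>d>0. \<forall>x\<in>?S j. d \<le> x" for j
  proof (rule finite_pos_lower_bound)
    have "finite {(\<zeta>, \<xi>) \<in> H j \<times> H j. \<zeta> \<noteq> \<xi>}" using H(6) by (auto intro: finite_subset[of _ "H j \<times> H j"])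
    then show "finite (?S j)" by blast
    have "\<forall>x\<in>?S j. 0 < x" using c(3,4)[of j] by (simp add: ball_Un)
    then show "0 < x" if "x \<in> ?S j" for x using that by blast
  qed
  then have "\<forall>j. \<exists>d. d > 0 \<and> (\<forall>x\<in>?S j. d \<le> x)" by blast
  from choice[OF this] obtain \<delta> where \<delta>: "\<forall>j. \<delta> j > 0 \<and> (\<forall>x\<in>?S j. \<delta> j \<le> x)" ..
  have d: "\<delta> j > 0" "x \<in> ?S j \<Longrightarrow> \<delta> j \<le> x" for j x
    using conjunct1[OF spec[OF \<delta>, of j]] bspec[OF conjunct2[OF spec[OF \<delta>, of j]], of x] by blast+
  have "bumpy_sphere i0 H u (centre u) \<delta>"
  proof
    show "4 * \<delta> j \<le> norm (tail i0 (centre u j))" for j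
      using d(2)[of "norm (tail i0 (centre u j)) / 4" j] by simp
    show "\<delta> j \<le> norm (centre u j $ i0) ^ j" for j by (rule d(2)) simp
    show "4000 * (real CARD('n))\<^sup>2 * \<delta> j \<le> 1" for j
      using d(2)[of "1 / (4000 * (real CARD('n))\<^sup>2)" j] by (simp add: field_simps)
    show "4 * \<delta> j \<le> norm (\<zeta> - \<xi>) * norm (tail i0 (centre u j))" if "\<zeta> \<in> H j" "\<xi> \<in> H j" "\<zeta> \<noteq> \<xi>" for \<zeta> \<xi> j
    proof -
      have "norm (\<zeta> - \<xi>) * norm (tail i0 (centre u j)) / 4 \<in> ?S j" using that by force
      from d(2)[OF this] show ?thesis by simp
    qed
    have "T \<subseteq> {x. x $ i0 \<noteq> 0 \<and> infinite {j. x = x $ i0 *s u j}}"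
    proof
      fix x assume x: "x \<in> T"
      then obtain n where n: "from_nat_into T n = x" using from_nat_into_surj[OF T(1)] by blast
      have x0: "x $ i0 \<noteq> 0" using T(3) x by blast
      have "range (\<lambda>m. prod_encode (n, m)) \<subseteq> {j. x = x $ i0 *s u j}"
        using x0 by (auto simp: u_def w_def n)
      moreover have "infinite (range (\<lambda>m. prod_encode (n, m)))"
        by (rule range_inj_infinite) (auto simp: inj_def)
      ultimately show "x \<in> {x. x $ i0 \<noteq> 0 \<and> infinite {j. x = x $ i0 *s u j}}"
        using x0 infinite_super by blast
    qed
    from closure_mono[OF this] show "closure {x. x $ i0 \<noteq> 0 \<and> infinite {j. x = x $ i0 *s u j}} = UNIV"
      using T(2) by blast
  qed (use H u c d in auto)
  then show ?thesis by blast
qed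

section \<open>Subgroups of the circle\<close>

lemma group_circle: "group circle_group"
proof (rule groupI)
  fix x assume x: "x \<in> carrier circle_group"
  then have "cnj x * x = 1" by (simp add: circle_group_def mult.commute[of "cnj x"] flip: complex_norm_square)
  then show "\<exists>y\<in>carrier circle_group. y \<otimes>\<^bsub>circle_group\<^esub> x = \<one>\<^bsub>circle_group\<^esub>"
    using x by (intro bexI[of _ "cnj x"]) (auto simp: circle_group_def)
qed (auto simp: circle_group_def norm_mult)

lemma inv_circle:
  assumes "norm x = 1"
  shows "inv\<^bsub>circle_group\<^esub> x = inverse x"
proof (rule group.inv_equality[OF group_circle])
  have "x \<noteq> 0" using assms by auto
  then show "inverse x \<otimes>\<^bsub>circle_group\<^esub> x = \<one>\<^bsub>circle_group\<^esub>" by (simp add: circle_group_def)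
qed (use assms in \<open>auto simp: circle_group_def norm_inverse\<close>)

lemma subgroup_circle_iff:
  "subgroup S circle_group \<longleftrightarrow> S \<subseteq> sphere 0 1 \<and> 1 \<in> S \<and> (\<forall>x\<in>S. \<forall>y\<in>S. x * y \<in> S) \<and> (\<forall>x\<in>S. inverse x \<in> S)"
proof
  assume S: "subgroup S circle_group"
  have "S \<subseteq> sphere 0 1" using subgroup.subset[OF S] by (simp add: circle_group_def)
  then show "S \<subseteq> sphere 0 1 \<and> 1 \<in> S \<and> (\<forall>x\<in>S. \<forall>y\<in>S. x * y \<in> S) \<and> (\<forall>x\<in>S. inverse x \<in> S)"
    using subgroup.one_closed[OF S] subgroup.m_closed[OF S] subgroup.m_inv_closed[OF S] inv_circle
    by (fastforce simp: circle_group_def)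
next
  assume "S \<subseteq> sphere 0 1 \<and> 1 \<in> S \<and> (\<forall>x\<in>S. \<forall>y\<in>S. x * y \<in> S) \<and> (\<forall>x\<in>S. inverse x \<in> S)"
  then show "subgroup S circle_group"
    using inv_circle by unfold_locales (auto simp: circle_group_def subset_iff)
qed

definition dyadic :: "nat \<Rightarrow> nat \<Rightarrow> complex" where
  "dyadic m l = cis (2 * pi * (real l / 2 ^ m))"

lemma dyadic_exp: "exp (2 * of_real pi * \<i> * of_nat l / 2 ^ m) = dyadic m l"
  unfolding dyadic_def cis_conv_exp by (simp add: mult_ac)

lemma dyadic_add: "dyadic m k * dyadic m l = dyadic m (k + l)"
  by (simp add: dyadic_def cis_mult ring_distribs add_divide_distrib)

lemma dyadic_double: "dyadic m l = dyadic (Suc m) (2 * l)"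
  by (simp add: dyadic_def)

lemma dyadic_power: "dyadic m l ^ 2 ^ m = 1"
  unfolding dyadic_def by (simp add: Complex.DeMoivre)

lemma subgroup_dyadic: "subgroup (range (dyadic m)) circle_group"
  unfolding subgroup_circle_iff
proof (intro conjI ballI)
  show "range (dyadic m) \<subseteq> sphere 0 1" by (auto simp: dyadic_def)
  show "1 \<in> range (dyadic m)" by (rule range_eqI[of _ _ 0]) (simp add: dyadic_def)
  show "x * y \<in> range (dyadic m)" if "x \<in> range (dyadic m)" "y \<in> range (dyadic m)" for x y
    using that by (auto simp: dyadic_add)
  show "inverse x \<in> range (dyadic m)" if x: "x \<in> range (dyadic m)" for x
  proof -
    have pow: "x ^ k \<in> range (dyadic m)" for k
    proof (induction k)
      case 0
      show ?case by (rule range_eqI[of _ _ 0]) (simp add: dyadic_def)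
    next
      case (Suc k)
      then show ?case using x by (auto simp: dyadic_add)
    qed
    have "x * x ^ (2 ^ m - 1) = 1" using x dyadic_power[of m] by (auto simp flip: power_Suc)
    then have "inverse x = x ^ (2 ^ m - 1)" by (rule inverse_unique)
    then show ?thesis using pow by simp
  qed
qed

lemma dyadic_subgroup:
  "range (dyadic m) \<subseteq> sphere 0 1" "1 \<in> range (dyadic m)"
  "x \<in> range (dyadic m) \<Longrightarrow> y \<in> range (dyadic m) \<Longrightarrow> x * y \<in> range (dyadic m)"
  "x \<in> range (dyadic m) \<Longrightarrow> inverse x \<in> range (dyadic m)"
  using subgroup_dyadic[of m] unfolding subgroup_circle_iff by auto

lemma finite_dyadic: "finite (range (dyadic m))"
proof (rule finite_subset)
  show "range (dyadic m) \<subseteq> {z. z ^ 2 ^ m = 1}" using dyadic_power by blast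
  show "finite {z :: complex. z ^ 2 ^ m = 1}" by (rule finite_roots_unity) simp
qed

lemma dyadic_mono: "incseq (\<lambda>m. range (dyadic m))"
  by (rule incseq_SucI) (use dyadic_double in blast)

lemma dyadic_dense: "sphere 0 1 \<subseteq> closure (\<Union>m. range (dyadic m))"
proof
  fix z :: complex assume z: "z \<in> sphere 0 1"
  define x where "x = Arg2pi z / (2 * pi)"
  have x: "x \<ge> 0" using Arg2pi_ge_0[of z] by (simp add: x_def)
  have zx: "z = cis (2 * pi * x)"
    using Arg2pi_eq[of z] z by (simp add: x_def cis_conv_exp)
  let ?l = "\<lambda>m. real (nat \<lfloor>x * 2 ^ m\<rfloor>) / 2 ^ m"
  have l: "x - (1 / 2) ^ m \<le> ?l m" "?l m \<le> x" for m
  proof -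
    have "real (nat \<lfloor>x * 2 ^ m\<rfloor>) = of_int \<lfloor>x * 2 ^ m\<rfloor>" using x by simp
    then have "x * 2 ^ m - 1 \<le> real (nat \<lfloor>x * 2 ^ m\<rfloor>)" "real (nat \<lfloor>x * 2 ^ m\<rfloor>) \<le> x * 2 ^ m" by linarith+
    then have "x \<le> (real (nat \<lfloor>x * 2 ^ m\<rfloor>) + 1) / 2 ^ m" "?l m \<le> x"
      by (simp_all only: pos_le_divide_eq pos_divide_le_eq zero_less_power zero_less_numeral)
    then show "x - (1 / 2) ^ m \<le> ?l m" "?l m \<le> x"
      by (simp_all add: power_one_over add_divide_distrib)
  qed
  have "?l \<longlonglongrightarrow> x"
  proof (rule tendsto_sandwich[of "\<lambda>m. x - (1 / 2) ^ m" _ _ "\<lambda>_. x"])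
    have "(\<lambda>m. x - (1 / 2) ^ m) \<longlonglongrightarrow> x - 0"
      by (intro tendsto_intros LIMSEQ_power_zero) auto
    then show "(\<lambda>m. x - (1 / 2) ^ m) \<longlonglongrightarrow> x" by simp
  qed (use l in auto)
  then have "(\<lambda>m. dyadic m (nat \<lfloor>x * 2 ^ m\<rfloor>)) \<longlonglongrightarrow> z"
    unfolding dyadic_def zx by (intro tendsto_intros)
  then show "z \<in> closure (\<Union>m. range (dyadic m))"
    unfolding closure_sequential by (intro exI[of _ "\<lambda>m. dyadic m (nat \<lfloor>x * 2 ^ m\<rfloor>)"]) auto
qed

lemma dyadic_not_isolated:
  assumes z: "z \<in> (\<Union>m. range (dyadic m))" and e: "e > 0"
  shows "\<exists>y\<in>(\<Union>m. range (dyadic m)). y \<noteq> z \<and> dist y z < e"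
proof -
  have "(\<lambda>m. (1 / 2 :: real) ^ m) \<longlonglongrightarrow> 0" by (rule LIMSEQ_power_zero) simp
  then have "(\<lambda>m. cis (2 * pi * (1 / 2) ^ m)) \<longlonglongrightarrow> cis (2 * pi * 0)" by (intro tendsto_intros) simp
  then have "(\<lambda>m. dyadic m 1) \<longlonglongrightarrow> 1" by (simp add: dyadic_def power_one_over)
  then obtain N where N: "\<And>m. m \<ge> N \<Longrightarrow> dist (dyadic m 1) 1 < e" using e unfolding lim_sequentially by blast
  let ?d = "dyadic (Suc N) 1"
  have "?d ^ 2 ^ N = -1" by (simp add: dyadic_def Complex.DeMoivre)
  then have "?d \<noteq> 1" by (metis one_neq_neg_one power_one)
  obtain m l where ml: "z = dyadic m l" using z by blast
  have n: "norm z = 1" by (simp add: ml dyadic_def)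
  have mono: "range (dyadic i) \<subseteq> range (dyadic j)" if "i \<le> j" for i j using dyadic_mono that by (simp add: incseq_def)
  have "z \<in> range (dyadic (max m (Suc N)))" "?d \<in> range (dyadic (max m (Suc N)))"
    using mono[of m "max m (Suc N)"] mono[of "Suc N" "max m (Suc N)"] ml by auto
  then have "z * ?d \<in> range (dyadic (max m (Suc N)))" by (rule dyadic_subgroup(3))
  then have "z * ?d \<in> (\<Union>m. range (dyadic m))" by (rule UN_I[OF UNIV_I])
  moreover have "z * ?d \<noteq> z" using \<open>?d \<noteq> 1\<close> n by auto
  moreover have "dist (z * ?d) z < e"
  proof -
    have "z * ?d - z = z * (?d - 1)" by (simp add: algebra_simps)
    then show ?thesis using N[of "Suc N"] n by (simp add: dist_norm norm_mult)
  qed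
  ultimately show ?thesis by blast
qed

section \<open>Countable Lie groups are discrete\<close>

text \<open>An open set contains an interval in the direction of the first coordinate.\<close>

lemma open_in_Euclidean_space_uncountable:
  assumes "openin (Euclidean_space d) S" "y \<in> S" "d > 0"
  shows "uncountable S"
proof
  assume S: "countable S"
  have yd: "\<forall>i\<ge>d. y i = 0"
    using openin_subset[OF assms(1)] assms(2) by (auto simp: topspace_Euclidean_space)
  let ?g = "\<lambda>t. y(0 := t)"
  have "continuous_map euclideanreal (Euclidean_space d) ?g"
    unfolding Euclidean_space_def continuous_map_in_subtopology
  proof
    show "continuous_map euclideanreal (powertop_real UNIV) ?g"
      unfolding continuous_map_componentwise_UNIV by (auto simp: fun_upd_def)
  qed (use yd assms(3) in auto)
  from openin_continuous_map_preimage[OF this assms(1)] have "open {t. ?g t \<in> S}" by simp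
  moreover have "y 0 \<in> {t. ?g t \<in> S}" using assms(2) by simp
  ultimately obtain e where e: "e > 0" "ball (y 0) e \<subseteq> {t. ?g t \<in> S}" using open_contains_ball by blast
  have "inj ?g" by (auto simp: inj_def fun_eq_iff dest: spec[of _ 0])
  moreover have "?g ` ball (y 0) e \<subseteq> S" using e(2) by auto
  then have "countable (?g ` ball (y 0) e)" using S countable_subset by blast
  ultimately have "countable (ball (y 0) e)" using countable_image_inj_on inj_on_subset by blast
  then show False using uncountable_ball[OF e(1)] by blast
qed

text \<open>A chart identifies an open set with a countable open subset of a Euclidean space, so the
  dimension is zero.\<close>

lemma countable_lie_group_isolated:
  assumes "lie_group A T" "countable (topspace T)" "x \<in> topspace T"
  shows "openin T {x}"
proof -
  obtain d C where C: "smooth_atlas T d C" using assms(1) unfolding lie_group_def by blast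
  then obtain U \<phi> where U: "(U, \<phi>) \<in> C" "x \<in> U" using assms(3) unfolding smooth_atlas_def by auto
  then have o: "openin T U" "openin (Euclidean_space d) (\<phi> ` U)"
    "homeomorphic_map (subtopology T U) (subtopology (Euclidean_space d) (\<phi> ` U)) \<phi>"
    using C unfolding smooth_atlas_def by blast+
  have sub: "U \<subseteq> topspace T" by (rule openin_subset[OF o(1)])
  have inj: "inj_on \<phi> U"
    using homeomorphic_imp_injective_map[OF o(3)] unfolding topspace_subtopology_subset[OF sub] .
  have "countable (\<phi> ` U)" using assms(2) sub countable_subset by blast
  then have "d = 0" using open_in_Euclidean_space_uncountable[OF o(2), of "\<phi> x"] U(2) by blast
  then have "\<phi> ` U \<subseteq> {\<lambda>_. 0}"
    using openin_subset[OF o(2)] by (auto simp: topspace_Euclidean_space)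
  then have "\<phi> y = \<phi> x" if "y \<in> U" for y
    using that U(2) by (simp add: image_subset_iff)
  then have "U = {x}" using inj_onD[OF inj] U(2) by blast
  then show ?thesis using o(1) by simp
qed

lemma not_lie_group_dyadic:
  assumes "topologically_isomorphic A T B (top_of_set (\<Union>m. range (dyadic m)))"
  shows "\<not> lie_group A T"
proof
  assume L: "lie_group A T"
  let ?D = "\<Union>m. range (dyadic m)"
  obtain h where h: "homeomorphic_map T (top_of_set ?D) h"
    using assms unfolding topologically_isomorphic_def by blast
  have im: "h ` topspace T = ?D" using homeomorphic_imp_surjective_map[OF h] by simp
  have "countable ?D" by simp
  then have "countable (topspace T)"
    using im homeomorphic_imp_injective_map[OF h] by (metis countable_image_inj_on)
  moreover obtain x where x: "x \<in> topspace T" using im by blast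
  ultimately have "openin T {x}" using countable_lie_group_isolated[OF L] by blast
  then have "openin (top_of_set ?D) {h x}"
    using homeomorphic_map_openness[OF h, of "{x}"] x by simp
  then obtain e where "e > 0" "\<forall>y\<in>?D. dist y (h x) < e \<longrightarrow> y \<in> {h x}"
    unfolding openin_euclidean_subtopology_iff by blast
  then show False using dyadic_not_isolated[of "h x" e] im x by blast
qed

lemma realize_circle_subgroup:
  assumes "CARD('n::finite) \<ge> 2" and H: "incseq H" "\<And>k. finite (H k) \<and> subgroup (H k) circle_group"
  shows "\<exists>(M :: (complex^'n) set) p. spsc_hypersurface M \<and> p \<in> M \<and>
    topologically_isomorphic (Aut M p) (Aut_topology M p)
      (circle_group\<lparr>carrier := \<Union>k. H k\<rparr>) (top_of_set (\<Union>k. H k))"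
proof -
  obtain i0 b :: 'n where b: "b \<noteq> i0"
  proof -
    fix i0 :: 'n
    have "UNIV \<noteq> {i0}" using assms(1) by (metis card_1_singleton_iff One_nat_def Suc_1 Suc_n_not_le_n)
    then show thesis using that by blast
  qed
  note S = H(2)[unfolded subgroup_circle_iff]
  obtain u c \<delta> where "bumpy_sphere i0 H u c \<delta>"
  proof -
    have "\<exists>u c \<delta>. bumpy_sphere i0 H u c \<delta>"
    proof (rule exists_bumpy_sphere[OF b])
      show "norm \<zeta> = 1" if "\<zeta> \<in> H k" for \<zeta> k using S[of k] that by auto
      show "H j \<subseteq> H k" if "j \<le> k" for j k using H(1) that by (simp add: incseq_def)
    qed (use S in blast)+
    then show thesis using that by blast
  qed
  then interpret bumpy_sphere i0 H u c \<delta> .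
  show ?thesis using spsc_M zero_in_M Aut_M by blast
qed

theorem mainTheorem2:
  assumes "CARD('n::finite) \<ge> 2"
  shows "(\<forall>(G :: complex set) (H :: nat \<Rightarrow> complex set).
            incseq H \<and> (\<forall>k. finite (H k) \<and> subgroup (H k) circle_group) \<and> G = (\<Union>k. H k) \<longrightarrow>
            (\<exists>(M :: (complex^'n) set) p. spsc_hypersurface M \<and> p \<in> M \<and>
               topologically_isomorphic (Aut M p) (Aut_topology M p)
                 (circle_group\<lparr>carrier := G\<rparr>) (top_of_set G)))
       \<and> (let D = {exp (2 * of_real pi * \<i> * of_nat l / 2 ^ m) | l m :: nat. True} :: complex set in
            subgroup D circle_group \<and> countable D \<and> sphere 0 1 \<subseteq> closure D \<and>
            (\<exists>(M :: (complex^'n) set) p. spsc_hypersurface M \<and> p \<in> M \<and>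
               topologically_isomorphic (Aut M p) (Aut_topology M p)
                 (circle_group\<lparr>carrier := D\<rparr>) (top_of_set D) \<and>
               \<not> lie_group (Aut M p) (Aut_topology M p)))"
proof (rule conjI)
  show "\<forall>(G :: complex set) (H :: nat \<Rightarrow> complex set).
            incseq H \<and> (\<forall>k. finite (H k) \<and> subgroup (H k) circle_group) \<and> G = (\<Union>k. H k) \<longrightarrow>
            (\<exists>(M :: (complex^'n) set) p. spsc_hypersurface M \<and> p \<in> M \<and>
               topologically_isomorphic (Aut M p) (Aut_topology M p)
                 (circle_group\<lparr>carrier := G\<rparr>) (top_of_set G))"
    using realize_circle_subgroup[OF assms] by blast
next
  have D: "{exp (2 * of_real pi * \<i> * of_nat l / 2 ^ m) | l m :: nat. True} = (\<Union>m. range (dyadic m))"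
    unfolding dyadic_exp by blast
  have sub: "subgroup (\<Union>m. range (dyadic m)) circle_group"
    unfolding subgroup_circle_iff
  proof (intro conjI ballI)
    fix x y assume "x \<in> (\<Union>m. range (dyadic m))" "y \<in> (\<Union>m. range (dyadic m))"
    then obtain i j where "x \<in> range (dyadic i)" "y \<in> range (dyadic j)" by blast
    then have "x \<in> range (dyadic (max i j))" "y \<in> range (dyadic (max i j))"
      using monoD[OF dyadic_mono, of i "max i j"] monoD[OF dyadic_mono, of j "max i j"] by auto
    then have "x * y \<in> range (dyadic (max i j))"
      by (rule dyadic_subgroup(3))
    then show "x * y \<in> (\<Union>m. range (dyadic m))" by blast
  next
    show "(\<Union>m. range (dyadic m)) \<subseteq> sphere 0 1" using dyadic_subgroup(1) by (rule UN_least)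
    show "1 \<in> (\<Union>m. range (dyadic m))" using dyadic_subgroup(2)[of 0] by (rule UN_I[OF UNIV_I])
    fix x assume "x \<in> (\<Union>m. range (dyadic m))"
    then obtain i where "x \<in> range (dyadic i)" by blast
    then have "inverse x \<in> range (dyadic i)" by (rule dyadic_subgroup(4))
    then show "inverse x \<in> (\<Union>m. range (dyadic m))" by (rule UN_I[OF UNIV_I])
  qed
  obtain M :: "(complex^'n) set" and p where M: "spsc_hypersurface M" "p \<in> M"
    "topologically_isomorphic (Aut M p) (Aut_topology M p)
      (circle_group\<lparr>carrier := \<Union>m. range (dyadic m)\<rparr>) (top_of_set (\<Union>m. range (dyadic m)))"
    using realize_circle_subgroup[OF assms dyadic_mono] finite_dyadic subgroup_dyadic by blast
  have "countable (\<Union>m. range (dyadic m))" by simp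
  then show "let D = {exp (2 * of_real pi * \<i> * of_nat l / 2 ^ m) | l m :: nat. True} :: complex set in
            subgroup D circle_group \<and> countable D \<and> sphere 0 1 \<subseteq> closure D \<and>
            (\<exists>(M :: (complex^'n) set) p. spsc_hypersurface M \<and> p \<in> M \<and>
               topologically_isomorphic (Aut M p) (Aut_topology M p)
                 (circle_group\<lparr>carrier := D\<rparr>) (top_of_set D) \<and>
               \<not> lie_group (Aut M p) (Aut_topology M p))"
    unfolding Let_def D using sub dyadic_dense M not_lie_group_dyadic[OF M(3)] by blast
qed

end
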